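(* Let $c\in\mathbb{C}$ and let $n, m$ be integers with $1\leq m\leq n$. Let $f(z)$ be a nonconstant entire function of finite order such that $\Delta_c^n f(z)\not\equiv 0$, and let $a(z)\in S(f)$ be such that $\Delta_c^m a(z)\equiv 0$. If $f(z)-a(z)$, $\Delta_c^n f(z)$ and $\Delta_c^{n+1} f(z)$ share $0$ CM, then there is a nonzero constant $C$ such that $$\Delta_c f(z)\equiv C f(z)+\Delta_c a(z)-C a(z).$$
   Context: Difference operators: for a meromorphic function $f$ in $\mathbb{C}$, $\Delta_c f(z)=f(z+c)-f(z)$ and $\Delta_c^n f(z)=\Delta_c^{n-1}(\Delta_c f(z))$ for $n\geq 2$. Let $T(r,f)$ be the Nevanlinna characteristic of $f$; finite order means $\rho(f)=\limsup_{r\to\infty}\frac{\log^+ T(r,f)}{\log r}<\infty$. $S(r,f)$ denotes any quantity that is $o(T(r,f))$ as $r\to\infty$ outside a possible exceptional set of finite logarithmic measure; a meromorphic function $\varphi$ is a small function of $f$ if $T(r,\varphi)=S(r,f)$, and $S(f)$ is the family of all small functions of $f$. Functions share $0$ CM if they all have the same zeros, counting multiplicities. *)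

theory Defs
  imports "HOL-Complex_Analysis.Complex_Analysis" "HOL-Library.Landau_Symbols"
    "HOL-Library.Extended_Nat"
begin

text \<open>
  A meromorphic function in the plane is a total function \<open>f\<close> with \<open>f meromorphic_on UNIV\<close>. Its
  values at poles carry no meaning, and its values on a sparse set may be arbitrary. Everything
  below is insensitive to such values. An identity between meromorphic functions is accordingly an
  identity off a sparse set, written \<open>\<forall>\<^sub>\<approx>z. f z = g z\<close>; for holomorphic \<open>f\<close> and \<open>g\<close> this means
  \<open>f = g\<close>.
\<close>

definition fwd_diff :: "complex \<Rightarrow> (complex \<Rightarrow> complex) \<Rightarrow> complex \<Rightarrow> complex" where
  "fwd_diff c f = (\<lambda>z. f (z + c) - f z)"

text \<open>At \<open>x = 0\<close> the value is \<open>0\<close>, as it should be, because \<open>ln 0 = 0\<close>.\<close>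
definition ln_plus :: "real \<Rightarrow> real" where
  "ln_plus x = max 0 (ln x)"

definition proximity :: "(complex \<Rightarrow> complex) \<Rightarrow> real \<Rightarrow> real" where
  "proximity f r =
     integral {0..2 * pi} (\<lambda>\<theta>. ln_plus (cmod (f (of_real r * cis \<theta>)))) / (2 * pi)"

definition pole_count :: "(complex \<Rightarrow> complex) \<Rightarrow> real \<Rightarrow> real" where
  "pole_count f t = (\<Sum>z | cmod z \<le> t \<and> is_pole f z. real_of_int (- zorder f z))"

definition pole_counting :: "(complex \<Rightarrow> complex) \<Rightarrow> real \<Rightarrow> real" where
  "pole_counting f r =
     integral {0..r} (\<lambda>t. (pole_count f t - pole_count f 0) / t) + pole_count f 0 * ln r"

definition nevanlinna_char :: "(complex \<Rightarrow> complex) \<Rightarrow> real \<Rightarrow> real" where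
  "nevanlinna_char f r = proximity f r + pole_counting f r"

definition growth_order :: "(complex \<Rightarrow> complex) \<Rightarrow> ereal" where
  "growth_order f = Limsup at_top (\<lambda>r. ereal (ln_plus (nevanlinna_char f r) / ln r))"

definition finite_log_measure :: "real set \<Rightarrow> bool" where
  "finite_log_measure E \<longleftrightarrow>
     E \<in> sets lebesgue \<and> E \<subseteq> {1..} \<and> (\<integral>\<^sup>+ r \<in> E. ennreal (1 / r) \<partial>lebesgue) < \<infinity>"

text \<open>The set \<open>S(f)\<close> of small functions of \<open>f\<close>.\<close>
definition small_functions :: "(complex \<Rightarrow> complex) \<Rightarrow> (complex \<Rightarrow> complex) set" where
  "small_functions f = {\<phi>. \<phi> meromorphic_on UNIV \<and>
     (\<exists>E. finite_log_measure E \<and>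
        nevanlinna_char \<phi> \<in> o[inf at_top (principal (- E))](nevanlinna_char f))}"

text \<open>
  A function that vanishes identically near \<open>z\<close> has a zero of infinite multiplicity there; in
  particular the zero function has a zero at every point. Note that \<open>zorder\<close> alone is unsuitable
  here: it is unspecified in that case, and it is negative at poles.
\<close>
definition zero_mult :: "(complex \<Rightarrow> complex) \<Rightarrow> complex \<Rightarrow> enat" where
  "zero_mult g z =
     (if \<forall>\<^sub>F w in at z. g w = 0 then \<infinity>
      else if isolated_zero g z then enat (nat (zorder g z))
      else 0)"

definition share_zero_CM :: "(complex \<Rightarrow> complex) set \<Rightarrow> bool" where
  "share_zero_CM G \<longleftrightarrow> (\<forall>g\<in>G. \<forall>h\<in>G. \<forall>z. zero_mult g z = zero_mult h z)"

end

theory Submission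
  imports Defs "HOL-Computational_Algebra.Fundamental_Theorem_Algebra"
begin

text \<open>
  Write \<open>u = \<Delta>\<^sup>n f\<close> and \<open>\<beta> = \<Delta>\<^sup>n\<^sup>+\<^sup>1 f / u\<close>. As zeros are shared, \<open>\<beta>\<close> is zero-free of finite order,
  so \<open>\<beta> = exp P\<close> for a polynomial \<open>P\<close>, and \<open>u (z + c) = (1 + \<beta> z) u z\<close>. The quotient
  \<open>E = u / (f - a)\<close> is entire of finite order: its zeros are the poles of \<open>a\<close>, and \<open>u\<close> does not
  vanish there. Since \<open>\<Delta>\<^sup>n a = 0\<close>, the function \<open>u / E\<close> satisfies \<open>\<Delta>\<^sup>n (u / E) = u\<close>, which after division
  by \<open>u\<close> expresses \<open>E\<close> through the quotients \<open>E z / E (z + k c)\<close> and the values \<open>\<beta> (z + j c)\<close>. The former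
  are small (a difference analogue of the lemma on the logarithmic derivative), whence
  \<open>log |E| = O(r\<^sup>p)\<close> with \<open>p = degree P\<close>. If \<open>p = 0\<close>, then \<open>E\<close> is constant by Liouville's theorem, and
  the claim follows with \<open>C = \<beta>\<close>.

  Assume \<open>p > 0\<close>. At the zeros of \<open>1 + \<beta>\<close> the difference equation degenerates and gives
  \<open>E z / E (z - c) = n + 1 - n exp (P (z - c) - P z)\<close>. There are at least \<open>const r\<^sup>p\<close> such zeros in a disc, while
  both sides have smaller growth and few poles, so this is an identity. The multiplicity of
  the zeros of \<open>E\<close> is maximal along every chain \<open>w + \<int> c\<close> with fewer than \<open>m\<close> exceptions, because the
  leading Laurent coefficients of \<open>a\<close> depend on the index as a polynomial of degree less than
  \<open>m\<close>. Hence the right-hand side has no zeros, so \<open>P\<close> is linear; letting \<open>\<beta>\<close> tend to \<open>0\<close> shows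
  that \<open>\<beta>\<close> has period \<open>c\<close>. Then \<open>u z = (1 + \<beta> z)\<^sup>k u (z - k c)\<close> for all \<open>k\<close>, and \<open>u\<close> would have a zero of
  infinite order.
\<close>

section \<open>Zeros of entire functions\<close>

text \<open>The obstacle is that \<open>a\<close> may have infinitely many poles, so that
  \<open>E\<close> may have zeros; a zero-free \<open>E\<close> of finite order would be the
  exponential of a polynomial at once. These zeros are controlled only by
  \<open>\<Delta>\<^sup>m a = 0\<close>, through multiplicities along chains. Growth is estimated in
  discs: the zeros in a disc are divided out, and a logarithm of the zero-free rest is bounded. Bad
  circles are avoided by averaging: the logarithmic singularity at a zero is dominated by
  \<open>1 / sqrt \<bar>t - \<rho>\<bar>\<close>, which is integrable, so that the mean over
  \<open>{r..2 * r}\<close> yields one radius \<open>t\<close> that suits all zeros. The price is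
  that a difference quotient gains only \<open>sqrt r\<close> in the exponent instead of nearly
  \<open>r\<close>. This half-order is enough twice: it lets the growth of \<open>E\<close> be
  lowered step by step, and it puts the quotient \<open>E z / E (z - c)\<close> below the number of
  zeros of \<open>1 + \<beta>\<close>.\<close>

abbreviation zmult :: "(complex \<Rightarrow> complex) \<Rightarrow> complex \<Rightarrow> nat" where
  "zmult F w \<equiv> nat (zorder F w)"

text \<open>Unlike a bound on \<open>zorder\<close>, divisibility makes sense for the zero function
  and passes to sums. The cofactor is entire, not merely local, so that it can be divided
  again.\<close>

definition zdvd :: "complex \<Rightarrow> nat \<Rightarrow> (complex \<Rightarrow> complex) \<Rightarrow> bool" where
  "zdvd w k F \<longleftrightarrow> (\<exists>g. g holomorphic_on UNIV \<and> (\<forall>z. F z = (z - w) ^ k * g z))"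

lemma holomorphic_patch:
  assumes "F holomorphic_on S" "open S" "G holomorphic_on T" "open T"
    and "\<And>z. z \<in> S \<Longrightarrow> z \<in> T \<Longrightarrow> F z = G z" "S \<union> T = U"
  shows "(\<lambda>z. if z \<in> S then F z else G z) holomorphic_on U"
proof -
  let ?h = "\<lambda>z. if z \<in> S then F z else G z"
  have "?h holomorphic_on S"
    using assms(1) by (rule holomorphic_transform) auto
  moreover have "?h holomorphic_on T"
    using assms(3) by (rule holomorphic_transform) (auto simp: assms)
  ultimately show ?thesis
    using holomorphic_on_Un[of ?h S T] assms by auto
qed

text \<open>Away from \<open>w\<close> the cofactor can only be \<open>F z / (z - w) ^ k\<close>, so
  a local cofactor extends by patching.\<close>

lemma zdvd_local:
  assumes F: "F holomorphic_on UNIV" and g: "g holomorphic_on S" "open S" "w \<in> S"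
    and eq: "\<And>z. z \<in> S \<Longrightarrow> F z = (z - w) ^ k * g z"
  obtains G where "G holomorphic_on UNIV" "G w = g w" "\<And>z. F z = (z - w) ^ k * G z"
proof -
  let ?G = "\<lambda>z. if z \<in> S then g z else F z / (z - w) ^ k"
  have "?G holomorphic_on UNIV"
    by (rule holomorphic_patch[where T = "- {w}"])
      (use assms in \<open>auto intro!: holomorphic_intros intro: holomorphic_on_subset\<close>)
  moreover have "F z = (z - w) ^ k * ?G z" for z
    using eq g by auto
  ultimately show ?thesis
    using that[of ?G] g by auto
qed

lemma zdvd_zmult:
  assumes F: "F holomorphic_on UNIV" "\<exists>z. F z \<noteq> 0"
  obtains g where "g holomorphic_on UNIV" "g w \<noteq> 0" "\<And>z. F z = (z - w) ^ zmult F w * g z"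
proof -
  obtain r where r: "r > 0" "zor_poly F w holomorphic_on cball w r"
    "\<forall>z\<in>cball w r. F z = zor_poly F w z * (z - w) ^ zmult F w \<and> zor_poly F w z \<noteq> 0"
    using zorder_exist_zero[of F UNIV w] F by auto
  have *: "zor_poly F w holomorphic_on ball w r"
    using r(2) by (rule holomorphic_on_subset) auto
  show ?thesis
    by (rule zdvd_local[OF F(1) *, of w "zmult F w"])
      (use r that in \<open>auto simp: mult.commute less_imp_le\<close>)
qed

lemma zmult_eqI:
  assumes "g holomorphic_on UNIV" "g w \<noteq> 0" "\<And>z. F z = (z - w) ^ k * g z"
  shows "zorder F w = int k" "zmult F w = k"
proof -
  show "zorder F w = int k"
    by (rule zorder_eqI[of UNIV _ g]) (use assms in \<open>auto simp: mult.commute\<close>)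
  then show "zmult F w = k" by simp
qed

lemma zdvd_le_zmult:
  assumes F: "F holomorphic_on UNIV" "\<exists>z. F z \<noteq> 0" and "zdvd w k F"
  shows "k \<le> zmult F w"
proof -
  obtain g where g: "g holomorphic_on UNIV" "\<And>z. F z = (z - w) ^ k * g z"
    using assms(3) unfolding zdvd_def by auto
  have "\<exists>z. g z \<noteq> 0" using F g by force
  then obtain h where h: "h holomorphic_on UNIV" "h w \<noteq> 0" "\<And>z. g z = (z - w) ^ zmult g w * h z"
    using zdvd_zmult[OF g(1)] by blast
  have "zmult F w = k + zmult g w"
  proof (rule zmult_eqI(2)[OF h(1,2)])
    show "F z = (z - w) ^ (k + zmult g w) * h z" for z
      by (simp only: g(2)[of z] h(3)[of z] power_add mult.assoc)
  qed
  then show ?thesis by simp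
qed

lemma zmult_pos_iff:
  assumes F: "F holomorphic_on UNIV" "\<exists>z. F z \<noteq> 0"
  shows "zmult F w > 0 \<longleftrightarrow> F w = 0" "zorder F w \<ge> 0"
proof -
  have *: "if F w = 0 then zorder F w > 0 else zorder F w = 0"
    using zorder_exist_zero[OF F(1) open_UNIV connected_UNIV UNIV_I, of w] F(2) by simp
  then show "zmult F w > 0 \<longleftrightarrow> F w = 0" "zorder F w \<ge> 0"
    by (auto split: if_splits)
qed

lemma zdvd_mono: "zdvd w k F \<Longrightarrow> l \<le> k \<Longrightarrow> zdvd w l F"
  unfolding zdvd_def
proof (elim exE conjE)
  fix g assume l: "l \<le> k" and g: "g holomorphic_on UNIV" "\<forall>z. F z = (z - w) ^ k * g z"
  show "\<exists>g. g holomorphic_on UNIV \<and> (\<forall>z. F z = (z - w) ^ l * g z)"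
    by (rule exI[of _ "\<lambda>z. (z - w) ^ (k - l) * g z"])
      (use l g in \<open>auto intro!: holomorphic_intros simp: power_add[symmetric] mult.assoc[symmetric]\<close>)
qed

lemma zdvd_iff:
  assumes F: "F holomorphic_on UNIV" "\<exists>z. F z \<noteq> 0"
  shows "zdvd w k F \<longleftrightarrow> k \<le> zmult F w"
  using zdvd_le_zmult[OF assms] zdvd_zmult[OF assms, of w] zdvd_mono[of w "zmult F w" F k]
  unfolding zdvd_def by metis

lemma zdvd_mult: "zdvd w k F \<Longrightarrow> zdvd w l G \<Longrightarrow> zdvd w (k + l) (\<lambda>z. F z * G z)"
  unfolding zdvd_def
proof (elim exE conjE)
  fix f g assume "f holomorphic_on UNIV" "\<forall>z. F z = (z - w) ^ k * f z"
    "g holomorphic_on UNIV" "\<forall>z. G z = (z - w) ^ l * g z"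
  then show "\<exists>g. g holomorphic_on UNIV \<and> (\<forall>z. F z * G z = (z - w) ^ (k + l) * g z)"
    by (intro exI[of _ "\<lambda>z. f z * g z"]) (auto intro!: holomorphic_intros simp: power_add)
qed

lemma zdvd_add: "zdvd w k F \<Longrightarrow> zdvd w k G \<Longrightarrow> zdvd w k (\<lambda>z. F z + G z)"
  unfolding zdvd_def
proof (elim exE conjE)
  fix f g assume "f holomorphic_on UNIV" "\<forall>z. F z = (z - w) ^ k * f z"
    "g holomorphic_on UNIV" "\<forall>z. G z = (z - w) ^ k * g z"
  then show "\<exists>g. g holomorphic_on UNIV \<and> (\<forall>z. F z + G z = (z - w) ^ k * g z)"
    by (intro exI[of _ "\<lambda>z. f z + g z"]) (auto intro!: holomorphic_intros simp: algebra_simps)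
qed

lemma zdvd_0: "F holomorphic_on UNIV \<Longrightarrow> zdvd w 0 F"
  unfolding zdvd_def by auto

lemma zdvd_1:
  assumes F: "F holomorphic_on UNIV" "F w = 0"
  shows "zdvd w 1 F"
proof (cases "\<exists>z. F z \<noteq> 0")
  case True
  then show ?thesis using zdvd_iff[OF F(1) True, of w 1] zmult_pos_iff(1)[OF F(1) True, of w] F
    by simp
next
  case False
  then show ?thesis unfolding zdvd_def by (intro exI[of _ "\<lambda>_. 0"]) auto
qed

lemma zdvd_multL: "zdvd w k F \<Longrightarrow> G holomorphic_on UNIV \<Longrightarrow> zdvd w k (\<lambda>z. F z * G z)"
  using zdvd_mult[of w k F 0 G] zdvd_0 by simp

lemma zdvd_prod:
  assumes F: "F holomorphic_on UNIV" and "finite W" "\<And>w. w \<in> W \<Longrightarrow> zdvd w (k w) F"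
  shows "\<exists>g. g holomorphic_on UNIV \<and> (\<forall>z. F z = (\<Prod>w\<in>W. (z - w) ^ k w) * g z)"
  using assms(2,3)
proof (induction W rule: finite_induct)
  case empty
  then show ?case using F by auto
next
  case (insert w W)
  then obtain g where g: "g holomorphic_on UNIV" "\<And>z. F z = (\<Prod>w\<in>W. (z - w) ^ k w) * g z"
    by auto
  let ?p = "\<lambda>z. \<Prod>w\<in>W. (z - w) ^ k w"
  obtain h where h: "h holomorphic_on UNIV" "\<And>z. F z = (z - w) ^ k w * h z"
    using insert.prems[of w] unfolding zdvd_def by auto
  \<comment> \<open>Near \<open>w\<close> the product over \<open>W\<close> has no zeros, so
    dividing it out of \<open>h\<close> gives a local cofactor of \<open>g\<close> at
    \<open>w\<close>.\<close>
  have o: "open (- W)" using insert by (simp add: finite_imp_closed open_Compl)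
  have q: "(\<lambda>z. h z / ?p z) holomorphic_on (- W)"
    using h(1) insert.hyps by (auto intro!: holomorphic_intros intro: holomorphic_on_subset)
  obtain G where G: "G holomorphic_on UNIV" "\<And>z. g z = (z - w) ^ k w * G z"
  proof (rule zdvd_local[OF g(1) q o])
    show "w \<in> - W" using insert by auto
    fix z assume z: "z \<in> - W"
    then have "?p z \<noteq> 0" using insert.hyps by auto
    then show "g z = (z - w) ^ k w * (h z / ?p z)"
      using g(2)[of z] h(2)[of z] by (simp add: field_simps)
  qed auto
  show ?case
    by (rule exI[of _ G]) (use G insert g in \<open>auto simp: mult_ac\<close>)
qed

lemma finite_zeros_cball:
  assumes F: "F holomorphic_on UNIV" "\<exists>z. F z \<noteq> 0"
  shows "finite {w \<in> cball 0 R. F w = 0}"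
proof -
  have "finite (cball 0 R \<inter> {w. F w = 0})"
  proof (rule finite_not_islimpt_in_compact)
  show "\<not> w islimpt {w. F w = 0}" if "w \<in> cball 0 R" for w
  proof -
    have "\<forall>\<^sub>F z in at w. F z \<noteq> 0 \<and> z \<in> UNIV"
      using non_zero_neighbour_alt[of F UNIV w] F by auto
    then show ?thesis
      unfolding islimpt_iff_eventually by (auto elim: eventually_mono)
  qed
qed auto
  moreover have "cball 0 R \<inter> {w. F w = 0} = {w \<in> cball 0 R. F w = 0}" by auto
  ultimately show ?thesis by metis
qed

lemma entire_eventually_nonzero:
  assumes F: "F holomorphic_on UNIV" "\<exists>z. F z \<noteq> 0"
  shows "\<forall>\<^sub>F z in at w. F z \<noteq> 0"
  using non_zero_neighbour_alt[of F UNIV w] F by (auto elim: eventually_mono)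

lemma factor_zeros_cball:
  assumes F: "F holomorphic_on UNIV" "\<exists>z. F z \<noteq> 0" and W: "W = {w \<in> cball 0 R. F w = 0}"
  obtains h where "h holomorphic_on UNIV" "\<And>z. z \<in> cball 0 R \<Longrightarrow> h z \<noteq> 0"
    "\<And>z. F z = (\<Prod>w\<in>W. (z - w) ^ zmult F w) * h z"
proof -
  have fin: "finite W" using finite_zeros_cball[OF F, of R] W by simp
  have "\<exists>g. g holomorphic_on UNIV \<and> (\<forall>z. F z = (\<Prod>w\<in>W. (z - w) ^ zmult F w) * g z)"
    by (rule zdvd_prod[OF F(1) fin]) (simp add: zdvd_iff[OF F])
  then obtain h where h: "h holomorphic_on UNIV" "\<And>z. F z = (\<Prod>w\<in>W. (z - w) ^ zmult F w) * h z"
    by auto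
  \<comment> \<open>A zero of \<open>h\<close> in the disc would be a zero of \<open>F\<close>,
    hence in \<open>W\<close>, and would raise the order of \<open>F\<close> there above
    \<open>zmult\<close>.\<close>
  have "h z \<noteq> 0" if "z \<in> cball 0 R" for z
  proof
    assume hz: "h z = 0"
    then have "F z = 0" using h(2)[of z] by (metis mult_zero_right)
    then have z: "z \<in> W" using that W by simp
    have *: "(\<lambda>y. \<Prod>w\<in>W. (y - w) ^ zmult F w)
        = (\<lambda>y. (y - z) ^ zmult F z * (\<Prod>w\<in>W - {z}. (y - w) ^ zmult F w))"
      using prod.remove[OF fin z] by blast
    have A: "zdvd z (zmult F z + 1) (\<lambda>y. (\<Prod>w\<in>W. (y - w) ^ zmult F w) * h y)"
    proof (rule zdvd_mult)
      show "zdvd z 1 h" by (rule zdvd_1[OF h(1) hz])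
      show "zdvd z (zmult F z) (\<lambda>y. \<Prod>w\<in>W. (y - w) ^ zmult F w)"
        unfolding zdvd_def *
        by (intro exI[of _ "\<lambda>y. \<Prod>w\<in>W - {z}. (y - w) ^ zmult F w"])
          (auto intro!: holomorphic_intros)
    qed
    have B: "F = (\<lambda>y. (\<Prod>w\<in>W. (y - w) ^ zmult F w) * h y)"
      by (rule ext) (rule h(2))
    have "zdvd z (zmult F z + 1) F"
      by (rule ssubst[where P = "zdvd z (zmult F z + 1)", OF B A])
    from zdvd_le_zmult[OF F this] show False by simp
  qed
  with h show ?thesis by (intro that)
qed


section \<open>Logarithms of zero-free factors and averaging over circles\<close>

text \<open>After normalisation this is the Schwarz lemma: \<open>H\<close> maps into a half-plane,
  which a Moebius map carries to the unit disc.\<close>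

lemma Borel_Caratheodory:
  assumes hol: "H holomorphic_on ball z0 R" and R: "R > 0"
    and M: "\<And>z. z \<in> ball z0 R \<Longrightarrow> Re (H z) \<le> M" and z: "z \<in> cball z0 (R / 2)"
  shows "cmod (H z - H z0) \<le> 2 * (M - Re (H z0))"
proof (rule field_le_epsilon)
  fix e :: real assume e: "e > 0"
  \<comment> \<open>The surplus \<open>e / 2\<close> makes the real part of \<open>G\<close>
    strictly positive even where \<open>Re (H z) = M\<close>.\<close>
  define M' where "M' = M + e / 2"
  define G0 where "G0 = of_real M' - H z0"
  define G where "G = (\<lambda>\<zeta>. of_real M' - H (z0 + of_real R * \<zeta>))"
  \<comment> \<open>Composition with the Moebius map of the right half-plane onto the unit disc that
    sends \<open>G0\<close> to \<open>0\<close>.\<close>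
  define \<phi> where "\<phi> = (\<lambda>\<zeta>. (G \<zeta> - G0) / (G \<zeta> + cnj G0))"
  have inb: "z0 + of_real R * \<zeta> \<in> ball z0 R" if "cmod \<zeta> < 1" for \<zeta>
    using that R by (simp add: dist_norm norm_mult)
  have ReG0: "Re G0 > 0" using M[of z0] R e by (simp add: G0_def M'_def)
  have ReG: "Re (G \<zeta>) > 0" if "cmod \<zeta> < 1" for \<zeta>
    using M[OF inb[OF that]] e by (simp add: G_def M'_def)
  have nz: "G \<zeta> + cnj G0 \<noteq> 0" if "cmod \<zeta> < 1" for \<zeta>
  proof
    assume "G \<zeta> + cnj G0 = 0"
    then have "Re (G \<zeta> + cnj G0) = 0" by simp
    then show False using ReG[OF that] ReG0 by simp
  qed
  have Ghol: "G holomorphic_on ball 0 1"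
    unfolding G_def
    by (intro holomorphic_intros holomorphic_on_compose_gen[OF _ hol, unfolded o_def])
      (use inb in auto)
  have hphi: "\<phi> holomorphic_on ball 0 1"
    unfolding \<phi>_def by (intro holomorphic_intros Ghol) (use nz in auto)
  have phi0: "\<phi> 0 = 0" by (simp add: \<phi>_def G_def G0_def)
  have lt: "cmod (\<phi> \<zeta>) < 1" if "cmod \<zeta> < 1" for \<zeta>
  proof -
    have "(cmod (G \<zeta> - G0))\<^sup>2 < (cmod (G \<zeta> + cnj G0))\<^sup>2"
      using mult_pos_pos[OF ReG[OF that] ReG0]
      unfolding cmod_power2 by (simp add: power2_eq_square algebra_simps)
    then have "cmod (G \<zeta> - G0) < cmod (G \<zeta> + cnj G0)"
      using power2_less_imp_less norm_ge_zero by blast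
    then show ?thesis
      using nz[OF that] by (simp add: \<phi>_def norm_divide)
  qed
  define \<zeta> where "\<zeta> = (z - z0) / of_real R"
  have s: "cmod \<zeta> \<le> 1 / 2"
    using z R by (simp add: \<zeta>_def dist_norm norm_divide norm_minus_commute field_simps)
  have zz: "z0 + of_real R * \<zeta> = z" using R by (simp add: \<zeta>_def)
  have "cmod (\<phi> \<zeta>) \<le> cmod \<zeta>"
    using Schwarz_Lemma(1)[OF hphi phi0 lt] s by simp
  then have a: "cmod (\<phi> \<zeta>) \<le> 1 / 2" using s by simp
  \<comment> \<open>To solve for \<open>G \<zeta> - G0\<close>, write
    \<open>G \<zeta> + cnj G0\<close> as \<open>(G \<zeta> - G0) + 2 * Re G0\<close> and absorb the
    first part, whose factor is at most \<open>1 / 2\<close>.\<close>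
  have "G \<zeta> - G0 = \<phi> \<zeta> * (G \<zeta> + cnj G0)"
    using nz[of \<zeta>] s by (simp add: \<phi>_def)
  also have "\<dots> = \<phi> \<zeta> * (G \<zeta> - G0) + \<phi> \<zeta> * of_real (2 * Re G0)"
    by (simp add: complex_eq_iff algebra_simps)
  finally have "cmod (G \<zeta> - G0) \<le> cmod (\<phi> \<zeta>) * cmod (G \<zeta> - G0) + cmod (\<phi> \<zeta>) * (2 * Re G0)"
    using ReG0 norm_triangle_ineq[of "\<phi> \<zeta> * (G \<zeta> - G0)" "\<phi> \<zeta> * of_real (2 * Re G0)"]
    by (simp add: norm_mult del: of_real_mult)
  also have "\<dots> \<le> 1 / 2 * cmod (G \<zeta> - G0) + 1 / 2 * (2 * Re G0)"
    using a ReG0 by (intro add_mono mult_right_mono) auto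
  finally have "cmod (G \<zeta> - G0) \<le> 2 * Re G0" by simp
  moreover have "G \<zeta> - G0 = - (H z - H z0)" by (simp add: G_def G0_def zz)
  ultimately have "cmod (H z - H z0) \<le> 2 * Re G0" by (simp only: norm_minus_cancel)
  then show "cmod (H z - H z0) \<le> 2 * (M - Re (H z0)) + e"
    by (simp add: G0_def M'_def)
qed

text \<open>The real \<open>sqrt\<close> is an odd function, so negative arguments matter. The
  factor \<open>2\<close> is due to \<open>y < 0 \<le> x\<close>, where both roots contribute up to
  \<open>sqrt (x - y)\<close>.\<close>

lemma sqrt_diff_le:
  fixes x y :: real assumes "y \<le> x" shows "sqrt x - sqrt y \<le> 2 * sqrt (x - y)"
proof -
  have sub: "sqrt p \<le> sqrt q + sqrt (p - q)" if "0 \<le> q" "q \<le> p" for p q :: real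
    using sqrt_add_le_add_sqrt[of q "p - q"] that by simp
  have nn: "0 \<le> sqrt (x - y)" using assms by simp
  consider "y \<ge> 0" | "y < 0" "x \<ge> 0" | "x < 0" by linarith
  then show ?thesis
  proof cases
    case 1 then show ?thesis using sub[of y x] assms nn by linarith
  next
    case 2
    have "sqrt x \<le> sqrt (x - y)" "sqrt (- y) \<le> sqrt (x - y)" using 2 by auto
    then show ?thesis using real_sqrt_minus[of y] by linarith
  next
    case 3
    then have "- sqrt y \<le> - sqrt x + sqrt (x - y)"
      using sub[of "- x" "- y"] assms real_sqrt_minus[of x] real_sqrt_minus[of y] by simp
    then show ?thesis using nn by linarith
  qed
qed

text \<open>Since \<open>sqrt\<close> is odd, the single expression
  \<open>2 * sqrt (t - \<rho>)\<close> is a continuous primitive on both sides of the singularity,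
  wherever \<rho> lies relative to the interval.\<close>

lemma has_integral_inverse_sqrt:
  fixes a b \<rho> :: real assumes "a \<le> b"
  shows "((\<lambda>t. 1 / sqrt \<bar>t - \<rho>\<bar>) has_integral (2 * sqrt (b - \<rho>) - 2 * sqrt (a - \<rho>))) {a..b}"
proof (rule fundamental_theorem_of_calculus_strong[of "{\<rho>}"])
  fix x assume x: "x \<in> {a..b} - {\<rho>}"
  show "((\<lambda>t. 2 * sqrt (t - \<rho>)) has_vector_derivative 1 / sqrt \<bar>x - \<rho>\<bar>) (at x)"
  proof (cases "x > \<rho>")
    case True
    then have "((\<lambda>t. 2 * sqrt (t - \<rho>)) has_real_derivative 1 / sqrt (x - \<rho>)) (at x)"
      by (auto intro!: derivative_eq_intros simp: field_simps)
    with True show ?thesis by (simp add: has_real_derivative_iff_has_vector_derivative)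
  next
    case False
    then have "((\<lambda>t. - 2 * sqrt (\<rho> - t)) has_real_derivative 1 / sqrt (\<rho> - x)) (at x)"
      using x by (auto intro!: derivative_eq_intros simp: field_simps)
    moreover have "(\<lambda>t. - 2 * sqrt (\<rho> - t)) = (\<lambda>t. 2 * sqrt (t - \<rho>))"
      using real_sqrt_minus by (metis (no_types, opaque_lifting) minus_diff_eq minus_mult_commute)
    ultimately show ?thesis using False by (simp add: has_real_derivative_iff_has_vector_derivative)
  qed
qed (use assms in \<open>auto intro!: continuous_intros\<close>)

text \<open>An averaging argument: each \<open>1 / sqrt \<bar>t - \<rho> i\<bar>\<close> has
  integral at most \<open>4 * sqrt r\<close> over an interval of length \<open>r\<close>. A sum
  above \<open>5 / sqrt r\<close> times the total weight at all admissible points would have too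
  large an integral.\<close>

lemma good_radius:
  fixes w \<rho> :: "'a \<Rightarrow> real"
  assumes I: "finite I" and w: "\<And>i. i \<in> I \<Longrightarrow> 0 \<le> w i" and S: "finite S" and r: "r > 0"
  obtains t where "t \<in> {r..2 * r}" "t \<notin> S" "\<And>i. i \<in> I \<Longrightarrow> t \<noteq> \<rho> i"
    "(\<Sum>i\<in>I. w i / sqrt \<bar>t - \<rho> i\<bar>) \<le> 5 * (\<Sum>i\<in>I. w i) / sqrt r"
proof -
  define N where "N = (\<Sum>i\<in>I. w i)"
  have N: "N \<ge> 0" unfolding N_def using w by (rule sum_nonneg)
  define S' where "S' = S \<union> \<rho> ` I"
  have S': "finite S'" using I S by (simp add: S'_def)
  define \<phi> where "\<phi> = (\<lambda>t. \<Sum>i\<in>I. w i / sqrt \<bar>t - \<rho> i\<bar>)"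
  define J where "J = (\<Sum>i\<in>I. w i * (2 * sqrt (2 * r - \<rho> i) - 2 * sqrt (r - \<rho> i)))"
  have J: "(\<phi> has_integral J) {r..2 * r}"
    unfolding \<phi>_def J_def
    using has_integral_mult_right[OF has_integral_inverse_sqrt[of r "2 * r"]] r
    by (intro has_integral_sum I) (simp add: divide_inverse)
  have "J \<le> (\<Sum>i\<in>I. w i * (4 * sqrt r))"
    unfolding J_def
  proof (intro sum_mono mult_left_mono w)
    fix i
    show "2 * sqrt (2 * r - \<rho> i) - 2 * sqrt (r - \<rho> i) \<le> 4 * sqrt r"
      using sqrt_diff_le[of "r - \<rho> i" "2 * r - \<rho> i"] r by simp
  qed
  then have J4: "J \<le> N * (4 * sqrt r)" by (simp add: N_def sum_distrib_right)
  have "\<exists>t\<in>{r..2 * r} - S'. \<phi> t \<le> 5 * N / sqrt r"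
  proof (cases "N = 0")
    \<comment> \<open>For total weight \<open>0\<close> the comparison of \<open>4\<close> with
      \<open>5\<close> is not strict; the sum then vanishes, and any admissible point will
      do.\<close>
    case True
    have "infinite {r..2 * r}" using r by (simp add: infinite_Icc)
    then have "infinite ({r..2 * r} - S')" using S' by (rule Diff_infinite_finite[rotated])
    then obtain t where t: "t \<in> {r..2 * r} - S'" using infinite_imp_nonempty by blast
    have "\<forall>i\<in>I. w i = 0" using True I w unfolding N_def by (simp add: sum_nonneg_eq_0_iff)
    then have "\<phi> t = 0" by (simp add: \<phi>_def)
    then show ?thesis using t True by (intro bexI[of _ t]) auto
  next
    case False
    show ?thesis
    proof (rule ccontr)
      assume "\<not> ?thesis"
      then have ge: "5 * N / sqrt r \<le> \<phi> t" if "t \<in> {r..2 * r} - S'" for t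
        using that by force
      have "((\<lambda>t. 5 * N / sqrt r) has_integral (r * (5 * N / sqrt r))) {r..2 * r}"
        using has_integral_const_real[of "5 * N / sqrt r" r "2 * r"] r by simp
      moreover have "((\<lambda>t. if t \<in> S' then 5 * N / sqrt r else \<phi> t) has_integral J) {r..2 * r}"
        by (rule has_integral_spike_finite[OF S' _ J]) auto
      ultimately have "r * (5 * N / sqrt r) \<le> J"
        by (rule has_integral_le) (use ge in auto)
      also have "r * (5 * N / sqrt r) = 5 * N * sqrt r"
        using r real_div_sqrt[of r] by (simp add: field_simps)
      finally have "5 * N * sqrt r \<le> N * (4 * sqrt r)" using J4 by linarith
      then show False using False N r by simp
    qed
  qed
  then show ?thesis using that unfolding S'_def \<phi>_def N_def by blast
qed

lemma maximum_modulus_sphere: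
  assumes "F holomorphic_on UNIV" "\<And>z. cmod z = R \<Longrightarrow> cmod (F z) \<le> B" "cmod z \<le> R"
  shows "cmod (F z) \<le> B"
proof (rule maximum_modulus_frontier[of F "cball 0 R"])
  show "continuous_on (closure (cball 0 R)) F"
    using assms(1) holomorphic_on_imp_continuous_on holomorphic_on_subset by blast
qed (use assms in \<open>auto intro: holomorphic_on_subset\<close>)

text \<open>A Jensen-type argument. Normalised by \<open>2 * R\<close>, the factor of a zero of
  modulus at most \<open>R\<close> has modulus at least \<open>1\<close> on the circle of radius
  \<open>3 * R\<close> and at most \<open>1 / 2\<close> at \<open>0\<close>. The former carries the
  bound on \<open>F\<close> over to the zero-free part, the latter bounds the number of zeros.
  Borel-Caratheodory then controls the logarithm \<open>H\<close>.\<close>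

lemma disc_decomposition:
  assumes F: "F holomorphic_on UNIV" "F 0 \<noteq> 0" and R: "R > 0"
    and L: "\<And>z. cmod z = 3 * R \<Longrightarrow> cmod (F z) \<le> exp L"
    and W: "W = {w \<in> cball 0 R. F w = 0}" and D: "D = L - ln (cmod (F 0))"
  obtains H where
    "\<And>z. z \<in> ball 0 R \<Longrightarrow> F z = exp (H z) * (\<Prod>w\<in>W. ((z - w) / of_real (2 * R)) ^ zmult F w)"
    "(\<Sum>w\<in>W. real (zmult F w)) \<le> 2 * D"
    "Re (H 0) \<ge> ln (cmod (F 0))" "\<And>z. z \<in> ball 0 R \<Longrightarrow> Re (H z) \<le> L"
    "\<And>z. z \<in> cball 0 (R / 2) \<Longrightarrow> cmod (H z - H 0) \<le> 2 * D"
    "\<And>z z'. z \<in> cball 0 (R / 4) \<Longrightarrow> z' \<in> cball 0 (R / 4) \<Longrightarrow>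
        cmod (H z - H z') \<le> 8 * D / R * cmod (z - z')"
proof -
  have nt: "\<exists>z. F z \<noteq> 0" using F by auto
  have fin: "finite W" using finite_zeros_cball[OF F(1) nt] W by metis
  obtain h where h: "h holomorphic_on UNIV" "\<And>z. z \<in> cball 0 R \<Longrightarrow> h z \<noteq> 0"
    "\<And>z. F z = (\<Prod>w\<in>W. (z - w) ^ zmult F w) * h z"
    using factor_zeros_cball[OF F(1) nt W] by metis
  define N where "N = (\<Sum>w\<in>W. zmult F w)"
  define k where "k = (\<lambda>z. of_real (2 * R) ^ N * h z)"
  have k: "k holomorphic_on UNIV" unfolding k_def by (intro holomorphic_intros h)
  have knz: "k z \<noteq> 0" if "z \<in> cball 0 R" for z using h(2)[OF that] R by (simp add: k_def)
  have Fk: "F z = k z * (\<Prod>w\<in>W. ((z - w) / of_real (2 * R)) ^ zmult F w)" for z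
    using R fin by (simp add: h(3)[of z] k_def power_divide prod_dividef N_def power_sum)
  have nF: "cmod (F z) = cmod (k z) * (\<Prod>w\<in>W. (cmod (z - w) / (2 * R)) ^ zmult F w)" for z
    using R by (simp add: Fk[of z] norm_mult prod_norm[symmetric] norm_power norm_divide)
  have wR: "cmod w \<le> R" if "w \<in> W" for w using that W by simp
  have kle: "cmod (k z) \<le> exp L" if "cmod z = 3 * R" for z
  proof -
    have "1 \<le> (\<Prod>w\<in>W. (cmod (z - w) / (2 * R)) ^ zmult F w)"
    proof (intro prod_ge_1 one_le_power)
      fix w assume "w \<in> W"
      then have "cmod (z - w) \<ge> 2 * R" using norm_triangle_ineq2[of z w] wR that by force
      then show "1 \<le> cmod (z - w) / (2 * R)" using R by simp
    qed
    then have "cmod (k z) * 1 \<le> cmod (F z)" unfolding nF by (intro mult_left_mono) auto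
    then show ?thesis using L[OF that] by simp
  qed
  have kle': "cmod (k z) \<le> exp L" if "cmod z \<le> 3 * R" for z
    using maximum_modulus_sphere[OF k kle that] .
  obtain H where H: "H holomorphic_on cball 0 R" "\<And>z. z \<in> cball 0 R \<Longrightarrow> k z = exp (H z)"
  proof (rule contractible_imp_holomorphic_log[of k "cball 0 R"])
    show "k holomorphic_on cball 0 R" using k by (rule holomorphic_on_subset) simp
    show "contractible (cball (0::complex) R)" by (simp add: convex_imp_contractible)
  qed (use knz in auto)
  have Re: "Re (H z) = ln (cmod (k z))" if "z \<in> cball 0 R" for z
    using H(2)[OF that] by simp
  have Hb: "H holomorphic_on ball 0 R" using H(1) ball_subset_cball holomorphic_on_subset by blast
  have ReL: "Re (H z) \<le> L" if "z \<in> ball 0 R" for z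
  proof -
    have "cmod (k z) \<le> exp L" using kle' that R by simp
    then show ?thesis using H(2)[of z] that by simp
  qed
  have k0: "cmod (F 0) * 2 ^ N \<le> cmod (k 0)"
  proof -
    have "(\<Prod>w\<in>W. (cmod (0 - w) / (2 * R)) ^ zmult F w) \<le> (\<Prod>w\<in>W. (1 / 2) ^ zmult F w)"
      by (intro prod_mono conjI power_mono) (use wR R in \<open>auto simp: field_simps\<close>)
    also have "\<dots> = (1 / 2) ^ N" by (simp add: N_def power_sum)
    finally have "cmod (F 0) \<le> cmod (k 0) * (1 / 2) ^ N"
      unfolding nF[of 0] by (intro mult_left_mono) auto
    then show ?thesis by (simp add: field_simps)
  qed
  have "ln (cmod (F 0)) + N * ln 2 = ln (cmod (F 0) * 2 ^ N)"
    using F(2) by (simp add: ln_mult_pos ln_realpow)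
  also have "\<dots> \<le> ln (cmod (k 0))" 
    using k0 F(2) knz[of 0] R by (subst ln_le_cancel_iff) auto
  finally have a: "ln (cmod (F 0)) + N * ln 2 \<le> Re (H 0)" using Re[of 0] R by simp
  have ln2: "ln (2::real) \<ge> 1 / 2"
    using ln2_ge_two_thirds by simp
  have Nn: "real N / 2 \<le> N * ln 2" using mult_left_mono[OF ln2, of "real N"] by simp
  have b: "Re (H 0) \<ge> ln (cmod (F 0))"
    using a Nn by linarith
  have c: "real N \<le> 2 * D" using a Nn ReL[of 0] R D by simp
  have d: "cmod (H z - H 0) \<le> 2 * D" if "z \<in> cball 0 (R / 2)" for z
    using Borel_Caratheodory[OF Hb R ReL that] b D by simp
  have D0: "D \<ge> 0" using b ReL[of 0] R D by simp
  \<comment> \<open>Cauchy's estimate on discs of radius \<open>R / 4\<close>, which stay in the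
    disc of radius \<open>R / 2\<close> where \<open>H z - H 0\<close> is bounded by
    \<open>2 * D\<close>.\<close>
  have der: "cmod (deriv H z) \<le> 8 * D / R" if "z \<in> cball 0 (R / 4)" for z
  proof -
    have sub: "cball z (R / 4) \<subseteq> cball 0 (R / 2)"
    proof
      fix x assume "x \<in> cball z (R / 4)"
      then show "x \<in> cball 0 (R / 2)"
        using that norm_triangle_ineq[of "x - z" z] by (simp add: dist_norm norm_minus_commute)
    qed
    have sub2: "cball z (R / 4) \<subseteq> cball 0 R"
      using sub subset_cball[of "R / 2" R "0::complex"] R by simp
    have "cmod ((deriv ^^ 1) (\<lambda>z. H z - H 0) z) \<le> fact 1 * (2 * D) / (R / 4) ^ 1"
    proof (rule Cauchy_inequality)
      show "(\<lambda>z. H z - H 0) holomorphic_on ball z (R / 4)"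
        by (intro holomorphic_intros holomorphic_on_subset[OF H(1)])
          (use sub2 ball_subset_cball in blast)
      show "continuous_on (cball z (R / 4)) (\<lambda>z. H z - H 0)"
        by (intro continuous_intros holomorphic_on_imp_continuous_on holomorphic_on_subset[OF H(1)] sub2)
      fix x assume "cmod (z - x) = R / 4"
      then show "cmod (H x - H 0) \<le> 2 * D" using d sub by (auto simp: dist_norm)
    qed (use R in auto)
    moreover have "H field_differentiable at z"
      using Hb that R by (intro holomorphic_on_imp_differentiable_at[OF Hb]) auto
    then have "deriv (\<lambda>z. H z - H 0) z = deriv H z" by (simp add: deriv_diff)
    ultimately show ?thesis using R by simp
  qed
  have e: "cmod (H z - H z') \<le> 8 * D / R * cmod (z - z')"
    if "z \<in> cball 0 (R / 4)" "z' \<in> cball 0 (R / 4)" for z z'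
  proof (rule field_differentiable_bound[of "cball 0 (R / 4)" H "deriv H"])
    fix x assume "x \<in> cball (0::complex) (R / 4)"
    then have "x \<in> ball 0 R" using R by auto
    then show "(H has_field_derivative deriv H x) (at x within cball 0 (R / 4))"
      using holomorphic_derivI[OF Hb] by (meson has_field_derivative_at_within open_ball)
  qed (use der that in auto)
  show ?thesis
  proof (rule that[OF _ _ b ReL d e])
    show "F z = exp (H z) * (\<Prod>w\<in>W. ((z - w) / of_real (2 * R)) ^ zmult F w)" if "z \<in> ball 0 R" for z
      using Fk[of z] H(2)[of z] that by simp
    show "(\<Sum>w\<in>W. real (zmult F w)) \<le> 2 * D" using c by (simp add: N_def)
  qed
qed


section \<open>Growth of entire functions\<close>

text \<open>The parameter counts half-orders, because a difference quotient gains a factor \<open>sqrt r\<close>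
  in the exponent.\<close>

definition egrowth :: "(complex \<Rightarrow> complex) \<Rightarrow> nat \<Rightarrow> bool" where
  "egrowth F N \<longleftrightarrow> F holomorphic_on UNIV \<and>
     (\<exists>K. \<forall>z. cmod (F z) \<le> exp (K * sqrt (1 + cmod z) ^ N))"

lemma egrowth_hol: "egrowth F N \<Longrightarrow> F holomorphic_on UNIV"
  by (simp add: egrowth_def)

lemma sqrt_power_ge_1: "1 \<le> r \<Longrightarrow> 1 \<le> sqrt r ^ N"
  by (simp add: one_le_power)

lemma egrowthE:
  assumes "egrowth F N"
  obtains K where "K \<ge> 0" "\<And>z. cmod (F z) \<le> exp (K * sqrt (1 + cmod z) ^ N)"
proof -
  obtain K where K: "\<And>z. cmod (F z) \<le> exp (K * sqrt (1 + cmod z) ^ N)"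
    using assms egrowth_def by auto
  have "cmod (F z) \<le> exp (\<bar>K\<bar> * sqrt (1 + cmod z) ^ N)" for z
    using K[of z] by (rule order_trans) (auto intro!: mult_right_mono)
  then show ?thesis using that[of "\<bar>K\<bar>"] by auto
qed

lemma egrowth_mono:
  assumes "egrowth F N" "N \<le> M" shows "egrowth F M"
proof -
  obtain K where K: "K \<ge> 0" "\<And>z. cmod (F z) \<le> exp (K * sqrt (1 + cmod z) ^ N)"
    using egrowthE[OF assms(1)] by metis
  have "cmod (F z) \<le> exp (K * sqrt (1 + cmod z) ^ M)" for z
    using K(2)[of z] by (rule order_trans) (use K(1) assms in \<open>auto intro!: mult_left_mono power_increasing\<close>)
  then show ?thesis using assms(1) by (auto simp: egrowth_def)
qed

lemma egrowth_shift:
  assumes "egrowth F N" shows "egrowth (\<lambda>z. F (z + h)) N"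
proof -
  obtain K where K: "K \<ge> 0" "\<And>z. cmod (F z) \<le> exp (K * sqrt (1 + cmod z) ^ N)"
    using egrowthE[OF assms(1)] by metis
  have "cmod (F (z + h)) \<le> exp ((K * sqrt (1 + cmod h) ^ N) * sqrt (1 + cmod z) ^ N)" for z
  proof -
    have "1 + cmod (z + h) \<le> (1 + cmod h) * (1 + cmod z)"
      using norm_triangle_ineq[of z h] mult_nonneg_nonneg[OF norm_ge_zero[of h] norm_ge_zero[of z]]
      unfolding distrib_left distrib_right by linarith
    then have "sqrt (1 + cmod (z + h)) \<le> sqrt (1 + cmod h) * sqrt (1 + cmod z)"
      by (metis real_sqrt_le_mono real_sqrt_mult)
    then have "sqrt (1 + cmod (z + h)) ^ N \<le> sqrt (1 + cmod h) ^ N * sqrt (1 + cmod z) ^ N"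
      by (simp add: power_mono power_mult_distrib[symmetric])
    then have "K * sqrt (1 + cmod (z + h)) ^ N \<le> K * sqrt (1 + cmod h) ^ N * sqrt (1 + cmod z) ^ N"
      using K(1) by (simp add: mult_left_mono mult.assoc)
    then show ?thesis using K(2)[of "z + h"] by (meson exp_le_cancel_iff order_trans)
  qed
  moreover have "(\<lambda>z. F (z + h)) holomorphic_on UNIV"
    by (rule holomorphic_on_compose_gen[of "\<lambda>z. z + h" UNIV F UNIV, unfolded o_def])
      (use egrowth_hol[OF assms] in \<open>auto intro!: holomorphic_intros\<close>)
  ultimately show ?thesis unfolding egrowth_def by blast
qed

lemma egrowth_mult:
  assumes "egrowth F N" "egrowth G N" shows "egrowth (\<lambda>z. F z * G z) N"
proof -
  obtain K where K: "\<And>z. cmod (F z) \<le> exp (K * sqrt (1 + cmod z) ^ N)"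
    using egrowthE[OF assms(1)] by metis
  obtain L where L: "\<And>z. cmod (G z) \<le> exp (L * sqrt (1 + cmod z) ^ N)"
    using egrowthE[OF assms(2)] by metis
  have "cmod (F z * G z) \<le> exp ((K + L) * sqrt (1 + cmod z) ^ N)" for z
    using mult_mono[OF K[of z] L[of z]] by (simp add: norm_mult exp_add distrib_right)
  then show ?thesis
    using assms unfolding egrowth_def by (auto intro!: holomorphic_intros)
qed

lemma exp_add_exp_le:
  fixes x y s :: real assumes "0 \<le> x" "0 \<le> y" "1 \<le> s"
  shows "exp (x * s) + exp (y * s) \<le> exp ((x + y + 1) * s)"
proof -
  have "exp (x * s) + exp (y * s) \<le> exp ((x + y) * s) + exp ((x + y) * s)"
    using assms by (intro add_mono) (auto intro!: mult_right_mono)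
  also have "\<dots> \<le> exp 1 * exp ((x + y) * s)"
    using exp_ge_add_one_self[of 1] by (simp flip: mult_2)
  also have "\<dots> \<le> exp ((x + y + 1) * s)"
    using assms by (simp flip: exp_add add: algebra_simps)
  finally show ?thesis .
qed

lemma egrowth_add:
  assumes "egrowth F N" "egrowth G N" shows "egrowth (\<lambda>z. F z + G z) N"
proof -
  obtain K where K: "K \<ge> 0" "\<And>z. cmod (F z) \<le> exp (K * sqrt (1 + cmod z) ^ N)"
    using egrowthE[OF assms(1)] by metis
  obtain L where L: "L \<ge> 0" "\<And>z. cmod (G z) \<le> exp (L * sqrt (1 + cmod z) ^ N)"
    using egrowthE[OF assms(2)] by metis
  have "cmod (F z + G z) \<le> exp ((K + L + 1) * sqrt (1 + cmod z) ^ N)" for z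
  proof -
    let ?s = "sqrt (1 + cmod z) ^ N"
    have s: "?s \<ge> 1" by (rule sqrt_power_ge_1) simp
    have "cmod (F z + G z) \<le> exp (K * ?s) + exp (L * ?s)"
      using norm_triangle_ineq[of "F z" "G z"] K(2)[of z] L(2)[of z] by linarith
    also have "\<dots> \<le> exp ((K + L + 1) * ?s)" by (rule exp_add_exp_le[OF K(1) L(1) s])
    finally show ?thesis .
  qed
  then show ?thesis
    using assms unfolding egrowth_def by (auto intro!: holomorphic_intros)
qed

lemma egrowth_const: "egrowth (\<lambda>z. a) N"
proof -
  have "cmod a \<le> exp (cmod a * sqrt (1 + cmod z) ^ N)" for z
  proof -
    have "cmod a * 1 \<le> cmod a * sqrt (1 + cmod z) ^ N"
      by (intro mult_left_mono sqrt_power_ge_1) auto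
    then show ?thesis using exp_ge_add_one_self[of "cmod a * sqrt (1 + cmod z) ^ N"] by linarith
  qed
  then show ?thesis by (auto simp: egrowth_def)
qed

lemma egrowth_diff:
  assumes "egrowth F N" "egrowth G N" shows "egrowth (\<lambda>z. F z - G z) N"
  using egrowth_add[OF assms(1) egrowth_mult[OF egrowth_const[of "-1"] assms(2)]] by simp

text \<open>The bound is measured by \<open>r\<close>, not by the radius \<open>t\<close> of the
  circle, so the maximum principle transfers it to the disc of radius \<open>r\<close> however large
  \<open>t\<close> is.\<close>

lemma egrowthI_circle:
  assumes F: "F holomorphic_on UNIV" and r0: "r0 \<ge> 1"
    and K: "\<And>r. r \<ge> r0 \<Longrightarrow> \<exists>t\<ge>r. \<forall>z. cmod z = t \<longrightarrow> cmod (F z) \<le> exp (K * sqrt r ^ N)"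
  shows "egrowth F N"
proof -
  have *: "cmod (F z) \<le> exp (\<bar>K\<bar> * sqrt r ^ N)" if "r \<ge> r0" "cmod z \<le> r" for r z
  proof -
    obtain t where t: "t \<ge> r" "\<And>z. cmod z = t \<Longrightarrow> cmod (F z) \<le> exp (K * sqrt r ^ N)"
      using K[OF \<open>r \<ge> r0\<close>] by auto
    have "cmod (F z) \<le> exp (K * sqrt r ^ N)"
      by (rule maximum_modulus_sphere[OF F t(2), of t]) (use t(1) that in auto)
    also have "\<dots> \<le> exp (\<bar>K\<bar> * sqrt r ^ N)" using that r0 by (auto intro!: mult_right_mono)
    finally show ?thesis .
  qed
  have "cmod (F z) \<le> exp ((\<bar>K\<bar> * sqrt r0 ^ N) * sqrt (1 + cmod z) ^ N)" for z
  proof (cases "cmod z \<le> r0")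
    case True
    have "\<bar>K\<bar> * sqrt r0 ^ N * 1 \<le> \<bar>K\<bar> * sqrt r0 ^ N * sqrt (1 + cmod z) ^ N"
      using r0 by (intro mult_left_mono sqrt_power_ge_1) auto
    with *[OF order_refl True] show ?thesis
      unfolding mult_1_right by (rule order_trans[OF _ exp_le_cancel_iff[THEN iffD2]])
  next
    case False
    have "\<bar>K\<bar> * 1 * sqrt (cmod z) ^ N \<le> \<bar>K\<bar> * sqrt r0 ^ N * sqrt (1 + cmod z) ^ N"
      using r0 by (intro mult_mono mult_left_mono sqrt_power_ge_1 power_mono) auto
    then have "exp (\<bar>K\<bar> * sqrt (cmod z) ^ N) \<le> exp (\<bar>K\<bar> * sqrt r0 ^ N * sqrt (1 + cmod z) ^ N)"
      by simp
    then show ?thesis using *[of "cmod z" z] False by linarith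
  qed
  then show ?thesis using F egrowth_def by blast
qed

lemma egrowth_on_disc:
  assumes "egrowth F N"
  obtains K where "K \<ge> 0" "\<And>r z. r \<ge> 1 \<Longrightarrow> cmod z \<le> 2 * r \<Longrightarrow> cmod (F z) \<le> exp (K * sqrt r ^ N)"
proof -
  obtain K where K: "K \<ge> 0" "\<And>z. cmod (F z) \<le> exp (K * sqrt (1 + cmod z) ^ N)"
    using egrowthE[OF assms] by metis
  show ?thesis
  proof (rule that)
    show "K * 2 ^ N \<ge> 0" using K by simp
    fix r :: real and z :: complex assume r: "r \<ge> 1" "cmod z \<le> 2 * r"
    have "sqrt (1 + cmod z) \<le> sqrt (4 * r)" using r by simp
    then have "sqrt (1 + cmod z) \<le> 2 * sqrt r" by (simp add: real_sqrt_mult)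
    then have "sqrt (1 + cmod z) ^ N \<le> (2 * sqrt r) ^ N" by (rule power_mono) simp
    then have "K * sqrt (1 + cmod z) ^ N \<le> K * 2 ^ N * sqrt r ^ N"
      using K(1) unfolding power_mult_distrib mult.assoc by (intro mult_left_mono) auto
    then show "cmod (F z) \<le> exp (K * 2 ^ N * sqrt r ^ N)"
      using K(2)[of z] by (meson exp_le_cancel_iff order_trans)
  qed
qed

lemma egrowth_0_constant:
  assumes "egrowth F 0" shows "\<exists>a. \<forall>z. F z = a"
proof -
  obtain K where "\<And>z. cmod (F z) \<le> exp (K * sqrt (1 + cmod z) ^ 0)"
    using egrowthE[OF assms(1)] by metis
  then have "bounded (range F)" by (auto simp: bounded_iff)
  then have "F constant_on UNIV" using Liouville_theorem egrowth_hol[OF assms] by blast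
  then show ?thesis by (simp add: constant_on_def)
qed

text \<open>The outcome of \<open>disc_decomposition\<close> for the radius \<open>16 * r\<close>.
  Good circles have radius at most \<open>2 * r\<close>; even after a translation by at most
  \<open>r\<close> they remain in the disc of radius \<open>4 * r\<close>, where \<open>H\<close> is
  Lipschitz.\<close>

definition disc_form :: "(complex \<Rightarrow> complex) \<Rightarrow> real \<Rightarrow> real \<Rightarrow> (complex \<Rightarrow> complex) \<Rightarrow> bool" where
  "disc_form F r s H \<longleftrightarrow> (\<forall>z\<in>ball 0 (16 * r). F z = exp (H z) *
       (\<Prod>w\<in>{w \<in> cball 0 (16 * r). F w = 0}. ((z - w) / of_real (32 * r)) ^ zmult F w)) \<and>
    (\<Sum>w\<in>{w \<in> cball 0 (16 * r). F w = 0}. real (zmult F w)) \<le> s \<and>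
    (\<forall>z\<in>cball 0 (8 * r). Re (H z) \<ge> - s) \<and>
    (\<forall>z\<in>cball 0 (4 * r). \<forall>z'\<in>cball 0 (4 * r). cmod (H z - H z') \<le> s / r * cmod (z - z'))"

lemma egrowth_decomposition:
  assumes F: "egrowth F N" "F 0 \<noteq> 0"
  obtains C where "C \<ge> 0" "\<And>r. r \<ge> 1 \<Longrightarrow> \<exists>H. disc_form F r (C * sqrt r ^ N) H"
proof -
  obtain K where K: "K \<ge> 0" "\<And>z. cmod (F z) \<le> exp (K * sqrt (1 + cmod z) ^ N)"
    using egrowthE[OF F(1)] by metis
  define l where "l = ln (cmod (F 0))"
  \<comment> \<open>On the circle of radius \<open>48 * r\<close> one has
    \<open>1 + cmod z \<le> 49 * r\<close>, whence \<open>7 ^ N\<close>; the term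
    \<open>\<bar>l\<bar>\<close> absorbs \<open>ln (cmod (F 0))\<close>.\<close>
  define C0 where "C0 = K * 7 ^ N + \<bar>l\<bar>"
  have C0: "C0 \<ge> 0" using K by (simp add: C0_def)
  \<comment> \<open>The lower bound \<open>l - 2 * D\<close> for \<open>Re (H z)\<close> costs one
    share of \<open>C0\<close> for \<open>l\<close> and two for \<open>2 * D\<close>.\<close>
  define C where "C = 3 * C0"
  show ?thesis
  proof (rule that)
    show "C \<ge> 0" using C0 by (simp add: C_def)
    fix r :: real assume r: "r \<ge> 1"
    define L where "L = K * 7 ^ N * sqrt r ^ N"
    define D where "D = L - ln (cmod (F 0))"
    have s: "sqrt r ^ N \<ge> 1" using r by (rule sqrt_power_ge_1)
    have l: "\<bar>l\<bar> \<le> \<bar>l\<bar> * sqrt r ^ N" using mult_left_mono[OF s, of "\<bar>l\<bar>"] by simp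
    have D: "D \<le> C0 * sqrt r ^ N"
      using l by (simp add: D_def L_def C0_def algebra_simps flip: l_def)
    have Lb: "cmod (F z) \<le> exp L" if "cmod z = 3 * (16 * r)" for z
    proof -
      have "sqrt (1 + cmod z) \<le> sqrt (49 * r)" using that r by simp
      also have "\<dots> = 7 * sqrt r" by (simp add: real_sqrt_mult)
      finally have "sqrt (1 + cmod z) ^ N \<le> (7 * sqrt r) ^ N" by (rule power_mono) simp
      then have "K * sqrt (1 + cmod z) ^ N \<le> L"
        using K(1) by (simp add: L_def power_mult_distrib mult_left_mono mult.assoc)
      then show ?thesis using K(2)[of z] by (meson exp_le_cancel_iff order_trans)
    qed
    have R16: "0 < 16 * r" using r by simp
    obtain H where H: "\<And>z. z \<in> ball 0 (16 * r) \<Longrightarrow> F z = exp (H z) *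
         (\<Prod>w\<in>{w \<in> cball 0 (16 * r). F w = 0}. ((z - w) / of_real (2 * (16 * r))) ^ zmult F w)"
      "(\<Sum>w\<in>{w \<in> cball 0 (16 * r). F w = 0}. real (zmult F w)) \<le> 2 * D"
      "Re (H 0) \<ge> ln (cmod (F 0))"
      "\<And>z. z \<in> ball 0 (16 * r) \<Longrightarrow> Re (H z) \<le> L"
      "\<And>z. z \<in> cball 0 (16 * r / 2) \<Longrightarrow> cmod (H z - H 0) \<le> 2 * D"
      "\<And>z z'. z \<in> cball 0 (16 * r / 4) \<Longrightarrow> z' \<in> cball 0 (16 * r / 4) \<Longrightarrow>
          cmod (H z - H z') \<le> 8 * D / (16 * r) * cmod (z - z')"
      by (rule disc_decomposition[OF egrowth_hol[OF F(1)] F(2) R16 Lb refl D_def]) (assumption, rule that, assumption+)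
    show "\<exists>H. disc_form F r (C * sqrt r ^ N) H"
      unfolding disc_form_def
    proof (intro exI[of _ H] conjI ballI)
      fix z :: complex assume "z \<in> ball 0 (16 * r)"
      from H(1)[OF this] show "F z = exp (H z) *
         (\<Prod>w\<in>{w \<in> cball 0 (16 * r). F w = 0}. ((z - w) / of_real (32 * r)) ^ zmult F w)"
        by simp
    next
      show "(\<Sum>w\<in>{w \<in> cball 0 (16 * r). F w = 0}. real (zmult F w)) \<le> C * sqrt r ^ N"
        using H(2) D mult_nonneg_nonneg[OF C0, of "sqrt r ^ N"] s unfolding C_def mult.assoc
          by linarith
    next
      fix z :: complex assume "z \<in> cball 0 (8 * r)"
      then have "cmod (H z - H 0) \<le> 2 * D" using H(5) by simp
      then have "Re (H z) \<ge> l - 2 * D" using abs_Re_le_cmod[of "H z - H 0"] H(3) unfolding l_def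
        by simp
      moreover have "\<bar>l\<bar> \<le> C0 * sqrt r ^ N" using l K(1) s
        by (simp add: C0_def algebra_simps add_increasing2)
      ultimately show "Re (H z) \<ge> - (C * sqrt r ^ N)" using D by (simp add: C_def)
    next
      fix z z' :: complex assume "z \<in> cball 0 (4 * r)" "z' \<in> cball 0 (4 * r)"
      then have "cmod (H z - H z') \<le> 8 * D / (16 * r) * cmod (z - z')" using H(6) by simp
      also have "\<dots> \<le> C * sqrt r ^ N / r * cmod (z - z')"
      proof (rule mult_right_mono)
        have "D \<le> 2 * (C * sqrt r ^ N)"
          using D mult_nonneg_nonneg[OF C0, of "sqrt r ^ N"] s unfolding C_def mult.assoc
            by linarith
        then show "8 * D / (16 * r) \<le> C * sqrt r ^ N / r" using r by (simp add: field_simps)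
      qed auto
      finally show "cmod (H z - H z') \<le> C * sqrt r ^ N / r * cmod (z - z')" .
    qed
  qed
qed

section \<open>Bounds on well-chosen circles\<close>

text \<open>The bound \<open>ln y \<ge> - 2 / sqrt y\<close> trades the logarithmic singularity for
  one that \<open>good_radius\<close> averages.\<close>

lemma exp_ge_root: 
  assumes "0 < y" shows "exp (- (2 / sqrt y)) \<le> (y::real)"
proof -
  have "1 / sqrt y \<le> exp (1 / sqrt y)" using exp_ge_add_one_self[of "1 / sqrt y"] by linarith
  then have "(1 / sqrt y) ^ 2 \<le> exp (1 / sqrt y) ^ 2" using assms by (intro power_mono) auto
  also have "\<dots> = exp (2 / sqrt y)" by (simp flip: exp_of_nat_mult)
  finally have "1 / y \<le> exp (2 / sqrt y)" using assms by (simp add: power_divide)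
  then show ?thesis using assms by (simp add: exp_minus field_simps)
qed

lemma one_plus_le_exp_root:
  assumes "0 \<le> y" shows "1 + y \<le> exp (2 * sqrt y)"
proof -
  have "1 + y \<le> (1 + sqrt y) ^ 2" using assms by (simp add: power2_sum)
  also have "\<dots> \<le> exp (sqrt y) ^ 2" using assms by (intro power_mono exp_ge_add_one_self) auto
  also have "\<dots> = exp (2 * sqrt y)" by (simp flip: exp_of_nat_mult)
  finally show ?thesis .
qed

text \<open>On a good circle \<open>exp_ge_root\<close> bounds each factor
  \<open>cmod (z - w) / (32 * r)\<close> from below, and the averaged sum of the exponents is of the
  order of the number of zeros.\<close>

lemma minimum_modulus:
  assumes F: "egrowth F N" "F 0 \<noteq> 0"
  obtains K where "K \<ge> 0" "\<And>r. r \<ge> 1 \<Longrightarrow> \<exists>t\<in>{r..2 * r}. \<forall>z. cmod z = t \<longrightarrow>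
    F z \<noteq> 0 \<and> exp (- (K * sqrt r ^ N)) \<le> cmod (F z)"
proof -
  obtain C where C: "C \<ge> 0" "\<And>r. r \<ge> 1 \<Longrightarrow> \<exists>H. disc_form F r (C * sqrt r ^ N) H"
    using egrowth_decomposition[OF F] by metis
  show ?thesis
  proof (rule that)
    \<comment> \<open>One \<open>C\<close> is for \<open>Re (H z)\<close>. The other
      \<open>60 = 12 * 5\<close> combine \<open>12 \<ge> 2 * sqrt 32\<close> with the constant of
      \<open>good_radius\<close>.\<close>
    show "61 * C \<ge> 0" using C by simp
    fix r :: real assume r: "r \<ge> 1"
    define W where "W = {w \<in> cball 0 (16 * r). F w = 0}"
    define s where "s = sqrt r ^ N"
    have fin: "finite W"
      using finite_zeros_cball[OF egrowth_hol[OF F(1)]] F(2) unfolding W_def by blast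
    obtain H where H: "\<And>z. z \<in> ball 0 (16 * r) \<Longrightarrow> F z = exp (H z) *
         (\<Prod>w\<in>W. ((z - w) / of_real (32 * r)) ^ zmult F w)"
      "(\<Sum>w\<in>W. real (zmult F w)) \<le> C * s"
      "\<And>z. z \<in> cball 0 (8 * r) \<Longrightarrow> Re (H z) \<ge> - (C * s)"
      using C(2)[OF r] unfolding W_def s_def disc_form_def by blast
    obtain t where t: "t \<in> {r..2 * r}" "\<And>w. w \<in> W \<Longrightarrow> t \<noteq> cmod w"
      "(\<Sum>w\<in>W. real (zmult F w) / sqrt \<bar>t - cmod w\<bar>) \<le> 5 * (\<Sum>w\<in>W. real (zmult F w)) / sqrt r"
      using good_radius[OF fin, of "\<lambda>w. real (zmult F w)" "{}" r cmod] r by auto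
    show "\<exists>t\<in>{r..2 * r}. \<forall>z. cmod z = t \<longrightarrow> F z \<noteq> 0 \<and> exp (- (61 * C * sqrt r ^ N)) \<le> cmod (F z)"
    proof (intro bexI[OF _ t(1)] allI impI)
      fix z assume z: "cmod z = t"
      have fac: "exp (- (12 * (1 / sqrt \<bar>t - cmod w\<bar>) * sqrt r)) \<le> cmod (z - w) / (32 * r)"
        if "w \<in> W" for w
      proof -
        define y where "y = \<bar>t - cmod w\<bar>"
        have y: "y > 0" using t(2)[OF that] by (simp add: y_def)
        have le: "y \<le> cmod (z - w)" using norm_triangle_ineq3[of z w] z by (simp add: y_def)
        have "2 / sqrt (y / (32 * r)) = 2 * sqrt 32 * sqrt r / sqrt y"
          using y r by (simp add: real_sqrt_divide real_sqrt_mult)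
        also have "\<dots> \<le> 2 * 6 * sqrt r / sqrt y"
          using y r by (intro divide_right_mono mult_right_mono mult_left_mono real_le_lsqrt) auto
        finally have "- (12 * (1 / sqrt y) * sqrt r) \<le> - (2 / sqrt (y / (32 * r)))" by simp
        then have "exp (- (12 * (1 / sqrt y) * sqrt r)) \<le> y / (32 * r)"
          using exp_ge_root[of "y / (32 * r)"] y r
            by (meson divide_pos_pos exp_le_cancel_iff mult_pos_pos order_trans less_le_trans zero_less_numeral zero_less_one)
        also have "\<dots> \<le> cmod (z - w) / (32 * r)" using le r by (intro divide_right_mono) auto
        finally show ?thesis by (simp add: y_def)
      qed
      have "- (60 * C * s) \<le> - (12 * sqrt r * (5 * (C * s) / sqrt r))"
        using r by simp
      also have "\<dots> \<le> - (12 * sqrt r * (\<Sum>w\<in>W. real (zmult F w) / sqrt \<bar>t - cmod w\<bar>))"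
      proof -
        have "5 * (\<Sum>w\<in>W. real (zmult F w)) / sqrt r \<le> 5 * (C * s) / sqrt r"
          using H(2) r by (intro divide_right_mono) auto
        with t(3) have "(\<Sum>w\<in>W. real (zmult F w) / sqrt \<bar>t - cmod w\<bar>) \<le> 5 * (C * s) / sqrt r"
          by linarith
        then show ?thesis unfolding neg_le_iff_le by (rule mult_left_mono) (use r in auto)
      qed
      finally have "exp (- (60 * C * s)) \<le>
        exp (- (12 * sqrt r * (\<Sum>w\<in>W. real (zmult F w) / sqrt \<bar>t - cmod w\<bar>)))"
        by simp
      also have "\<dots> = (\<Prod>w\<in>W. exp (- (12 * (1 / sqrt \<bar>t - cmod w\<bar>) * sqrt r)) ^ zmult F w)"
        by (simp add: sum_distrib_left exp_sum[OF fin] sum_negf[symmetric] exp_of_nat_mult[symmetric] mult_ac)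
      also have "\<dots> \<le> (\<Prod>w\<in>W. (cmod (z - w) / (32 * r)) ^ zmult F w)"
        by (intro prod_mono conjI power_mono fac) auto
      finally have P: "exp (- (60 * C * s)) \<le> (\<Prod>w\<in>W. (cmod (z - w) / (32 * r)) ^ zmult F w)" .
      have zb: "z \<in> ball 0 (16 * r)" "z \<in> cball 0 (8 * r)" using z t(1) r by auto
      have "cmod (F z) = exp (Re (H z)) * (\<Prod>w\<in>W. (cmod (z - w) / (32 * r)) ^ zmult F w)"
        using r by (simp add: H(1)[OF zb(1)] norm_mult prod_norm[symmetric] norm_power norm_divide)
      also have "\<dots> \<ge> exp (- (C * s)) * exp (- (60 * C * s))"
        using H(3)[OF zb(2)] P by (intro mult_mono) auto
      finally have "exp (- (61 * C * s)) \<le> cmod (F z)"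
        by (simp add: mult.assoc flip: exp_add)
      moreover have "cmod (F z) > 0" using calculation exp_gt_zero less_le_trans by blast
      ultimately show "F z \<noteq> 0 \<and> exp (- (61 * C * sqrt r ^ N)) \<le> cmod (F z)"
        by (simp add: s_def)
    qed
  qed
qed

text \<open>Both parts of \<open>disc_form\<close> gain at least \<open>sqrt r\<close>. A fixed
  shift changes \<open>H\<close> by a multiple of its growth bound divided by \<open>r\<close>. In
  the product a zero \<open>w\<close> contributes a multiple of
  \<open>1 / sqrt \<bar>t - cmod (w - h)\<bar>\<close> to the exponent, and on average this is
  smaller than the number of zeros by the factor \<open>sqrt r\<close>.\<close>

lemma difference_quotient_bound:
  assumes F: "egrowth F (Suc N)" "F 0 \<noteq> 0" and Hs: "finite Hs"
  obtains K r0 where "K \<ge> 0" "r0 \<ge> 1" "\<And>r. r \<ge> r0 \<Longrightarrow> \<exists>t\<in>{r..2 * r}. \<forall>z. cmod z = t \<longrightarrow>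
    F z \<noteq> 0 \<and> (\<forall>h\<in>Hs. F (z + h) \<noteq> 0 \<and> cmod (F z / F (z + h)) \<le> exp (K * sqrt r ^ N))"
proof -
  obtain C where C: "C \<ge> 0" "\<And>r. r \<ge> 1 \<Longrightarrow> \<exists>H. disc_form F r (C * sqrt r ^ Suc N) H"
    using egrowth_decomposition[OF F] by metis
  define q where "q = (\<Sum>h\<in>Hs. cmod h)"
  have q: "cmod h \<le> q" if "h \<in> Hs" for h
    unfolding q_def using member_le_sum[of h Hs cmod] that Hs by auto
  have q0: "q \<ge> 0" unfolding q_def by (intro sum_nonneg) auto
  define K where "K = C * q + 10 * sqrt q * card Hs * C"
  show ?thesis
  proof (rule that)
    show "K \<ge> 0" using C q0 by (simp add: K_def)
    show "1 + q \<ge> 1" using q0 by simp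
    fix r assume r: "r \<ge> 1 + q"
    then have r1: "r \<ge> 1" using q0 by simp
    define W where "W = {w \<in> cball 0 (16 * r). F w = 0}"
    define s where "s = sqrt r ^ N"
    have s: "s \<ge> 1" unfolding s_def using r1 by (rule sqrt_power_ge_1)
    have fin: "finite W"
      using finite_zeros_cball[OF egrowth_hol[OF F(1)]] F(2) unfolding W_def by blast
    obtain H where H: "\<And>z. z \<in> ball 0 (16 * r) \<Longrightarrow> F z = exp (H z) *
         (\<Prod>w\<in>W. ((z - w) / of_real (32 * r)) ^ zmult F w)"
      "(\<Sum>w\<in>W. real (zmult F w)) \<le> C * (sqrt r * s)"
      "\<And>z z'. z \<in> cball 0 (4 * r) \<Longrightarrow> z' \<in> cball 0 (4 * r) \<Longrightarrow>
          cmod (H z - H z') \<le> C * (sqrt r * s) / r * cmod (z - z')"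
      using C(2)[OF r1] unfolding W_def s_def power_Suc disc_form_def by blast
    \<comment> \<open>The radii of the zeros of all translates \<open>F (z + h)\<close> are averaged
      together, so that one \<open>t\<close> serves every shift; the zeros of \<open>F\<close>
      itself only have to be avoided and enter through the finite set.\<close>
    let ?\<rho> = "\<lambda>(w, h). cmod (w - h)" and ?wt = "\<lambda>(w, h :: complex). real (zmult F w)"
    obtain t where t: "t \<in> {r..2 * r}" "t \<notin> cmod ` W" "\<And>i. i \<in> W \<times> Hs \<Longrightarrow> t \<noteq> ?\<rho> i"
      "(\<Sum>i\<in>W \<times> Hs. ?wt i / sqrt \<bar>t - ?\<rho> i\<bar>) \<le> 5 * (\<Sum>i\<in>W \<times> Hs. ?wt i) / sqrt r"
      by (rule good_radius[of "W \<times> Hs" ?wt "cmod ` W" r ?\<rho>]) (use fin Hs r1 in auto)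
    have t3: "t \<noteq> cmod (w - h)" if "w \<in> W" "h \<in> Hs" for w h
      using t(3)[of "(w, h)"] that by simp
    have tot: "(\<Sum>i\<in>W \<times> Hs. ?wt i) = card Hs * (\<Sum>w\<in>W. real (zmult F w))"
      by (simp add: sum.cartesian_product[symmetric] sum_distrib_left)
    have sumh: "(\<Sum>w\<in>W. real (zmult F w) / sqrt \<bar>t - cmod (w - h)\<bar>) \<le> 5 * card Hs * C * s"
      if "h \<in> Hs" for h
    proof -
      have "(\<Sum>w\<in>W. real (zmult F w) / sqrt \<bar>t - cmod (w - h)\<bar>)
          \<le> (\<Sum>h\<in>Hs. \<Sum>w\<in>W. real (zmult F w) / sqrt \<bar>t - cmod (w - h)\<bar>)"
        by (rule member_le_sum[OF that _ Hs, of "\<lambda>h. \<Sum>w\<in>W. real (zmult F w) / sqrt \<bar>t - cmod (w - h)\<bar>"])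
          (auto intro!: sum_nonneg)
      also have "\<dots> = (\<Sum>i\<in>W \<times> Hs. ?wt i / sqrt \<bar>t - ?\<rho> i\<bar>)"
        by (subst sum.swap) (simp add: sum.cartesian_product case_prod_beta)
      also have "\<dots> \<le> 5 * (card Hs * (\<Sum>w\<in>W. real (zmult F w))) / sqrt r"
        using t(4) unfolding tot .
      also have "\<dots> \<le> 5 * (card Hs * (C * (sqrt r * s))) / sqrt r"
        using H(2) r1 by (intro divide_right_mono mult_left_mono) auto
      also have "\<dots> = 5 * card Hs * C * s" using r1 by simp
      finally show ?thesis .
    qed
    show "\<exists>t\<in>{r..2 * r}. \<forall>z. cmod z = t \<longrightarrow> F z \<noteq> 0 \<and>
      (\<forall>h\<in>Hs. F (z + h) \<noteq> 0 \<and> cmod (F z / F (z + h)) \<le> exp (K * sqrt r ^ N))"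
    proof (intro bexI[OF _ t(1)] allI impI conjI ballI)
      fix z assume z: "cmod z = t"
      have zb: "z \<in> ball 0 (16 * r)" "z \<in> cball 0 (4 * r)" using z t(1) r1 by auto
      show "F z \<noteq> 0" using t(2) z zb by (auto simp: W_def image_iff)
      fix h assume h: "h \<in> Hs"
      have ch: "cmod h \<le> q" "cmod h \<le> r" using q[OF h] r by auto
      have zhb: "z + h \<in> ball 0 (16 * r)" "z + h \<in> cball 0 (4 * r)"
        using norm_triangle_ineq[of z h] z t(1) ch r1 by auto
      show nz: "F (z + h) \<noteq> 0"
      proof
        assume "F (z + h) = 0"
        then have "z + h \<in> W" using zhb by (auto simp: W_def)
        from t3[OF this h] z show False by simp
      qed
      have fac: "cmod (z - w) / cmod (z + h - w) \<le> exp (2 * sqrt q * (1 / sqrt \<bar>t - cmod (w - h)\<bar>))"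
        if "w \<in> W" for w
      proof -
        define y where "y = \<bar>t - cmod (w - h)\<bar>"
        have y: "y > 0" using t3[OF that h] by (simp add: y_def)
        have le: "y \<le> cmod (z + h - w)"
          using norm_triangle_ineq3[of z "w - h"] z by (simp add: y_def algebra_simps)
        have "cmod (z - w) \<le> cmod (z + h - w) + cmod h"
          using norm_triangle_ineq4[of "z + h - w" h] by simp
        then have "cmod (z - w) / cmod (z + h - w) \<le> 1 + cmod h / cmod (z + h - w)"
          using y le by (simp add: divide_le_eq distrib_right)
        also have "\<dots> \<le> 1 + q / y" using y le ch q0 by (intro add_left_mono frac_le) auto
        also have "\<dots> \<le> exp (2 * sqrt (q / y))" using q0 y by (intro one_plus_le_exp_root) auto
        finally show ?thesis by (simp add: y_def real_sqrt_divide)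
      qed
      have nF: "cmod (F x) = exp (Re (H x)) * (\<Prod>w\<in>W. (cmod (x - w) / (32 * r)) ^ zmult F w)"
        if "x \<in> ball 0 (16 * r)" for x
        using r1 by (simp add: H(1)[OF that] norm_mult prod_norm[symmetric] norm_power norm_divide)
      have "cmod (F z / F (z + h)) = exp (Re (H z)) / exp (Re (H (z + h))) *
          (\<Prod>w\<in>W. (cmod (z - w) / (32 * r)) ^ zmult F w / (cmod (z + h - w) / (32 * r)) ^ zmult F w)"
        unfolding norm_divide nF[OF zb(1)] nF[OF zhb(1)] prod_dividef by simp
      also have "\<dots> = exp (Re (H z - H (z + h))) *
          (\<Prod>w\<in>W. (cmod (z - w) / cmod (z + h - w)) ^ zmult F w)"
        using r1 by (simp add: exp_diff flip: power_divide)
      also have "\<dots> \<le> exp (C * q * s) * exp (10 * sqrt q * card Hs * C * s)"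
      proof (rule mult_mono)
        have "Re (H z - H (z + h)) \<le> C * (sqrt r * s) / r * cmod (z - (z + h))"
          using H(3)[OF zb(2) zhb(2)] complex_Re_le_cmod order_trans by blast
        also have "\<dots> \<le> C * s * q"
        proof (rule mult_mono)
          have "sqrt r * 1 \<le> sqrt r * sqrt r" using r1 by (intro mult_left_mono) auto
          then have "sqrt r / r \<le> 1" using r1 by simp
          then have "C * s * (sqrt r / r) \<le> C * s * 1" using C s by (intro mult_left_mono) auto
          then show "C * (sqrt r * s) / r \<le> C * s" by (simp add: mult_ac)
        qed (use ch C s in auto)
        finally show "exp (Re (H z - H (z + h))) \<le> exp (C * q * s)" by (simp add: mult_ac)
        have "(\<Prod>w\<in>W. (cmod (z - w) / cmod (z + h - w)) ^ zmult F w)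
            \<le> (\<Prod>w\<in>W. exp (2 * sqrt q * (1 / sqrt \<bar>t - cmod (w - h)\<bar>)) ^ zmult F w)"
          by (intro prod_mono conjI power_mono fac) auto
        also have "\<dots> = exp (2 * sqrt q * (\<Sum>w\<in>W. real (zmult F w) / sqrt \<bar>t - cmod (w - h)\<bar>))"
          by (simp add: sum_distrib_left exp_sum[OF fin] exp_of_nat_mult[symmetric] mult_ac)
        also have "\<dots> \<le> exp (2 * sqrt q * (5 * card Hs * C * s))"
          unfolding exp_le_cancel_iff by (rule mult_left_mono[OF sumh[OF h]]) (use q0 in auto)
        finally show "(\<Prod>w\<in>W. (cmod (z - w) / cmod (z + h - w)) ^ zmult F w)
            \<le> exp (10 * sqrt q * card Hs * C * s)" by (simp add: mult_ac)
      qed (auto intro!: prod_nonneg)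
      also have "\<dots> = exp (K * sqrt r ^ N)"
        by (simp add: K_def s_def distrib_right exp_add)
      finally show "cmod (F z / F (z + h)) \<le> exp (K * sqrt r ^ N)" .
    qed
  qed
qed


section \<open>Exponentials of polynomials\<close>

lemma poly_norm_bound:
  fixes P :: "complex poly"
  obtains A where "A \<ge> 0" "\<And>z. cmod (poly P z) \<le> A * (1 + cmod z) ^ degree P"
proof (rule that)
  show "(\<Sum>i\<le>degree P. cmod (coeff P i)) \<ge> 0" by (intro sum_nonneg) auto
  fix z
  have "cmod (poly P z) \<le> (\<Sum>i\<le>degree P. cmod (coeff P i) * cmod z ^ i)"
    unfolding poly_altdef by (rule order_trans[OF norm_sum]) (simp add: norm_mult norm_power)
  also have "\<dots> \<le> (\<Sum>i\<le>degree P. cmod (coeff P i) * (1 + cmod z) ^ degree P)"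
  proof (intro sum_mono mult_left_mono)
    fix i assume "i \<in> {..degree P}"
    have "cmod z ^ i \<le> (1 + cmod z) ^ i" by (intro power_mono) auto
    also have "\<dots> \<le> (1 + cmod z) ^ degree P" using \<open>i \<in> _\<close> by (intro power_increasing) auto
    finally show "cmod z ^ i \<le> (1 + cmod z) ^ degree P" .
  qed auto
  finally show "cmod (poly P z) \<le> (\<Sum>i\<le>degree P. cmod (coeff P i)) * (1 + cmod z) ^ degree P"
    by (simp add: sum_distrib_right)
qed

lemma egrowth_exp_poly: "egrowth (\<lambda>z. exp (poly P z)) (2 * degree P)"
proof -
  obtain A where A: "A \<ge> 0" "\<And>z. cmod (poly P z) \<le> A * (1 + cmod z) ^ degree P"
    using poly_norm_bound by blast
  have "cmod (exp (poly P z)) \<le> exp (A * sqrt (1 + cmod z) ^ (2 * degree P))" for z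
  proof -
    have "cmod (exp (poly P z)) \<le> exp (cmod (poly P z))" by (rule norm_exp)
    also have "\<dots> \<le> exp (A * (1 + cmod z) ^ degree P)" using A(2) by simp
    also have "(1 + cmod z) ^ degree P = sqrt (1 + cmod z) ^ (2 * degree P)"
      by (simp add: power_mult)
    finally show ?thesis .
  qed
  then show ?thesis unfolding egrowth_def by (auto intro!: holomorphic_intros)
qed

lemma egrowth_prod:
  assumes "\<And>j. j \<in> J \<Longrightarrow> egrowth (F j) N" "finite J"
  shows "egrowth (\<lambda>z. \<Prod>j\<in>J. F j z) N"
  using assms(2,1) by (induction J rule: finite_induct) (auto intro!: egrowth_const egrowth_mult)

text \<open>The modulus of the constant coefficient is that of the leading coefficient times the
  product of the moduli of the roots; the induction splits off one root at a time.\<close>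

lemma poly_small_root:
  fixes Q :: "complex poly"
  assumes "\<rho> > 0" "cmod (poly Q 0) < cmod (lead_coeff Q) * \<rho> ^ degree Q"
  shows "\<exists>z. cmod z \<le> \<rho> \<and> poly Q z = 0"
proof (rule ccontr)
  assume "\<not> ?thesis"
  then have *: "\<And>z. poly Q z = 0 \<Longrightarrow> cmod z > \<rho>" by (meson not_le)
  have "cmod (lead_coeff Q) * \<rho> ^ degree Q \<le> cmod (poly Q 0)"
    using *
  proof (induction "degree Q" arbitrary: Q)
    case 0
    then obtain a where "Q = [:a:]" by (metis degree_eq_zeroE)
    then show ?case by simp
  next
    case (Suc k)
    then obtain a where a: "poly Q a = 0"
      using Fundamental_Theorem_Algebra.fundamental_theorem_of_algebra[of Q]
        by (metis constant_degree nat.distinct(1))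
    then obtain Q' where Q: "Q = [:- a, 1:] * Q'" by (metis dvdE poly_eq_0_iff_dvd)
    have Q0: "Q' \<noteq> 0" using Suc.hyps(2) Q by auto
    have deg: "degree Q = Suc (degree Q')" unfolding Q using Q0 by (subst degree_mult_eq) auto
    have "cmod (lead_coeff Q') * \<rho> ^ degree Q' \<le> cmod (poly Q' 0)"
      using Suc.hyps(1)[of Q'] Suc.hyps(2) deg Suc.prems Q by simp
    moreover have "\<rho> \<le> cmod a" using Suc.prems[OF a] by simp
    ultimately have "\<rho> * (cmod (lead_coeff Q') * \<rho> ^ degree Q') \<le> cmod a * cmod (poly Q' 0)"
      using assms(1) by (intro mult_mono) auto
    moreover have "lead_coeff Q = lead_coeff Q'" unfolding Q lead_coeff_mult by simp
    moreover have "cmod (poly Q 0) = cmod a * cmod (poly Q' 0)" unfolding Q by (simp add: norm_mult)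
    ultimately show ?case unfolding deg by (simp add: mult_ac)
  qed
  with assms(2) show False by simp
qed

text \<open>Solutions of \<open>poly P z = of_real ((2 * l + 1) * pi) * \<i>\<close> are zeros. By
  \<open>poly_small_root\<close> there is one in the disc as long as the leading coefficient
  outweighs the constant one, which leaves about \<open>d * r ^ degree P / (2 * pi)\<close> values
  of \<open>l\<close>, and distinct \<open>l\<close> give distinct zeros. Finiteness is assumed
  because \<open>card\<close> is \<open>0\<close> on infinite sets.\<close>

lemma zeros_exp_poly_count:
  fixes P :: "complex poly"
  assumes p: "degree P > 0"
  obtains a C where "a > 0" "\<And>r. r > 0 \<Longrightarrow> finite {z \<in> cball 0 r. 1 + exp (poly P z) = 0} \<Longrightarrow>
    a * r ^ degree P - C \<le> real (card {z \<in> cball 0 r. 1 + exp (poly P z) = 0})"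
proof -
  define d where "d = cmod (lead_coeff P)"
  have d: "d > 0" using p by (auto simp: d_def)
  define p0 where "p0 = cmod (poly P 0)"
  define a where "a = d / (2 * pi)"
  define C where "C = (p0 + 2 * pi) / (2 * pi) + 1"
  show ?thesis
  proof (rule that)
    show "a > 0" using d by (simp add: a_def)
    fix r :: real assume r: "r > 0" and fin: "finite {z \<in> cball 0 r. 1 + exp (poly P z) = 0}"
    let ?Y = "{z \<in> cball 0 r. 1 + exp (poly P z) = 0}"
    define M where "M = nat \<lfloor>a * r ^ degree P - (p0 + 2 * pi) / (2 * pi)\<rfloor>"
    have ex: "\<exists>z. cmod z \<le> r \<and> poly P z = of_real ((2 * real l + 1) * pi) * \<i>" if l: "l < M" for l
    proof -
      define Q where "Q = P + [:- (of_real ((2 * real l + 1) * pi) * \<i>):]"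
      have degQ: "degree Q = degree P" unfolding Q_def using p
        by (intro degree_add_eq_left) auto
      have lead: "lead_coeff Q = lead_coeff P"
        unfolding degQ unfolding Q_def using p by (cases "degree P") auto
      have "real l + 1 \<le> real M" using l by linarith
      also have "real M \<le> a * r ^ degree P - (p0 + 2 * pi) / (2 * pi)"
        using l unfolding M_def by linarith
      finally have "2 * pi * (real l + 1) \<le> 2 * pi * (a * r ^ degree P - (p0 + 2 * pi) / (2 * pi))"
        by (intro mult_left_mono) auto
      also have "\<dots> = d * r ^ degree P - p0 - 2 * pi"
        by (simp add: a_def field_simps)
      finally have le0: "2 * pi * (real l + 1) \<le> d * r ^ degree P - p0 - 2 * pi" .
      have le: "p0 + (2 * real l + 1) * pi < d * r ^ degree P"
      proof -
        define x where "x = pi * real l"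
        have A: "(2 * real l + 1) * pi = 2 * x + pi" by (simp add: distrib_right x_def)
        have B: "2 * pi * (real l + 1) = 2 * x + 2 * pi" by (simp add: distrib_left x_def)
        show ?thesis using le0 pi_gt_zero unfolding A B by linarith
      qed
      have "cmod (poly Q 0) \<le> p0 + (2 * real l + 1) * pi"
        using norm_triangle_ineq4[of "poly P 0" "of_real ((2 * real l + 1) * pi) * \<i>"]
        by (simp add: Q_def p0_def norm_mult del: of_real_mult of_real_add)
      with le have "\<exists>z. cmod z \<le> r \<and> poly Q z = 0"
        by (intro poly_small_root r) (simp only: degQ lead d_def[symmetric] lead[unfolded degQ])
      then show ?thesis by (simp add: Q_def)
    qed
    then obtain f where f: "\<And>l. l < M \<Longrightarrow> cmod (f l) \<le> r"
      "\<And>l. l < M \<Longrightarrow> poly P (f l) = of_real ((2 * real l + 1) * pi) * \<i>"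
      by metis
    have inj: "inj_on f {..<M}"
    proof (rule inj_onI)
      fix k l assume "k \<in> {..<M}" "l \<in> {..<M}" "f k = f l"
      then have "of_real ((2 * real k + 1) * pi) * \<i> = of_real ((2 * real l + 1) * pi) * \<i>"
        using f(2) by (metis lessThan_iff)
      then have "(2 * real k + 1) * pi = (2 * real l + 1) * pi"
        by (metis complex_i_not_zero mult_right_cancel of_real_eq_iff)
      then show "k = l" by simp
    qed
    have sub: "f ` {..<M} \<subseteq> ?Y"
    proof
      fix x assume "x \<in> f ` {..<M}"
      then obtain l where l: "l < M" "x = f l" by auto
      have "exp (poly P x) = cis ((2 * real l + 1) * pi)"
        unfolding l(2) f(2)[OF l(1)] by (simp add: cis_conv_exp mult.commute)
      also have "\<dots> = cis (real (2 * l + 1) * pi)" by (simp add: add.commute)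
      also have "\<dots> = cis pi ^ (2 * l + 1)" by (simp only: Complex.DeMoivre)
      also have "\<dots> = -1" by simp
      finally show "x \<in> ?Y" using f(1)[OF l(1)] l(2) by simp
    qed
    have "M \<le> card ?Y"
      using card_mono[OF fin sub] card_image[OF inj] by simp
    moreover have "a * r ^ degree P - C \<le> real M" unfolding M_def C_def by linarith
    ultimately show "a * r ^ degree P - C \<le> real (card ?Y)" by linarith
  qed
qed

lemma holomorphic_shift:
  assumes "F holomorphic_on UNIV" shows "(\<lambda>z. F (z + a)) holomorphic_on UNIV"
  by (rule holomorphic_on_compose_gen[of "\<lambda>z. z + a" UNIV F UNIV, unfolded o_def])
      (use assms in \<open>auto intro!: holomorphic_intros\<close>)

lemma zmult_shift:
  assumes F: "F holomorphic_on UNIV" "\<exists>z. F z \<noteq> 0"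
  shows "zmult (\<lambda>z. F (z + a)) w = zmult F (w + a)"
proof -
  obtain g where g: "g holomorphic_on UNIV" "g (w + a) \<noteq> 0" "\<And>z. F z =
    (z - (w + a)) ^ zmult F (w + a) * g z"
    using zdvd_zmult[OF F] by metis
  show ?thesis
  proof (rule zmult_eqI(2)[of "\<lambda>z. g (z + a)"])
    show "F (z + a) = (z - w) ^ zmult F (w + a) * g (z + a)" for z
      using g(3)[of "z + a"] by simp
  qed (use g holomorphic_shift in auto)
qed

text \<open>The maximum principle at \<open>0\<close> for a quotient \<open>G / Q\<close> whose
  poles in the disc cancel: numerator and denominator lose the same product over the zeros of
  \<open>Q\<close>, and the remaining denominator is zero-free there.\<close>

lemma divided_maximum_modulus:
  assumes G: "G holomorphic_on UNIV" and Q: "Q holomorphic_on UNIV" "Q 0 \<noteq> 0" and t: "t \<ge> 0"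
    and nz: "\<And>z. cmod z = t \<Longrightarrow> Q z \<noteq> 0"
    and dvd: "\<And>w. cmod w \<le> t \<Longrightarrow> zdvd w (zmult Q w) G"
    and le: "\<And>z. cmod z = t \<Longrightarrow> cmod (G z) \<le> B * cmod (Q z)"
  shows "cmod (G 0) \<le> B * cmod (Q 0)"
proof -
  have nt: "\<exists>z. Q z \<noteq> 0" using Q by auto
  define W where "W = {w \<in> cball 0 t. Q w = 0}"
  define pr where "pr = (\<lambda>z. \<Prod>w\<in>W. (z - w) ^ zmult Q w)"
  have fin: "finite W" using finite_zeros_cball[OF Q(1) nt] unfolding W_def by metis
  obtain h where h: "h holomorphic_on UNIV" "\<And>z. z \<in> cball 0 t \<Longrightarrow> h z \<noteq> 0" "\<And>z. Q z = pr z * h z"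
    using factor_zeros_cball[OF Q(1) nt W_def] unfolding pr_def by metis
  have "\<exists>g. g holomorphic_on UNIV \<and> (\<forall>z. G z = pr z * g z)"
    unfolding pr_def by (rule zdvd_prod[OF G fin]) (auto simp: W_def intro: dvd)
  then obtain g where g: "g holomorphic_on UNIV" "\<And>z. G z = pr z * g z" by auto
  have h': "h holomorphic_on S" "g holomorphic_on S" for S using h g holomorphic_on_subset by blast+
  have "cmod (g 0 / h 0) \<le> B"
  proof (rule maximum_modulus_frontier[of "\<lambda>z. g z / h z" "cball 0 t"])
    show "(\<lambda>z. g z / h z) holomorphic_on interior (cball 0 t)"
      using h(2) by (intro holomorphic_intros h') auto
    show "continuous_on (closure (cball 0 t)) (\<lambda>z. g z / h z)"
      using h(2) by (intro holomorphic_on_imp_continuous_on holomorphic_intros h') auto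
    fix z assume "z \<in> frontier (cball (0::complex) t)"
    then have z: "cmod z = t" by (auto simp: frontier_def)
    have "pr z \<noteq> 0" "h z \<noteq> 0" using nz[OF z] h(3)[of z] by auto
    then show "cmod (g z / h z) \<le> B"
      using le[OF z] by (simp add: g(2) h(3) norm_mult norm_divide field_simps)
  qed (use t in auto)
  moreover have "pr 0 \<noteq> 0" "h 0 \<noteq> 0" using Q(2) h(3)[of 0] by auto
  ultimately show ?thesis by (simp add: g(2) h(3) norm_mult norm_divide field_simps)
qed


section \<open>The difference equation\<close>

text \<open>Here \<open>E = u / (f - a)\<close>. Only two traces of \<open>f\<close> and \<open>a\<close> remain: \<open>star\<close> is
  \<open>\<Delta>\<^sup>n (u / E) = u\<close> divided by \<open>u\<close>, and \<open>chain\<close> expresses \<open>\<Delta>\<^sup>m a = 0\<close> at the poles of \<open>a\<close>.\<close>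

locale difference_system =
  fixes c :: complex and u E :: "complex \<Rightarrow> complex" and P :: "complex poly" and n m :: nat
  assumes c0: "c \<noteq> 0" and m1: "1 \<le> m" and mn: "m \<le> n"
    and holE: "E holomorphic_on UNIV" and ntE: "\<exists>z. E z \<noteq> 0"
    and grE: "\<exists>N. egrowth E N"
    and holu: "u holomorphic_on UNIV" and ntu: "\<exists>z. u z \<noteq> 0"
    and u_shift: "\<And>z. u (z + c) = (1 + exp (poly P z)) * u z"
    and E_u: "\<And>z. E z = 0 \<Longrightarrow> u z \<noteq> 0"
    and chain: "\<And>w q i K. finite K \<Longrightarrow> (\<And>j. j \<in> K \<Longrightarrow> zmult E (w + of_nat j * c) \<le> q) \<Longrightarrow>
        zmult E (w + of_nat i * c) > q \<Longrightarrow> card K < m"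
    and star: "\<And>z. (\<And>k. k \<le> n \<Longrightarrow> E (z + of_nat k * c) \<noteq> 0) \<Longrightarrow>
        (\<Sum>k\<le>n. (-1) ^ (n - k) * of_nat (n choose k) *
          (\<Prod>j<k. 1 + exp (poly P (z + of_nat j * c))) / E (z + of_nat k * c)) = 1"
begin

definition b :: "complex \<Rightarrow> complex" where "b z = 1 + exp (poly P z)"

lemma holb: "b holomorphic_on UNIV"
  unfolding b_def by (intro holomorphic_intros)

lemma u_iter: "u (z + of_nat (Suc k) * c) = b (z + of_nat k * c) * u (z + of_nat k * c)"
  using u_shift[of "z + of_nat k * c"] by (simp add: b_def algebra_simps)

section \<open>Values of \<open>E\<close> at the zeros of \<open>b\<close>\<close>

text \<open>A zero of \<open>b\<close> makes \<open>u\<close> vanish at all later points of the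
  chain, and \<open>u\<close> and \<open>E\<close> have no common zeros.\<close>

lemma E_nonzero_right:
  assumes "b z = 0" "k \<ge> 1" shows "E (z + of_nat k * c) \<noteq> 0"
proof -
  have "u (z + of_nat k * c) = 0" using assms(2)
  proof (induction k rule: dec_induct)
    case base
    then show ?case using u_iter[of z 0] assms by simp
  next
    case (step k)
    then show ?case using u_iter[of z k] by simp
  qed
  then show ?thesis using E_u by blast
qed

text \<open>To the right of \<open>z\<close> there are \<open>m\<close> chain points at which
  \<open>E\<close> does not vanish. A zero further left would contradict \<open>chain\<close> at
  level \<open>q = 0\<close>.\<close>

lemma E_nonzero_left:
  assumes "b z = 0" shows "E (z - of_nat l * c) \<noteq> 0"
proof
  let ?w = "z - of_nat l * c"
  assume "E ?w = 0"
  then have "zmult E (?w + of_nat 0 * c) > 0" using zmult_pos_iff[OF holE ntE] by simp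
  moreover have "zmult E (?w + of_nat j * c) \<le> 0" if "j \<in> {l + 1..l + m}" for j
  proof -
    have "?w + of_nat j * c = z + of_nat (j - l) * c" using that
      by (simp add: of_nat_diff algebra_simps)
    moreover have "E (z + of_nat (j - l) * c) \<noteq> 0"
      by (rule E_nonzero_right[OF assms]) (use that in auto)
    ultimately show ?thesis using zmult_pos_iff[OF holE ntE] by (metis not_gr_zero le_zero_eq)
  qed
  ultimately have "card {l + 1..l + m} < m"
    by (intro chain[of "{l + 1..l + m}" ?w 0 0]) simp_all
  then show False by simp
qed

text \<open>Every product that contains \<open>b z\<close> vanishes, so \<open>star\<close> at
  \<open>z\<close> reduces to its first term and \<open>star\<close> at \<open>z - c\<close> to its
  first two.\<close>

lemma E_at_zero:
  assumes "b z = 0" shows "E z = (-1) ^ n" "E z / E (z - c) =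
    of_nat n + 1 - of_nat n * exp (poly P (z - c) - poly P z)"
proof -
  have nzk: "E (z + of_nat k * c) \<noteq> 0" for k
    using E_nonzero_right[OF assms, of k] E_nonzero_left[OF assms, of 0] by (cases k) auto
  have nz1: "E (z - c) \<noteq> 0" using E_nonzero_left[OF assms, of 1] by simp
  have n1: "n \<ge> 1" using m1 mn by simp
  define T where "T = (\<lambda>z k. (-1) ^ (n - k) * of_nat (n choose k) *
          (\<Prod>j<k. b (z + of_nat j * c)) / E (z + of_nat k * c))"
  have star': "(\<Sum>k\<le>n. T z k) = 1" if "\<And>k. k \<le> n \<Longrightarrow> E (z + of_nat k * c) \<noteq> 0" for z
    using star[OF that] by (simp add: T_def b_def)
  have "1 = (\<Sum>k\<le>n. T z k)" using star'[of z] nzk by simp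
  also have "\<dots> = (\<Sum>k\<in>{0}. T z k)"
  proof (rule sum.mono_neutral_right)
    show "\<forall>k\<in>{..n} - {0}. T z k = 0"
    proof
      fix k assume "k \<in> {..n} - {0}"
      then have "(\<Prod>j<k. b (z + of_nat j * c)) = 0"
        using assms by (intro prod_zero[OF _ bexI[of _ 0]]) auto
      then show "T z k = 0" by (simp add: T_def)
    qed
  qed auto
  finally have 1: "E z = (-1) ^ n" using nzk[of 0] by (simp add: T_def field_simps)
  then show "E z = (-1) ^ n" .
  have "1 = (\<Sum>k\<le>n. T (z - c) k)"
  proof (rule star'[symmetric])
    fix k show "E (z - c + of_nat k * c) \<noteq> 0"
      using nz1 nzk[of "k - 1"] by (cases k) (auto simp: algebra_simps)
  qed
  also have "\<dots> = (\<Sum>k\<in>{0, 1}. T (z - c) k)"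
  proof (rule sum.mono_neutral_right)
    show "\<forall>k\<in>{..n} - {0, 1}. T (z - c) k = 0"
    proof
      fix k assume "k \<in> {..n} - {0, 1}"
      then have "(\<Prod>j<k. b (z - c + of_nat j * c)) = 0"
        using assms by (intro prod_zero[OF _ bexI[of _ 1]]) auto
      then show "T (z - c) k = 0" by (simp add: T_def)
    qed
  qed (use n1 in auto)
  also have "\<dots> = (-1) ^ n / E (z - c) + (-1) ^ (n - 1) * of_nat n * b (z - c) / E z"
    by (simp add: T_def)
  also have "\<dots> = E z / E (z - c) - of_nat n * b (z - c)"
  proof -
    \<comment> \<open>As \<open>E z = (-1) ^ n\<close> is its own inverse,
      \<open>(-1) ^ n / E (z - c)\<close> is \<open>E z / E (z - c)\<close>, and
      \<open>(-1) ^ (n - 1) / E z\<close> is \<open>-1\<close>.\<close>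
    obtain k where "n = Suc k" using n1 by (cases n) auto
    then show ?thesis unfolding 1 by (cases "even k") (simp_all add: algebra_simps)
  qed
  finally have "E z / E (z - c) = 1 + of_nat n * b (z - c)" by (simp add: algebra_simps)
  also have "b (z - c) = 1 - exp (poly P (z - c) - poly P z)"
  proof -
    have "exp (poly P z) = -1" using assms by (simp add: b_def add_eq_0_iff)
    then show ?thesis by (simp add: b_def exp_diff)
  qed
  finally show "E z / E (z - c) = of_nat n + 1 - of_nat n * exp (poly P (z - c) - poly P z)"
    by (simp add: algebra_simps)
qed

text \<open>The estimates normalise at \<open>0\<close>, where \<open>E\<close> may vanish;
  translation moves a suitable point there.\<close>

lemma translate: "difference_system c (\<lambda>z. u (z + a)) (\<lambda>z. E (z + a)) (P \<circ>\<^sub>p [:a, 1:]) n m"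
proof
  have comm: "x + a + y = x + y + a" for x y :: complex by simp
  have pc: "poly (P \<circ>\<^sub>p [:a, 1:]) z = poly P (z + a)" for z by (simp add: poly_pcompose add.commute)
  show "\<exists>z. E (z + a) \<noteq> 0" "\<exists>z. u (z + a) \<noteq> 0"
    using ntE ntu by (metis diff_add_cancel)+
  show "\<exists>N. egrowth (\<lambda>z. E (z + a)) N" using grE egrowth_shift by blast
  show "u (z + c + a) = (1 + exp (poly (P \<circ>\<^sub>p [:a, 1:]) z)) * u (z + a)" for z
    using u_shift[of "z + a"] unfolding pc by (simp add: add_ac)
  show "card K < m" if "finite K" "\<And>j. j \<in> K \<Longrightarrow> zmult (\<lambda>z. E (z + a)) (w + of_nat j * c) \<le> q"
    "zmult (\<lambda>z. E (z + a)) (w + of_nat i * c) > q" for w q i K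
    using chain[of K "w + a" q i] that unfolding zmult_shift[OF holE ntE] by (simp add: add_ac)
  show "(\<Sum>k\<le>n. (-1) ^ (n - k) * of_nat (n choose k) *
          (\<Prod>j<k. 1 + exp (poly (P \<circ>\<^sub>p [:a, 1:]) (z + of_nat j * c))) / E (z + of_nat k * c + a)) =
            1"
    if "\<And>k. k \<le> n \<Longrightarrow> E (z + of_nat k * c + a) \<noteq> 0" for z
    using star[of "z + a"] that unfolding pc comm[of z] .
qed (use c0 m1 mn holE holu E_u in \<open>auto intro!: holomorphic_shift\<close>)

lemma holE1: "(\<lambda>z. E (z - c)) holomorphic_on UNIV"
  using holomorphic_shift[OF holE, of "- c"] by simp

lemma ntE1: "\<exists>z. E (z - c) \<noteq> 0"
  using ntE by (metis add_diff_cancel)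

lemma zmult_E1: "zmult (\<lambda>z. E (z - c)) w = zmult E (w - c)"
  using zmult_shift[OF holE ntE, of "- c" w] by simp

section \<open>Lowering the order of \<open>E\<close>\<close>

definition \<tau> :: "nat \<Rightarrow> complex \<Rightarrow> complex" where
  "\<tau> k z = (-1) ^ (n - k) * of_nat (n choose k) * (\<Prod>j<k. b (z + of_nat j * c))"

lemma egrowth_\<tau>: "egrowth (\<tau> k) (2 * degree P)"
proof -
  have "egrowth b (2 * degree P)"
    unfolding b_def by (intro egrowth_add egrowth_const egrowth_exp_poly)
  then show ?thesis
    unfolding \<tau>_def by (intro egrowth_mult egrowth_const egrowth_prod egrowth_shift) auto
qed

text \<open>Multiplied by \<open>E z\<close>, the equation \<open>star\<close> becomes \<open>E z =
  (\<Sum>k\<le>n. \<tau> k z * (E z / E (z + of_nat k * c)))\<close>. On good circles the quotients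
  have half-order \<open>N\<close> although \<open>E\<close> is only known to have
  \<open>Suc N\<close>, and the coefficients have half-order
  \<open>2 * degree P \<le> N\<close>.\<close>

lemma growth_step_at_0:
  assumes E: "egrowth E (Suc N)" "E 0 \<noteq> 0" and N: "2 * degree P \<le> N"
  shows "egrowth E N"
proof -
  obtain K r0 where K: "K \<ge> 0" "r0 \<ge> 1" "\<And>r. r \<ge> r0 \<Longrightarrow> \<exists>t\<in>{r..2 * r}. \<forall>z. cmod z = t \<longrightarrow>
    E z \<noteq> 0 \<and> (\<forall>h\<in>(\<lambda>k. of_nat k * c) ` {..n}. E (z + h) \<noteq> 0 \<and> cmod (E z / E (z + h)) \<le>
      exp (K * sqrt r ^ N))"
    using difference_quotient_bound[OF E, of "(\<lambda>k. of_nat k * c) ` {..n}"] by blast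
  have "\<exists>L. L \<ge> 0 \<and> (\<forall>r z. r \<ge> 1 \<longrightarrow> cmod z \<le> 2 * r \<longrightarrow> cmod (\<tau> k z) \<le> exp (L * sqrt r ^ N))" for k
    using egrowth_on_disc[OF egrowth_mono[OF egrowth_\<tau>[of k] N]] by metis
  then obtain L where L: "\<And>k. L k \<ge> 0"
    "\<And>k r z. r \<ge> 1 \<Longrightarrow> cmod z \<le> 2 * r \<Longrightarrow> cmod (\<tau> k z) \<le> exp (L k * sqrt r ^ N)"
    by metis
  define M where "M = (\<Sum>k\<le>n. L k)"
  have M: "L k \<le> M" if "k \<le> n" for k
    unfolding M_def using member_le_sum[of k "{..n}" L] L(1) that by auto
  have M0: "M \<ge> 0" unfolding M_def using L(1) by (rule sum_nonneg)
  show ?thesis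
  \<comment> \<open>The summand \<open>n\<close> absorbs the number of terms, since
    \<open>1 + real n\<close> is at most \<open>exp (n * sqrt r ^ N)\<close>.\<close>
  proof (rule egrowthI_circle[OF holE K(2), of "M + K + n"])
    fix r assume r: "r \<ge> r0"
    then have r1: "r \<ge> 1" using K by simp
    obtain t where t: "t \<in> {r..2 * r}" "\<And>z k. cmod z = t \<Longrightarrow> k \<le> n \<Longrightarrow> E z \<noteq> 0 \<and>
      E (z + of_nat k * c) \<noteq> 0 \<and> cmod (E z / E (z + of_nat k * c)) \<le> exp (K * sqrt r ^ N)"
      using K(3)[OF r] by blast
    show "\<exists>t\<ge>r. \<forall>z. cmod z = t \<longrightarrow> cmod (E z) \<le> exp ((M + K + n) * sqrt r ^ N)"
    proof (intro exI[of _ t] conjI allI impI)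
      fix z assume z: "cmod z = t"
      have "1 = (\<Sum>k\<le>n. \<tau> k z / E (z + of_nat k * c))"
        using star[of z] t(2)[OF z] by (simp add: \<tau>_def b_def)
      then have "E z = E z * (\<Sum>k\<le>n. \<tau> k z / E (z + of_nat k * c))" by simp
      also have "\<dots> = (\<Sum>k\<le>n. \<tau> k z * (E z / E (z + of_nat k * c)))"
        by (simp add: sum_distrib_left mult_ac)
      finally have "cmod (E z) = cmod (\<Sum>k\<le>n. \<tau> k z * (E z / E (z + of_nat k * c)))"
        by (rule arg_cong)
      also have "\<dots> \<le> (\<Sum>k\<le>n. exp ((M + K) * sqrt r ^ N))"
      proof (rule sum_norm_le)
        fix k assume "k \<in> {..n}"
        then have k: "k \<le> n" by simp
        have "L k * sqrt r ^ N \<le> M * sqrt r ^ N"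
          using M[OF k] r1 by (intro mult_right_mono) auto
        then have "cmod (\<tau> k z) \<le> exp (M * sqrt r ^ N)"
          using L(2)[of r z k] r1 z t(1) by (meson atLeastAtMost_iff exp_le_cancel_iff order_trans)
        then have "cmod (\<tau> k z) * cmod (E z / E (z + of_nat k * c)) \<le>
            exp (M * sqrt r ^ N) * exp (K * sqrt r ^ N)"
          using t(2)[OF z k] by (intro mult_mono) auto
        also have "\<dots> = exp ((M + K) * sqrt r ^ N)"
          by (simp add: distrib_right flip: exp_add)
        finally show "cmod (\<tau> k z * (E z / E (z + of_nat k * c))) \<le> exp ((M + K) * sqrt r ^ N)"
          by (simp only: norm_mult)
      qed
      also have "\<dots> = (1 + real n) * exp ((M + K) * sqrt r ^ N)" by simp
      also have "\<dots> \<le> exp (n * sqrt r ^ N) * exp ((M + K) * sqrt r ^ N)"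
      proof (rule mult_right_mono)
        have "real n * 1 \<le> n * sqrt r ^ N" using r1 by (intro mult_left_mono sqrt_power_ge_1) auto
        then show "1 + real n \<le> exp (n * sqrt r ^ N)"
          using exp_ge_add_one_self[of "n * sqrt r ^ N"] by linarith
      qed auto
      also have "\<dots> = exp ((M + K + n) * sqrt r ^ N)"
        by (simp add: distrib_right flip: exp_add)
      finally show "cmod (E z) \<le> exp ((M + K + n) * sqrt r ^ N)" .
    qed (use t in auto)
  qed
qed

lemma growth_step:
  assumes E: "egrowth E (Suc N)" and N: "2 * degree P \<le> N"
  shows "egrowth E N"
proof -
  obtain a where a: "E a \<noteq> 0" using ntE by blast
  interpret T: difference_system c "\<lambda>z. u (z + a)" "\<lambda>z. E (z + a)" "P \<circ>\<^sub>p [:a, 1:]" n m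
    by (rule translate)
  have "egrowth (\<lambda>z. E (z + a)) N"
    by (rule T.growth_step_at_0) (use a N egrowth_shift[OF E] in \<open>auto simp: degree_pcompose\<close>)
  from egrowth_shift[OF this, of "- a"] show ?thesis by simp
qed

lemma growth_E: "egrowth E (2 * degree P)"
proof -
  obtain N where "egrowth E N" using grE by blast
  then have "egrowth E (2 * degree P + N)" by (rule egrowth_mono) simp
  then show ?thesis
  proof (induction N)
    case (Suc N)
    then show ?case using growth_step[of "2 * degree P + N"] by simp
  qed simp
qed

end


context difference_system
begin

section \<open>Points where the multiplicity drops along a chain\<close>

text \<open>This is \<open>chain\<close> read backwards: with \<open>J\<close> beyond all indices,
  \<open>j\<close> turns into \<open>J - j\<close> counted from
  \<open>y - of_nat J * c\<close>.\<close>

lemma chain_minus: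
  assumes "finite K" "\<And>j. j \<in> K \<Longrightarrow> zmult E (y - of_nat j * c) \<le> q" "zmult E (y - of_nat i * c) > q"
  shows "card K < m"
proof -
  obtain J where J: "\<And>j. j \<in> insert i K \<Longrightarrow> j \<le> J"
    using finite_nat_set_iff_bounded_le[of "insert i K"] assms(1) by auto
  have eq: "y - of_nat J * c + of_nat (J - j) * c = y - of_nat j * c" if "j \<in> insert i K" for j
    using J[OF that] by (simp add: of_nat_diff algebra_simps)
  have inj: "inj_on (\<lambda>j. J - j) K" using J by (intro inj_onI) (metis diff_diff_cancel insertCI)
  have "card ((\<lambda>j. J - j) ` K) < m"
  proof (rule chain[of _ "y - of_nat J * c" q "J - i"])
    show "zmult E (y - of_nat J * c + of_nat j * c) \<le> q" if j: "j \<in> (\<lambda>j. J - j) ` K" for j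
    proof -
      obtain i where i: "i \<in> K" "j = J - i" using j by auto
      show ?thesis unfolding i(2) eq[OF insertI2[OF i(1)]] by (rule assms(2)[OF i(1)])
    qed
    show "q < zmult E (y - of_nat J * c + of_nat (J - i) * c)"
      unfolding eq[OF insertI1] by (rule assms(3))
  qed (use assms in auto)
  then show ?thesis by (simp add: card_image[OF inj])
qed

text \<open>Double counting. If the multiplicity drops at \<open>e\<close>, then all but fewer than
  \<open>m\<close> of the next \<open>l + m\<close> chain points have at least the multiplicity of
  \<open>e - c\<close>. Conversely, a given zero is reached in this way from at most
  \<open>m\<close> points of \<open>X\<close>.\<close>

lemma exceptional_count:
  assumes X: "finite X" "\<And>e. e \<in> X \<Longrightarrow> zmult E (e - c) > zmult E e"
    and W: "finite W" "\<And>e j. e \<in> X \<Longrightarrow> j \<in> {1..l + m} \<Longrightarrow> E (e + of_nat j * c) = 0 \<Longrightarrow>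
      e + of_nat j * c \<in> W"
  shows "l * (\<Sum>e\<in>X. zmult E (e - c)) \<le> m * (\<Sum>w\<in>W. zmult E w)"
proof -
  let ?J = "{1..l + m}"
  have 1: "l * zmult E (e - c) \<le> (\<Sum>j\<in>?J. zmult E (e + of_nat j * c))" if e: "e \<in> X" for e
  proof -
    define q where "q = zmult E (e - c)"
    have q: "q > 0" using X(2)[OF e] by (simp add: q_def)
    define B where "B = {j \<in> ?J. zmult E (e + of_nat j * c) < q}"
    have fB: "finite B" by (simp add: B_def)
    have shift: "e - c + of_nat (Suc j) * c = e + of_nat j * c" for j by (simp add: algebra_simps)
    \<comment> \<open>Counted from \<open>e - c\<close>, the point \<open>e + of_nat j * c\<close>
      has index \<open>Suc j\<close>. As \<open>chain\<close> asks for values at most the level and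
      one value above it, the level is \<open>q - 1\<close>.\<close>
    have "card (Suc ` B) < m"
    proof (rule chain[of _ "e - c" "q - 1" 0])
      show "zmult E (e - c + of_nat j * c) \<le> q - 1" if j: "j \<in> Suc ` B" for j
      proof -
        obtain i where i: "i \<in> B" "j = Suc i" using j by auto
        then have "zmult E (e - c + of_nat j * c) < q" unfolding i(2) shift by (simp add: B_def)
        then show ?thesis by linarith
      qed
      show "q - 1 < zmult E (e - c + of_nat 0 * c)" using q by (simp add: q_def)
    qed (use fB in auto)
    then have cB: "card B < m" by (simp add: card_image)
    have "card (?J - B) = card ?J - card B"
      by (rule card_Diff_subset[OF fB]) (auto simp: B_def)
    then have "l \<le> card (?J - B)" using cB by simp
    then have "l * q \<le> card (?J - B) * q" by simp
    also have "\<dots> = (\<Sum>j\<in>?J - B. q)" by simp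
    also have "\<dots> \<le> (\<Sum>j\<in>?J - B. zmult E (e + of_nat j * c))"
      by (intro sum_mono) (auto simp: B_def)
    also have "\<dots> \<le> (\<Sum>j\<in>?J. zmult E (e + of_nat j * c))"
      by (intro sum_mono2) auto
    finally show ?thesis by (simp add: q_def)
  qed
  \<comment> \<open>Among these points, let \<open>M\<close> be the largest multiplicity just before
    a drop. All of them have multiplicity below \<open>M\<close>, so the chain property limits their
    number.\<close>
  have fib: "card {j \<in> ?J. y - of_nat j * c \<in> X} \<le> m" for y
  proof (cases "{j \<in> ?J. y - of_nat j * c \<in> X} = {}")
    case False
    let ?K = "{j \<in> ?J. y - of_nat j * c \<in> X}"
    define M where "M = Max ((\<lambda>j. zmult E (y - of_nat (Suc j) * c)) ` ?K)"
    have fK: "finite ?K" by simp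
    have "M \<in> (\<lambda>j. zmult E (y - of_nat (Suc j) * c)) ` ?K"
      unfolding M_def using False fK by (intro Max_in) auto
    then obtain i where i: "i \<in> ?K" "M = zmult E (y - of_nat (Suc i) * c)" by auto
    have lt: "zmult E (y - of_nat j * c) < M" if "j \<in> ?K" for j
    proof -
      have "zmult E (y - of_nat j * c) < zmult E (y - of_nat j * c - c)" using X(2) that by blast
      also have "y - of_nat j * c - c = y - of_nat (Suc j) * c" by (simp add: algebra_simps)
      also have "zmult E \<dots> \<le> M" unfolding M_def using that fK by (intro Max_ge) auto
      finally show ?thesis .
    qed
    have "card ?K < m"
    proof (rule chain_minus[of _ y "M - 1" "Suc i"])
      show "zmult E (y - of_nat j * c) \<le> M - 1" if "j \<in> ?K" for j using lt[OF that] by linarith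
      show "M - 1 < zmult E (y - of_nat (Suc i) * c)" using lt[OF i(1)] i(2) by linarith
    qed auto
    then show ?thesis by simp
  next
    case True
    then show ?thesis by (simp only: card.empty)
  qed
  have "l * (\<Sum>e\<in>X. zmult E (e - c)) \<le> (\<Sum>e\<in>X. \<Sum>j\<in>?J. zmult E (e + of_nat j * c))"
    unfolding sum_distrib_left by (intro sum_mono 1)
  also have "\<dots> = (\<Sum>j\<in>?J. \<Sum>e\<in>X. zmult E (e + of_nat j * c))" by (rule sum.swap)
  also have "\<dots> \<le> (\<Sum>j\<in>?J. \<Sum>w\<in>W. if w - of_nat j * c \<in> X then zmult E w else 0)"
  proof (rule sum_mono)
    fix j assume j: "j \<in> ?J"
    have "(\<Sum>e\<in>X. zmult E (e + of_nat j * c)) = (\<Sum>w\<in>(\<lambda>e. e + of_nat j * c) ` X. zmult E w)"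
      by (subst sum.reindex) (auto simp: inj_on_def)
    also have "\<dots> = (\<Sum>w\<in>(\<lambda>e. e + of_nat j * c) ` X \<inter> W. zmult E w)"
    proof (rule sum.mono_neutral_right)
      show "\<forall>w\<in>(\<lambda>e. e + of_nat j * c) ` X - (\<lambda>e. e + of_nat j * c) ` X \<inter> W. zmult E w = 0"
        using W(2)[OF _ j] zmult_pos_iff(1)[OF holE ntE] by blast
    qed (use X in auto)
    also have "\<dots> = (\<Sum>w\<in>(\<lambda>e. e + of_nat j * c) ` X \<inter> W.
      if w - of_nat j * c \<in> X then zmult E w else 0)"
      by (intro sum.cong) auto
    also have "\<dots> \<le> (\<Sum>w\<in>W. if w - of_nat j * c \<in> X then zmult E w else 0)"
      using W(1) by (intro sum_mono2) auto
    finally show "(\<Sum>e\<in>X. zmult E (e + of_nat j * c)) \<le>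
      (\<Sum>w\<in>W. if w - of_nat j * c \<in> X then zmult E w else 0)" .
  qed
  also have "\<dots> = (\<Sum>w\<in>W. \<Sum>j\<in>?J. if w - of_nat j * c \<in> X then zmult E w else 0)"
    by (rule sum.swap)
  also have "\<dots> = (\<Sum>w\<in>W. card {j \<in> ?J. w - of_nat j * c \<in> X} * zmult E w)"
    by (simp add: sum.If_cases Int_def)
  also have "\<dots> \<le> (\<Sum>w\<in>W. m * zmult E w)" by (intro sum_mono mult_right_mono fib) auto
  finally show ?thesis by (simp add: sum_distrib_left)
qed

section \<open>The identity \<open>E z = mu z * E (z - c)\<close>\<close>

definition \<delta> :: "complex poly" where "\<delta> = P \<circ>\<^sub>p [:- c, 1:] - P"

lemma poly_\<delta>: "poly \<delta> z = poly P (z - c) - poly P z"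
  by (simp add: \<delta>_def poly_pcompose)

lemma degree_\<delta>:
  assumes "degree P > 0" shows "degree \<delta> < degree P"
proof -
  let ?Q = "P \<circ>\<^sub>p [:- c, 1:]"
  have deg: "degree ?Q = degree P" by (simp add: degree_pcompose)
  have lead: "lead_coeff ?Q = lead_coeff P" by (subst lead_coeff_comp) auto
  show ?thesis
  proof (cases "\<delta> = 0")
    case False
    have "degree \<delta> \<le> degree P" unfolding \<delta>_def using degree_diff_le_max[of ?Q P] deg by simp
    moreover have "coeff \<delta> (degree P) = 0" unfolding \<delta>_def using lead deg by simp
    ultimately show ?thesis using False by (metis leading_coeff_0_iff le_neq_implies_less)
  qed (use assms in auto)
qed

text \<open>The value of \<open>E z / E (z - c)\<close> at the zeros of \<open>b\<close>, read as an
  entire function of \<open>z\<close>.\<close>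

definition mu :: "complex \<Rightarrow> complex" where
  "mu z = of_nat n + 1 - of_nat n * exp (poly \<delta> z)"

lemma holmu: "mu holomorphic_on UNIV"
  unfolding mu_def by (intro holomorphic_intros)

lemma hol_num: "(\<lambda>z. E z - mu z * E (z - c)) holomorphic_on UNIV"
  by (intro holomorphic_intros holE holE1 holmu)

lemma num_vanishes: "b z = 0 \<Longrightarrow> E z - mu z * E (z - c) = 0"
  using E_at_zero(2)[of z] E_nonzero_left[of z 1] by (simp add: mu_def poly_\<delta> field_simps)

text \<open>The quotient \<open>E z / E (z - c) - mu z\<close> is of small growth, has few poles, and vanishes at all
  zeros of \<open>b\<close>. Dividing by these zeros and clearing the poles bounds their number.\<close>

lemma zeros_vs_growth:
  assumes nz0: "E 0 \<noteq> 0" "E (- c) \<noteq> 0" "E 0 - mu 0 * E (- c) \<noteq> 0"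
    and t: "t > 0" "\<And>z. cmod z = t \<Longrightarrow> E (z - c) \<noteq> 0"
    and B: "B \<ge> 0" "\<And>z. cmod z = t \<Longrightarrow> cmod (E z - mu z * E (z - c)) \<le> B * cmod (E (z - c))"
    and s: "0 < s" "s \<le> t / 4"
    and X: "X = {e \<in> cball 0 t. zmult E (e - c) > zmult E e}"
    and Y: "Y = {y \<in> cball 0 s. b y = 0}" "finite Y"
    and \<epsilon>: "\<epsilon> > 0" "\<And>e. e \<in> X \<Longrightarrow> \<epsilon> \<le> cmod e"
  shows "finite X"
    "cmod (E 0 - mu 0 * E (- c)) * 3 ^ card Y \<le>
      B * cmod (E (- c)) * (2 * t / \<epsilon>) ^ (\<Sum>e\<in>X. zmult E (e - c))"
proof -
  let ?E1 = "\<lambda>z. E (z - c)"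
  have "X \<subseteq> {w \<in> cball 0 t. ?E1 w = 0}"
    using X zmult_pos_iff(1)[OF holE ntE] by force
  then show fX: "finite X" using finite_zeros_cball[OF holE1 ntE1] finite_subset by blast
  define k where "k = (\<lambda>e. zmult E (e - c))"
  define D where "D = (\<Sum>e\<in>X. k e)"
  define num where "num = (\<lambda>z. E z - mu z * ?E1 z)"
  \<comment> \<open>At an exceptional point the full multiplicity of the denominator is cleared, not
    just the excess; \<open>exceptional_bound\<close> counts in the same way.\<close>
  define A where "A = (\<lambda>z. \<Prod>e\<in>X. (z - e) ^ k e)"
  define py where "py = (\<lambda>z::complex. \<Prod>y\<in>Y. (z - y))"
  have holA: "A holomorphic_on UNIV" "py holomorphic_on UNIV"
    unfolding A_def py_def by (intro holomorphic_intros)+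
  have holnum: "num holomorphic_on UNIV" unfolding num_def by (rule hol_num)
  have z0: "0 \<notin> Y"
  proof
    assume "0 \<in> Y"
    then have "b 0 = 0" using Y by simp
    from num_vanishes[OF this] nz0 show False by simp
  qed
  have Ys: "cmod y \<le> t / 4" if "y \<in> Y" for y using that Y s by auto
  \<comment> \<open>The points of \<open>Y\<close> lie within \<open>t / 4\<close>: each factor of
    \<open>py\<close> is at least \<open>3 * t / 4\<close> on the circle and at most
    \<open>t / 4\<close> at \<open>0\<close>. The ratio of the two produces
    \<open>3 ^ card Y\<close>.\<close>
  have main: "cmod (A 0 * num 0) \<le> (2 * t) ^ D * B / (3 * t / 4) ^ card Y * cmod (?E1 0 * py 0)"
  proof (rule divided_maximum_modulus[of "\<lambda>z. A z * num z" "\<lambda>z. ?E1 z * py z" t])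
    show "(\<lambda>z. A z * num z) holomorphic_on UNIV" "(\<lambda>z. ?E1 z * py z) holomorphic_on UNIV"
      by (intro holomorphic_intros holA holnum holE1)+
    show "?E1 0 * py 0 \<noteq> 0" using nz0 z0 Y(2) by (simp add: py_def)
    show "?E1 z * py z \<noteq> 0" if "cmod z = t" for z
      using t(2)[OF that] Ys that t(1) Y(2) by (force simp: py_def)
    fix z assume z: "cmod z = t"
    have "cmod (A z) \<le> (\<Prod>e\<in>X. (2 * t) ^ k e)"
      unfolding A_def prod_norm[symmetric]
    proof (intro prod_mono conjI)
      fix e assume "e \<in> X"
      then have "cmod (z - e) \<le> 2 * t" using X z norm_triangle_ineq4[of z e] by simp
      then show "cmod ((z - e) ^ k e) \<le> (2 * t) ^ k e" 
        unfolding norm_power by (intro power_mono) auto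
    qed auto
    then have a: "cmod (A z) \<le> (2 * t) ^ D" by (simp add: D_def power_sum)
    have "(\<Prod>y\<in>Y. 3 * t / 4) \<le> cmod (py z)"
      unfolding py_def prod_norm[symmetric]
    proof (intro prod_mono conjI)
      fix y assume "y \<in> Y"
      then show "3 * t / 4 \<le> cmod (z - y)" using Ys[of y] z norm_triangle_ineq2[of z y] by simp
    qed (use t in auto)
    then have p: "(3 * t / 4) ^ card Y \<le> cmod (py z)" by simp
    have "cmod (A z * num z) \<le> (2 * t) ^ D * (B * cmod (?E1 z))"
      unfolding norm_mult num_def by (intro mult_mono a B(2)[OF z]) (use t in auto)
    also have "\<dots> = (2 * t) ^ D * B / (3 * t / 4) ^ card Y * (cmod (?E1 z) * (3 * t / 4) ^ card Y)"
      using t(1) by simp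
    also have "\<dots> \<le> (2 * t) ^ D * B / (3 * t / 4) ^ card Y * (cmod (?E1 z) * cmod (py z))"
      using p t(1) B(1) by (intro mult_left_mono) auto
    finally show "cmod (A z * num z) \<le> (2 * t) ^ D * B / (3 * t / 4) ^ card Y * cmod (?E1 z * py z)"
      by (simp only: norm_mult)
  next
    fix w assume w: "cmod w \<le> t"
    show "zdvd w (zmult (\<lambda>z. ?E1 z * py z) w) (\<lambda>z. A z * num z)"
    proof (cases "?E1 w = 0")
      case True
      \<comment> \<open>By \<open>E_nonzero_left\<close> the zeros of \<open>E (z - c)\<close> are
        disjoint from those of \<open>b\<close>, so the two factors of the denominator can be
        treated apart.\<close>
      have "w \<notin> Y" using E_nonzero_left[of w 1] True Y by auto
      then have pw: "py w \<noteq> 0" using Y(2) by (auto simp: py_def)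
      obtain g where g: "g holomorphic_on UNIV" "g w \<noteq> 0" "\<And>z. ?E1 z = (z - w) ^ zmult ?E1 w * g z"
        using zdvd_zmult[OF holE1 ntE1] by metis
      have zm: "zmult (\<lambda>z. ?E1 z * py z) w = k w"
        unfolding k_def zmult_E1[symmetric]
      proof (rule zmult_eqI(2)[of "\<lambda>z. g z * py z"])
        show "?E1 z * py z = (z - w) ^ zmult ?E1 w * (g z * py z)" for z
          unfolding mult.assoc[symmetric] g(3)[of z, symmetric] ..
      qed (use g(2) pw in \<open>auto intro!: holomorphic_intros g(1) holA\<close>)
      show ?thesis
      proof (cases "w \<in> X")
        case True
        have "zdvd w (k w) A"
          unfolding zdvd_def A_def prod.remove[OF fX True]
          by (intro exI[of _ "\<lambda>z. \<Prod>e\<in>X - {w}. (z - e) ^ k e"]) (auto intro!: holomorphic_intros)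
        then show ?thesis unfolding zm by (rule zdvd_multL[OF _ holnum])
      next
        case False
        then have le: "k w \<le> zmult E w" using X w by (auto simp: k_def)
        have "zdvd w (k w) ?E1" using zdvd_iff[OF holE1 ntE1] zmult_E1 by (simp add: k_def)
        then have "zdvd w (k w) (\<lambda>z. ?E1 z * (- mu z))"
          by (rule zdvd_multL) (intro holomorphic_intros holmu)
        moreover have "zdvd w (k w) E" using zdvd_iff[OF holE ntE] le by simp
        ultimately have "zdvd w (k w) (\<lambda>z. E z + ?E1 z * (- mu z))" by (intro zdvd_add)
        then have "zdvd w (k w) num" by (simp add: num_def mult.commute)
        then have "zdvd w (k w) (\<lambda>z. num z * A z)" by (rule zdvd_multL[OF _ holA(1)])
        then show ?thesis unfolding zm by (simp add: mult.commute)
      qed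
    next
      case False
      show ?thesis
      proof (cases "w \<in> Y")
        case True
        \<comment> \<open>A zero of \<open>b\<close> is divided out once, whatever its multiplicity,
          because \<open>Y\<close> counts points.\<close>
        have "zmult (\<lambda>z. ?E1 z * py z) w = 1"
        proof (rule zmult_eqI(2)[of "\<lambda>z. ?E1 z * (\<Prod>y\<in>Y - {w}. (z - y))"])
          show "?E1 z * py z = (z - w) ^ 1 * (?E1 z * (\<Prod>y\<in>Y - {w}. (z - y)))" for z
            unfolding py_def prod.remove[OF Y(2) True] by simp
        qed (use False Y(2) in \<open>auto intro!: holomorphic_intros holE1\<close>)
        moreover have "num w = 0" using num_vanishes[of w] True Y(1) by (simp add: num_def)
        then have "zdvd w 1 (\<lambda>z. A z * num z)"
          by (intro zdvd_1 holomorphic_intros holA holnum) simp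
        ultimately show ?thesis by simp
      next
        case False2: False
        then have pw: "py w \<noteq> 0" using Y(2) by (auto simp: py_def)
        have "zmult (\<lambda>z. ?E1 z * py z) w = 0"
          by (rule zmult_eqI(2)[of "\<lambda>z. ?E1 z * py z"])
            (use False pw in \<open>auto intro!: holomorphic_intros holE1 holA\<close>)
        then show ?thesis by (simp add: zdvd_0 holomorphic_on_mult[OF holA(1) holnum])
      qed
    qed
  qed (use t in auto)
  have "\<epsilon> ^ D \<le> cmod (A 0)"
    unfolding A_def prod_norm[symmetric] D_def power_sum
    by (intro prod_mono conjI) (use \<epsilon> in \<open>auto simp: norm_power intro!: power_mono\<close>)
  then have "\<epsilon> ^ D * cmod (num 0) \<le> cmod (A 0 * num 0)"
    by (simp add: norm_mult mult_right_mono)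
  also note main
  also have "(2 * t) ^ D * B / (3 * t / 4) ^ card Y * cmod (?E1 0 * py 0) \<le>
      (2 * t) ^ D * B / (3 * t / 4) ^ card Y * (cmod (E (- c)) * (t / 4) ^ card Y)"
  proof (rule mult_left_mono)
    have "cmod (py 0) \<le> (\<Prod>y\<in>Y. t / 4)"
      unfolding py_def prod_norm[symmetric] by (intro prod_mono conjI) (use Ys in auto)
    then show "cmod (?E1 0 * py 0) \<le> cmod (E (- c)) * (t / 4) ^ card Y"
      by (simp add: norm_mult mult_left_mono)
  qed (use t B in auto)
  finally have *: "\<epsilon> ^ D * cmod (num 0) \<le>
      (2 * t) ^ D * B / (3 * t / 4) ^ card Y * (cmod (E (- c)) * (t / 4) ^ card Y)" .
  have "(3 * t / 4) ^ card Y = 3 ^ card Y * (t / 4) ^ card Y"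
    by (simp flip: power_mult_distrib)
  with * have "\<epsilon> ^ D * cmod (num 0) \<le> (2 * t) ^ D * B * cmod (E (- c)) / 3 ^ card Y"
    using t(1) by simp
  then have "cmod (num 0) * 3 ^ card Y \<le> B * cmod (E (- c)) * ((2 * t) ^ D / \<epsilon> ^ D)"
    using \<epsilon>(1) by (simp add: field_simps)
  then show "cmod (E 0 - mu 0 * E (- c)) * 3 ^ card Y \<le>
      B * cmod (E (- c)) * (2 * t / \<epsilon>) ^ (\<Sum>e\<in>X. zmult E (e - c))"
    by (simp add: num_def D_def k_def power_divide)
qed

end


lemma ln_le_two_sqrt: "0 < x \<Longrightarrow> ln x \<le> 2 * sqrt (x::real)"
  using exp_ge_root[of "1 / x"] ln_ge_iff[of "1/x" "- (2 * sqrt x)"]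
  by (simp add: real_sqrt_divide ln_div)

context difference_system
begin

text \<open>With \<open>l\<close> about \<open>r / cmod c\<close>, \<open>exceptional_count\<close>
  weighs each exceptional point by a multiple of \<open>r\<close> against the zeros of
  \<open>E\<close> in the disc of radius \<open>16 * r\<close>. Their number is
  \<open>O(r ^ degree P)\<close>, so a whole factor \<open>r\<close> is gained.\<close>

lemma exceptional_bound:
  obtains C r1 where "C \<ge> 0" "r1 \<ge> 1" "\<And>r t X. r \<ge> r1 \<Longrightarrow> t \<le> 2 * r \<Longrightarrow> finite X \<Longrightarrow> X \<subseteq> cball 0 t \<Longrightarrow>
    (\<And>e. e \<in> X \<Longrightarrow> zmult E (e - c) > zmult E e) \<Longrightarrow> E 0 \<noteq> 0 \<Longrightarrow>
    r * real (\<Sum>e\<in>X. zmult E (e - c)) \<le> C * r ^ degree P"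
proof (cases "E 0 = 0")
  case True
  then show ?thesis using that[of 0 1] by simp
next
  case False
  obtain C where C: "C \<ge> 0" "\<And>r. r \<ge> 1 \<Longrightarrow> \<exists>H. disc_form E r (C * sqrt r ^ (2 * degree P)) H"
    using egrowth_decomposition[OF growth_E False] by metis
  have cc: "cmod c > 0" using c0 by simp
  show ?thesis
  proof (rule that)
    show "cmod c * m * C \<ge> 0" using C by simp
    \<comment> \<open>For such \<open>r\<close>, \<open>l + m\<close> steps of length
      \<open>cmod c\<close> from the disc of radius \<open>2 * r\<close> end within
      \<open>16 * r\<close>.\<close>
    show "1 + (m + 1) * cmod c \<ge> 1" by simp
    fix r t :: real and X :: "complex set"
    assume r: "r \<ge> 1 + (m + 1) * cmod c" and t: "t \<le> 2 * r" and X: "finite X" "X \<subseteq> cball 0 t"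
      "\<And>e. e \<in> X \<Longrightarrow> zmult E (e - c) > zmult E e"
    have r1: "r \<ge> 1" using r by (smt (verit) mult_nonneg_nonneg norm_ge_zero of_nat_0_le_iff)
    define W where "W = {w \<in> cball 0 (16 * r). E w = 0}"
    define l where "l = nat \<lceil>r / cmod c\<rceil>"
    have l: "r / cmod c \<le> l" "l \<le> r / cmod c + 1"
      unfolding l_def using r1 cc by auto
    have lc: "l * cmod c \<le> r + cmod c" using l(2) cc by (simp add: field_simps)
    have sumW: "real (\<Sum>w\<in>W. zmult E w) \<le> C * r ^ degree P"
    proof -
      have "(\<Sum>w\<in>W. real (zmult E w)) \<le> C * sqrt r ^ (2 * degree P)"
        using C(2)[OF r1] unfolding disc_form_def W_def by blast
      then show ?thesis using r1 by (simp add: power_mult)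
    qed
    have "l * (\<Sum>e\<in>X. zmult E (e - c)) \<le> m * (\<Sum>w\<in>W. zmult E w)"
    proof (rule exceptional_count[OF X(1,3)])
      show "finite W" unfolding W_def by (rule finite_zeros_cball[OF holE ntE])
      fix e j assume e: "e \<in> X" and j: "j \<in> {1..l + m}" and z: "E (e + of_nat j * c) = 0"
      have "cmod (e + of_nat j * c) \<le> cmod e + j * cmod c"
        by (rule order_trans[OF norm_triangle_ineq]) (simp add: norm_mult)
      also have "\<dots> \<le> 2 * r + (l + m) * cmod c"
      proof (intro add_mono mult_right_mono)
        show "cmod e \<le> 2 * r" using e X(2) t by auto
        show "real j \<le> real (l + m)" using j by (simp only: of_nat_le_iff atLeastAtMost_iff)
      qed auto
      also have "\<dots> \<le> 2 * r + r + (m + 1) * cmod c" using lc by (simp add: algebra_simps)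
      also have "\<dots> \<le> 16 * r" using r r1 by linarith
      finally show "e + of_nat j * c \<in> W" using z by (simp add: W_def)
    qed
    then have "real l * real (\<Sum>e\<in>X. zmult E (e - c)) \<le> m * real (\<Sum>w\<in>W. zmult E w)"
      by (metis of_nat_le_iff of_nat_mult)
    also have "\<dots> \<le> m * (C * r ^ degree P)" by (intro mult_left_mono sumW) auto
    finally have "r / cmod c * real (\<Sum>e\<in>X. zmult E (e - c)) \<le> m * (C * r ^ degree P)"
      using l(1) by (meson mult_right_mono of_nat_0_le_iff order_trans)
    then show "r * real (\<Sum>e\<in>X. zmult E (e - c)) \<le> cmod c * m * C * r ^ degree P"
      using cc by (simp add: field_simps)
  qed
qed

lemma num_bound_on_circles:
  assumes "E 0 \<noteq> 0" and p: "degree P = Suc p"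
  obtains K r0 where "K \<ge> 0" "r0 \<ge> 1" "\<And>r. r \<ge> r0 \<Longrightarrow> \<exists>t\<in>{r..2 * r}. \<forall>z. cmod z = t \<longrightarrow>
     E (z - c) \<noteq> 0 \<and> cmod (E z - mu z * E (z - c)) \<le> exp (K * (r ^ p * sqrt r)) * cmod (E (z - c))"
proof -
  \<comment> \<open>The half-order \<open>2 * p + 2\<close> of \<open>E\<close> is
    \<open>Suc N\<close>, so the quotient has the exponent \<open>r ^ p * sqrt r\<close>; since
    \<open>degree \<delta> \<le> p\<close>, the function \<open>mu\<close> stays below it.\<close>
  define N where "N = 2 * p + 1"
  have "egrowth E (Suc N)" using growth_E unfolding p N_def by simp
  then obtain K r0 where K: "K \<ge> 0" "r0 \<ge> 1" "\<And>r. r \<ge> r0 \<Longrightarrow> \<exists>t\<in>{r..2 * r}. \<forall>z. cmod z = t \<longrightarrow>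
    E z \<noteq> 0 \<and> (\<forall>h\<in>{- c}. E (z + h) \<noteq> 0 \<and> cmod (E z / E (z + h)) \<le> exp (K * sqrt r ^ N))"
    using difference_quotient_bound[of E N "{- c}"] assms(1) by blast
  have "egrowth mu (2 * degree \<delta>)"
    unfolding mu_def by (intro egrowth_diff egrowth_add egrowth_mult egrowth_const egrowth_exp_poly)
  then have "egrowth mu N"
    by (rule egrowth_mono) (use degree_\<delta> p in \<open>simp add: N_def\<close>)
  then obtain L where L: "L \<ge> 0" "\<And>r z. r \<ge> 1 \<Longrightarrow> cmod z \<le> 2 * r \<Longrightarrow> cmod (mu z) \<le> exp (L * sqrt r ^ N)"
    using egrowth_on_disc by blast
  show ?thesis
  proof (rule that)
    show "K + L + 1 \<ge> 0" using K L by simp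
    show "r0 \<ge> 1" by (rule K)
    fix r assume r: "r \<ge> r0"
    then have r1: "r \<ge> 1" using K by simp
    have sN: "sqrt r ^ N = r ^ p * sqrt r" using r1 by (simp add: N_def power_mult)
    have sN1: "sqrt r ^ N \<ge> 1" using r1 by (rule sqrt_power_ge_1)
    obtain t where t: "t \<in> {r..2 * r}" "\<And>z. cmod z = t \<Longrightarrow> E (z - c) \<noteq> 0"
      "\<And>z. cmod z = t \<Longrightarrow> cmod (E z / E (z - c)) \<le> exp (K * sqrt r ^ N)"
      using K(3)[OF r] by auto
    show "\<exists>t\<in>{r..2 * r}. \<forall>z. cmod z = t \<longrightarrow> E (z - c) \<noteq> 0 \<and>
      cmod (E z - mu z * E (z - c)) \<le> exp ((K + L + 1) * (r ^ p * sqrt r)) * cmod (E (z - c))"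
    proof (intro bexI[OF _ t(1)] allI impI conjI)
      fix z assume z: "cmod z = t"
      show nz: "E (z - c) \<noteq> 0" by (rule t(2)[OF z])
      have mu: "cmod (mu z) \<le> exp (L * sqrt r ^ N)" using L(2)[OF r1, of z] z t(1) by simp
      let ?s = "sqrt r ^ N"
      have "cmod (E z - mu z * E (z - c)) = cmod (E z / E (z - c) - mu z) * cmod (E (z - c))"
        using nz by (simp add: norm_mult[symmetric] left_diff_distrib)
      also have "\<dots> \<le> (exp (K * ?s) + exp (L * ?s)) * cmod (E (z - c))"
        using norm_triangle_ineq4[of "E z / E (z - c)" "mu z"] t(3)[OF z] mu
        by (intro mult_right_mono) auto
      also have "\<dots> \<le> exp ((K + L + 1) * ?s) * cmod (E (z - c))"
        by (intro mult_right_mono exp_add_exp_le K L sN1) simp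
      finally show "cmod (E z - mu z * E (z - c)) \<le>
        exp ((K + L + 1) * (r ^ p * sqrt r)) * cmod (E (z - c))" unfolding sN .
    qed
  qed
qed

text \<open>Logarithms in \<open>zeros_vs_growth\<close> compare \<open>const * r ^ Suc p\<close>
  zeros of \<open>b\<close> with terms of size \<open>r ^ p * sqrt r\<close>: the bound on the
  circle, and \<open>O(r ^ p)\<close> exceptional zeros that each cost
  \<open>ln (2 * t / \<epsilon>) = O(sqrt r)\<close>. Hence \<open>sqrt r\<close> would be
  bounded.\<close>

lemma num_zero_at_0:
  assumes p0: "degree P > 0" and nz0: "E 0 \<noteq> 0" "E (- c) \<noteq> 0" "E 0 - mu 0 * E (- c) \<noteq> 0"
  shows False
proof -
  obtain p where p: "degree P = Suc p" using p0 by (cases "degree P") auto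
  obtain K r0 where K: "K \<ge> 0" "r0 \<ge> 1" "\<And>r. r \<ge> r0 \<Longrightarrow> \<exists>t\<in>{r..2 * r}. \<forall>z. cmod z = t \<longrightarrow>
     E (z - c) \<noteq> 0 \<and> cmod (E z - mu z * E (z - c)) \<le> exp (K * (r ^ p * sqrt r)) * cmod (E (z - c))"
    using num_bound_on_circles[OF nz0(1) p] by metis
  obtain C r1 where C: "C \<ge> 0" "r1 \<ge> 1" "\<And>r t X. r \<ge> r1 \<Longrightarrow> t \<le> 2 * r \<Longrightarrow> finite X \<Longrightarrow> X \<subseteq> cball 0 t \<Longrightarrow>
    (\<And>e. e \<in> X \<Longrightarrow> zmult E (e - c) > zmult E e) \<Longrightarrow> E 0 \<noteq> 0 \<Longrightarrow>
    r * real (\<Sum>e\<in>X. zmult E (e - c)) \<le> C * r ^ degree P"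
    using exceptional_bound by metis
  obtain a C2 where a: "a > 0" "\<And>r. r > 0 \<Longrightarrow> finite {z \<in> cball 0 r. b z = 0} \<Longrightarrow>
    a * r ^ degree P - C2 \<le> real (card {z \<in> cball 0 r. b z = 0})"
    using zeros_exp_poly_count[OF p0, folded b_def] by blast
  have b0: "b 0 \<noteq> 0" using num_vanishes[of 0] nz0 by auto
  have finY: "finite {y \<in> cball 0 s. b y = 0}" for s using finite_zeros_cball[OF holb] b0 by blast
  \<comment> \<open>Exceptional points are zeros of \<open>E (z - c)\<close> and so keep a distance
    \<epsilon> from \<open>0\<close>, which bounds the cost of clearing the poles.\<close>
  have "continuous_on UNIV (\<lambda>z. E (z - c))" by (rule holomorphic_on_imp_continuous_on[OF holE1])
  then obtain \<epsilon> where e: "\<epsilon> > 0" "\<And>z. cmod z < \<epsilon> \<Longrightarrow> E (z - c) \<noteq> 0"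
    using continuous_on_avoid[of UNIV "\<lambda>z. E (z - c)" 0 0] nz0(2) by (auto simp: dist_norm)
  \<comment> \<open>The power of \<open>4\<close> arises because the zeros of \<open>b\<close> are
    counted only in the disc of radius \<open>r / 4\<close>.\<close>
  define \<alpha> where "\<alpha> = a / 4 ^ Suc p * ln 3"
  have \<alpha>: "\<alpha> > 0" using a by (simp add: \<alpha>_def)
  define C5 where "C5 = \<bar>C2 * ln 3 - ln (cmod (E 0 - mu 0 * E (- c))) + ln (cmod (E (- c)))\<bar>"
  define Q where "Q = K + C * (2 * sqrt (4 / \<epsilon>)) + C5"
  have Q0: "Q \<ge> 0" using K C e by (simp add: Q_def C5_def)
  have key: "\<alpha> * sqrt r \<le> Q" if r: "r \<ge> max (max r0 r1) \<epsilon>" for r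
  proof -
    have r01: "r \<ge> r0" "r \<ge> r1" "r \<ge> 1" "r \<ge> \<epsilon>" using r K C by auto
    obtain t where t: "t \<in> {r..2 * r}" "\<And>z. cmod z = t \<Longrightarrow> E (z - c) \<noteq> 0"
      "\<And>z. cmod z = t \<Longrightarrow> cmod (E z - mu z * E (z - c)) \<le>
        exp (K * (r ^ p * sqrt r)) * cmod (E (z - c))"
      using K(3)[OF r01(1)] by blast
    define X where "X = {e \<in> cball 0 t. zmult E (e - c) > zmult E e}"
    define Y where "Y = {y \<in> cball 0 (r / 4). b y = 0}"
    define D where "D = (\<Sum>e\<in>X. zmult E (e - c))"
    have Xe: "\<epsilon> \<le> cmod x" if "x \<in> X" for x
      using that e(2)[of x] zmult_pos_iff(1)[OF holE ntE, of "x - c"]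
        by (auto simp: X_def not_less[symmetric])
    have fY: "finite Y" unfolding Y_def by (rule finY)
    have pos: "0 < t" "0 \<le> exp (K * (r ^ p * sqrt r))" "0 < r / 4" "r / 4 \<le> t / 4"
      using t(1) r01 by auto
    note zw = zeros_vs_growth[OF nz0 pos(1) t(2) pos(2) t(3) pos(3,4) X_def Y_def fY e(1) Xe]
    have fX: "finite X" by (rule zw(1))
    have main: "cmod (E 0 - mu 0 * E (- c)) * 3 ^ card Y \<le>
        exp (K * (r ^ p * sqrt r)) * cmod (E (- c)) * (2 * t / \<epsilon>) ^ D"
      unfolding D_def by (rule zw(2))
    have D: "real D \<le> C * r ^ p"
    proof -
      have "r * real D \<le> C * r ^ degree P"
        unfolding D_def by (rule C(3)[OF r01(2) _ fX]) (use t nz0 in \<open>auto simp: X_def\<close>)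
      then show ?thesis using r01 p by (simp add: mult_ac)
    qed
    have cY: "a * (r / 4) ^ Suc p - C2 \<le> real (card Y)"
      using a(2)[OF pos(3) finY] unfolding p Y_def .
    have te: "2 * t / \<epsilon> \<ge> 1" "2 * t / \<epsilon> \<le> 4 * r / \<epsilon>" using t(1) r01 e(1) by (auto simp: field_simps)
    have "ln (cmod (E 0 - mu 0 * E (- c))) + card Y * ln 3 =
      ln (cmod (E 0 - mu 0 * E (- c)) * 3 ^ card Y)"
      using nz0 by (simp add: ln_mult_pos ln_realpow)
    also have "\<dots> \<le> ln (exp (K * (r ^ p * sqrt r)) * cmod (E (- c)) * (2 * t / \<epsilon>) ^ D)"
      using main nz0 te by (subst ln_le_cancel_iff) auto
    also have "\<dots> = K * (r ^ p * sqrt r) + ln (cmod (E (- c))) + D * ln (2 * t / \<epsilon>)"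
      using nz0 te t(1) r01 e by (simp add: ln_mult_pos ln_realpow)
    also have "D * ln (2 * t / \<epsilon>) \<le> C * r ^ p * (2 * sqrt (4 / \<epsilon>) * sqrt r)"
    proof (intro mult_mono D)
      have "ln (2 * t / \<epsilon>) \<le> ln (4 * r / \<epsilon>)" using te by (subst ln_le_cancel_iff) auto
      also have "\<dots> \<le> 2 * sqrt (4 * r / \<epsilon>)" using r01 e by (intro ln_le_two_sqrt) auto
      also have "4 * r / \<epsilon> = 4 / \<epsilon> * r" by simp
      finally show "ln (2 * t / \<epsilon>) \<le> 2 * sqrt (4 / \<epsilon>) * sqrt r"
        by (simp add: real_sqrt_mult del: times_divide_eq_left)
    qed (use C te r01 in auto)
    finally have 1: "card Y * ln 3 \<le> K * (r ^ p * sqrt r) + C * r ^ p * (2 * sqrt (4 / \<epsilon>) * sqrt r)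
       + (ln (cmod (E (- c))) - ln (cmod (E 0 - mu 0 * E (- c))))" by linarith
    have "(a * (r / 4) ^ Suc p - C2) * ln 3 \<le> card Y * ln 3" by (intro mult_right_mono cY) auto
    then have "a * (r / 4) ^ Suc p * ln 3 \<le>
      K * (r ^ p * sqrt r) + C * r ^ p * (2 * sqrt (4 / \<epsilon>) * sqrt r) + C5"
      using 1 unfolding C5_def left_diff_distrib by linarith
    also have "C5 \<le> C5 * (r ^ p * sqrt r)"
    proof -
      have "1 * 1 \<le> r ^ p * sqrt r" using r01 by (intro mult_mono one_le_power) auto
      then have "C5 * 1 \<le> C5 * (r ^ p * sqrt r)" by (intro mult_left_mono) (auto simp: C5_def)
      then show ?thesis by simp
    qed
    finally have "a * (r / 4) ^ Suc p * ln 3 \<le> Q * (r ^ p * sqrt r)"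
      by (simp add: Q_def algebra_simps)
    moreover have "a * (r / 4) ^ Suc p * ln 3 = \<alpha> * sqrt r * (r ^ p * sqrt r)"
      using r01 by (simp add: \<alpha>_def power_divide mult_ac)
    moreover have "r ^ p * sqrt r > 0" using r01 by simp
    ultimately show ?thesis by (simp only: mult_le_cancel_right_pos)
  qed
  define r where "r = (Q / \<alpha> + 1) ^ 2 + \<bar>r0\<bar> + \<bar>r1\<bar> + \<epsilon>"
  have "(Q / \<alpha> + 1) ^ 2 \<le> r" using e by (simp add: r_def)
  then have "Q / \<alpha> + 1 \<le> sqrt r" by (rule real_le_rsqrt)
  then have "\<alpha> * (Q / \<alpha> + 1) \<le> \<alpha> * sqrt r" using \<alpha> by (intro mult_left_mono) auto
  also have "\<dots> \<le> Q"
  proof (rule key)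
    have "0 \<le> (Q / \<alpha> + 1) ^ 2" by simp
    then have "r0 \<le> r" "r1 \<le> r" "\<epsilon> \<le> r" using e(1) unfolding r_def by linarith+
    then show "max (max r0 r1) \<epsilon> \<le> r" by simp
  qed
  finally show False using \<alpha> by (simp add: distrib_left)
qed

text \<open>If the entire difference is not identically zero, some point avoids its zeros and those
  of \<open>E z\<close> and \<open>E (z - c)\<close>. Translated to \<open>0\<close>, it contradicts
  \<open>num_zero_at_0\<close>.\<close>

lemma E_eq_mu:
  assumes p0: "degree P > 0" shows "E z = mu z * E (z - c)"
proof (rule ccontr)
  assume nz: "E z \<noteq> mu z * E (z - c)"
  have 1: "\<forall>\<^sub>F x in at 0. E x - mu x * E (x - c) \<noteq> 0"
    by (rule entire_eventually_nonzero[OF hol_num]) (use nz in auto)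
  have 2: "\<forall>\<^sub>F x in at 0. E (x - c) \<noteq> 0" by (rule entire_eventually_nonzero[OF holE1 ntE1])
  have 3: "\<forall>\<^sub>F x in at 0. E x \<noteq> 0" by (rule entire_eventually_nonzero[OF holE ntE])
  have "\<forall>\<^sub>F x in at (0::complex). E x - mu x * E (x - c) \<noteq> 0 \<and> E (x - c) \<noteq> 0 \<and> E x \<noteq> 0"
    using 1 2 3 by eventually_elim auto
  then obtain a where a: "E a - mu a * E (a - c) \<noteq> 0" "E (a - c) \<noteq> 0" "E a \<noteq> 0"
    using eventually_happens'[OF at_neq_bot] by blast
  interpret T: difference_system c "\<lambda>z. u (z + a)" "\<lambda>z. E (z + a)" "P \<circ>\<^sub>p [:a, 1:]" n m
    by (rule translate)
  have "T.mu 0 = mu a"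
    by (simp add: T.mu_def mu_def T.poly_\<delta> poly_\<delta> poly_pcompose add.commute)
  then show False
    using T.num_zero_at_0 p0 a by (simp add: degree_pcompose)
qed

end


section \<open>The polynomial \<open>P\<close> is constant\<close>

lemma poly_surj:
  fixes Q :: "complex poly" assumes "degree Q > 0"
  obtains z where "poly Q z = w"
proof -
  have "degree (Q + [:- w:]) = degree Q" using assms by (intro degree_add_eq_left) auto
  then have "\<not> constant (poly (Q + [:- w:]))" using assms by (simp add: constant_degree)
  then obtain z where "poly (Q + [:- w:]) z = 0"
    using Fundamental_Theorem_Algebra.fundamental_theorem_of_algebra by blast
  then show ?thesis using that[of z] by simp
qed

context difference_system
begin

text \<open>A zero of \<open>mu\<close> would make the multiplicity of the zeros of \<open>E\<close> jump up along a chain,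
  whereas it is maximal at all but finitely many points of the chain.\<close>

lemma mu_nonzero:
  assumes p0: "degree P > 0" shows "mu w \<noteq> 0"
proof
  assume mu0: "mu w = 0"
  let ?E1 = "\<lambda>z. E (z - c)"
  have Eeq: "E = (\<lambda>z. mu z * ?E1 z)" by (rule ext) (rule E_eq_mu[OF p0])
  have d1: "zdvd z (zmult E (z - c)) ?E1" for z using zdvd_iff[OF holE1 ntE1] zmult_E1 by simp
  have "zdvd w (1 + zmult E (w - c)) (\<lambda>z. mu z * ?E1 z)"
    by (rule zdvd_mult[OF zdvd_1[OF holmu mu0] d1])
  then have "zdvd w (1 + zmult E (w - c)) E" by (rule ssubst[OF Eeq])
  from zdvd_le_zmult[OF holE ntE this] have up: "zmult E (w - c) < zmult E w" by linarith
  have "zdvd z (0 + zmult E (z - c)) (\<lambda>z. mu z * ?E1 z)" for z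
    by (rule zdvd_mult[OF zdvd_0[OF holmu] d1])
  then have "zdvd z (0 + zmult E (z - c)) E" for z by (rule ssubst[OF Eeq])
  then have mono: "zmult E (z - c) \<le> zmult E z" for z using zdvd_iff[OF holE ntE] by simp
  have le: "zmult E (w - of_nat j * c) \<le> zmult E (w - c)" if "j \<ge> 1" for j
    using that
  proof (induction j rule: dec_induct)
    case (step j)
    have "w - of_nat (Suc j) * c = w - of_nat j * c - c" by (simp add: algebra_simps)
    then show ?case using mono[of "w - of_nat j * c"] step.IH by (simp only:) 
  qed simp
  have "card {1..m} < m"
    by (rule chain_minus[of _ w "zmult E (w - c)" 0]) (use le up in auto)
  then show False by simp
qed

lemma degree_P: "degree P = 0"
proof (rule ccontr)
  assume "degree P \<noteq> 0"
  then have p0: "degree P > 0" by simp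
  have n1: "n \<ge> 1" using m1 mn by simp
  \<comment> \<open>A nonconstant \<delta> takes the value \<open>ln ((n + 1) / n)\<close>, and
    there \<open>mu\<close> vanishes.\<close>
  have "degree \<delta> = 0"
  proof (rule ccontr)
    assume "degree \<delta> \<noteq> 0"
    then obtain w where w: "poly \<delta> w = of_real (ln ((n + 1) / n))" using poly_surj by blast
    have "exp (poly \<delta> w) = of_real ((n + 1) / n)"
      unfolding w exp_of_real using n1 by simp
    then have "mu w = 0" using n1 by (simp add: mu_def field_simps)
    then show False using mu_nonzero[OF p0] by blast
  qed
  then obtain d where "\<delta> = [:d:]" by (rule degree_eq_zeroE)
  then have d: "poly P (z - c) = poly P z + d" for z using poly_\<delta>[of z] by (simp add: algebra_simps)
  have dk: "poly P (- of_nat k * c) = poly P 0 + of_nat k * d" for k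
  proof (induction k)
    case (Suc k)
    have eq: "- of_nat (Suc k) * c = - of_nat k * c - c" by (simp add: algebra_simps)
    show ?case unfolding eq d Suc by (simp add: algebra_simps)
  qed simp
  define s where "s = - d / c"
  \<comment> \<open>Both polynomials agree at the infinitely many points
    \<open>- of_nat k * c\<close>.\<close>
  have Plin: "P = [:poly P 0, s:]"
  proof (rule ccontr)
    assume "P \<noteq> [:poly P 0, s:]"
    then have "finite {z. poly (P - [:poly P 0, s:]) z = 0}" by (intro poly_roots_finite) simp
    moreover have "range (\<lambda>k. - of_nat k * c) \<subseteq> {z. poly (P - [:poly P 0, s:]) z = 0}"
      using c0 dk by (auto simp: s_def)
    moreover have "inj (\<lambda>k. - of_nat k * c :: complex)" using c0 by (auto simp: inj_on_def)
    ultimately show False using finite_subset range_inj_infinite by blast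
  qed
  then have s0: "s \<noteq> 0" using p0 by (metis degree_pCons_0 less_irrefl pCons_0_0 degree_pCons_eq_if)
  have Pz: "poly P z = poly P 0 + s * z" for z by (subst Plin) simp
  define \<mu> where "\<mu> = of_nat n + 1 - of_nat n * exp d"
  have mu: "mu z = \<mu>" for z unfolding mu_def \<mu>_def poly_\<delta> d by simp
  have mu0: "\<mu> \<noteq> 0" using mu_nonzero[OF p0] mu by metis
  have E1: "E (z + c) = \<mu> * E z" for z using E_eq_mu[OF p0, of "z + c"] mu by simp
  have Ek: "E (z + of_nat k * c) = \<mu> ^ k * E z" for z k
  proof (induction k)
    case (Suc k)
    show ?case using E1[of "z + of_nat k * c"] Suc by (simp add: algebra_simps)
  qed simp
  \<comment> \<open>As translation by \<open>c\<close> multiplies \<open>E\<close> by \<mu>, the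
    equation \<open>star\<close> can be solved for \<open>E\<close>, which turns out to be a finite
    exponential sum.\<close>
  define q where "q = (\<lambda>z. \<Sum>k\<le>n. \<tau> k z / \<mu> ^ k)"
  have holq: "q holomorphic_on UNIV"
    unfolding q_def using egrowth_hol[OF egrowth_\<tau>] mu0 by (intro holomorphic_intros) auto
  have Eq: "E z = q z" for z
  proof (rule ccontr)
    assume "E z \<noteq> q z"
    then have "\<forall>\<^sub>F x in at 0. E x - q x \<noteq> 0"
      by (intro entire_eventually_nonzero holomorphic_intros holE holq) auto
    then have "\<forall>\<^sub>F x in at (0::complex). E x - q x \<noteq> 0 \<and> E x \<noteq> 0"
      using entire_eventually_nonzero[OF holE ntE, of 0] by eventually_elim auto
    then obtain x where x: "E x \<noteq> q x" "E x \<noteq> 0"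
      using eventually_happens'[OF at_neq_bot] by fastforce
    have "1 = (\<Sum>k\<le>n. \<tau> k x / E (x + of_nat k * c))"
      using star[of x] x(2) mu0 by (simp add: \<tau>_def b_def Ek)
    also have "\<dots> = q x / E x" unfolding q_def sum_divide_distrib Ek by simp
    finally show False using x by simp
  qed
  define \<eta> where "\<eta> = (\<Sum>k\<le>n. (-1) ^ (n - k) * of_nat (n choose k) / \<mu> ^ k)"
  have \<eta>: "\<eta> = (1 / \<mu> - 1) ^ n"
    unfolding \<eta>_def using binomial_ring[of "1 / \<mu>" "-1" n]
    by (simp add: power_divide mult_ac)
  \<comment> \<open>Here \<open>s * zs i = - of_nat i * of_real ((cmod s)\<^sup>2)\<close>, so along
    this sequence and all its translates \<open>exp (poly P z)\<close> tends to
    \<open>0\<close>.\<close>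
  define zs where "zs = (\<lambda>i::nat. - of_nat i * cnj s)"
  have lim_b: "(\<lambda>i. b (zs i + h)) \<longlonglongrightarrow> 1" for h
  proof -
    have eq: "exp (poly P (zs i + h)) = exp (poly P 0 + s * h) * of_real (exp (- (cmod s)\<^sup>2) ^ i)"
      for i
    proof -
      have "s * zs i = - of_nat i * of_real ((cmod s)\<^sup>2)"
        unfolding zs_def complex_norm_square by simp
      then have "poly P (zs i + h) = (poly P 0 + s * h) + of_real (- real i * (cmod s)\<^sup>2)"
        using Pz[of "zs i + h"] by (simp add: distrib_left)
      then have "exp (poly P (zs i + h)) =
        exp (poly P 0 + s * h) * of_real (exp (- real i * (cmod s)\<^sup>2))"
        by (simp only: exp_add exp_of_real)
      also have "exp (- real i * (cmod s)\<^sup>2) = exp (- (cmod s)\<^sup>2) ^ i"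
        by (simp add: exp_of_nat_mult[symmetric])
      finally show ?thesis .
    qed
    have "(\<lambda>i. 1 + exp (poly P 0 + s * h) * of_real (exp (- (cmod s)\<^sup>2) ^ i)) \<longlonglongrightarrow>
        1 + exp (poly P 0 + s * h) * of_real 0"
      by (intro tendsto_intros) (use s0 in simp)
    then show ?thesis unfolding b_def eq by simp
  qed
  have lim_q: "(\<lambda>i. q (zs i + h)) \<longlonglongrightarrow> \<eta>" for h
  proof -
    have "(\<lambda>i. \<Sum>k\<le>n. (-1) ^ (n - k) * of_nat (n choose k) * (\<Prod>j<k. b (zs i + (h + of_nat j * c))) / \<mu> ^ k)
      \<longlonglongrightarrow> (\<Sum>k\<le>n. (-1) ^ (n - k) * of_nat (n choose k) * (\<Prod>j<k. 1) / \<mu> ^ k)"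
      by (intro tendsto_intros lim_b) (use mu0 in auto)
    then show ?thesis by (simp add: q_def \<tau>_def \<eta>_def add.assoc)
  qed
  \<comment> \<open>Translation by \<open>c\<close> multiplies \<open>q\<close> by \<mu> but leaves
    the limit unchanged.\<close>
  have "(\<lambda>i. \<mu> * q (zs i + 0)) \<longlonglongrightarrow> \<mu> * \<eta>" by (intro tendsto_intros lim_q)
  moreover have "\<mu> * q (zs i + 0) = q (zs i + c)" for i using E1[of "zs i"] by (simp add: Eq)
  ultimately have "(\<lambda>i. q (zs i + c)) \<longlonglongrightarrow> \<mu> * \<eta>" by simp
  then have "\<mu> * \<eta> = \<eta>" by (rule LIMSEQ_unique[OF _ lim_q])
  \<comment> \<open>The alternative \<open>\<eta> = 0\<close> also gives \<open>\<mu> = 1\<close>,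
    because \<open>\<eta> = (1 / \<mu> - 1) ^ n\<close>.\<close>
  then have mu1: "\<mu> = 1" using \<eta> mu0 by auto
  then have ed: "exp d = 1" using n1 by (simp add: \<mu>_def)
  have bper: "b (z - c) = b z" for z unfolding b_def d exp_add ed by simp
  have bperk: "b (z - of_nat k * c) = b z" for z k
  proof (induction k)
    case (Suc k)
    have eq: "z - of_nat (Suc k) * c = z - of_nat k * c - c" by (simp add: algebra_simps)
    show ?case unfolding eq bper by (rule Suc)
  qed simp
  have uk: "u z = b z ^ k * u (z - of_nat k * c)" for z k
  proof (induction k)
    case (Suc k)
    have eq: "z - of_nat (Suc k) * c + c = z - of_nat k * c" by (simp add: algebra_simps)
    have A: "u (z - of_nat k * c) = b z * u (z - of_nat (Suc k) * c)"
      using u_shift[of "z - of_nat (Suc k) * c"] unfolding eq b_def[symmetric] bperk .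
    show ?case using Suc unfolding A by (simp only: power_Suc2 mult.assoc)
  qed simp
  obtain z0 where "poly P z0 = of_real pi * \<i>" using poly_surj[OF p0] by blast
  then have "b z0 = 0" by (simp add: b_def exp_Euler)
  then have d1: "zdvd z0 1 b" by (rule zdvd_1[OF holb])
  have "zdvd z0 k u" for k
  proof -
    have "zdvd z0 k (\<lambda>z. b z ^ k)" for k
    proof (induction k)
      case (Suc k)
      then show ?case using zdvd_mult[OF d1 Suc] by simp
    qed (simp add: zdvd_0)
    moreover have "(\<lambda>z. u (z - of_nat k * c)) holomorphic_on UNIV"
      using holomorphic_shift[OF holu, of "- (of_nat k * c)"] by simp
    ultimately have *: "zdvd z0 k (\<lambda>z. b z ^ k * u (z - of_nat k * c))" by (rule zdvd_multL)
    have eq: "u = (\<lambda>z. b z ^ k * u (z - of_nat k * c))" by (rule ext) (rule uk)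
    show ?thesis by (rule ssubst[where P = "zdvd z0 k", OF eq *])
  qed
  then have "Suc (zmult u z0) \<le> zmult u z0" using zdvd_le_zmult[OF holu ntu] by blast
  then show False by simp
qed

theorem E_constant: "\<exists>a. \<forall>z. E z = a"
  using growth_E egrowth_0_constant degree_P by simp

end


section \<open>Growth from the Nevanlinna characteristic\<close>

lemma ln_plus_nonneg: "0 \<le> ln_plus x" and ln_le_ln_plus: "ln x \<le> ln_plus x"
  by (auto simp: ln_plus_def)

lemma ln_plus_eq: "x \<ge> 0 \<Longrightarrow> ln_plus x = ln (max 1 x)"
  by (cases "x \<ge> 1"; cases "x = 0") (auto simp: ln_plus_def max_def)

lemma continuous_on_ln_plus:
  "continuous_on S g \<Longrightarrow> continuous_on S (\<lambda>x. ln_plus (cmod (g x)))"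
  by (simp add: ln_plus_eq) (intro continuous_intros, auto simp: max_def)

text \<open>Poisson's formula for the real part of a logarithm of \<open>h\<close>. For
  \<open>cmod z \<le> r / 2\<close> the kernel lies between \<open>0\<close> and \<open>3\<close>,
  so that \<open>ln\<close> may be replaced by \<open>ln_plus\<close> and the kernel by
  \<open>3\<close>.\<close>

lemma poisson_bound:
  assumes h: "h holomorphic_on cball 0 r" "\<And>z. z \<in> cball 0 r \<Longrightarrow> h z \<noteq> 0"
    and r: "r > 0" and z: "cmod z \<le> r / 2"
  shows "ln (cmod (h z)) \<le> 3 * proximity h r"
proof -
  obtain H where H: "H holomorphic_on cball 0 r" "\<And>z. z \<in> cball 0 r \<Longrightarrow> h z = exp (H z)"
    by (rule contractible_imp_holomorphic_log[OF h(1) _ h(2)]) (auto simp: convex_imp_contractible)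
  have ReH: "Re (H w) = ln (cmod (h w))" if "w \<in> cball 0 r" for w using H(2)[OF that] by simp
  define m :: complex where "m = of_real (r\<^sup>2 - (cmod z)\<^sup>2)"
  \<comment> \<open>The extra factor equals \<open>1\<close> at \<open>z\<close>. On the circle,
    where \<open>of_real (r\<^sup>2) = \<zeta> * cnj \<zeta>\<close>, it turns the Cauchy kernel
    into the real Poisson kernel \<open>k\<close>.\<close>
  define g where "g = (\<lambda>\<zeta>. H \<zeta> * m / (of_real (r\<^sup>2) - cnj z * \<zeta>))"
  have den: "of_real (r\<^sup>2) - cnj z * \<zeta> \<noteq> 0" if "\<zeta> \<in> cball 0 r" for \<zeta>
  proof
    assume "of_real (r\<^sup>2) - cnj z * \<zeta> = 0"
    then have "cmod (of_real (r\<^sup>2)) = cmod (cnj z * \<zeta>)" by simp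
    then have "r\<^sup>2 = cmod z * cmod \<zeta>" by (simp add: norm_mult norm_power)
    also have "\<dots> \<le> r / 2 * r" using that z r by (intro mult_mono) auto
    also have "\<dots> < r\<^sup>2" using r by (simp add: power2_eq_square)
    finally show False by simp
  qed
  have "g holomorphic_on cball 0 r"
    unfolding g_def by (intro holomorphic_intros H(1)) (use den in auto)
  then have "((\<lambda>\<zeta>. g \<zeta> / (\<zeta> - z)) has_contour_integral (2 * of_real pi * \<i> * g z)) (circlepath 0 r)"
    by (rule Cauchy_integral_circlepath_simple) (use z r in auto)
  moreover have "g z = H z"
  proof -
    have "of_real (r\<^sup>2) - cnj z * z = m"
      by (simp add: m_def complex_norm_square mult.commute del: of_real_power)
    then show ?thesis using den[of z] z r by (simp add: g_def)
  qed
  ultimately have int: "((\<lambda>\<theta>. g (of_real r * cis \<theta>) / (of_real r * cis \<theta> - z) * of_real r * \<i> * cis \<theta>)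
      has_integral (2 * of_real pi * \<i> * H z)) {0..2 * pi}"
    unfolding circlepath_def by (simp add: has_contour_integral_part_circlepath_iff mult_ac)
  define k where "k = (\<lambda>\<theta>. (r\<^sup>2 - (cmod z)\<^sup>2) / (cmod (of_real r * cis \<theta> - z))\<^sup>2)"
  have ker: "g (of_real r * cis \<theta>) / (of_real r * cis \<theta> - z) * of_real r * \<i> * cis \<theta> =
      \<i> * (H (of_real r * cis \<theta>) * of_real (k \<theta>))" for \<theta>
  proof -
    define \<zeta> where "\<zeta> = of_real r * cis \<theta>"
    have cz: "cmod \<zeta> = r" using r by (simp add: \<zeta>_def norm_mult)
    have nz: "\<zeta> - z \<noteq> 0" using cz z r by auto
    have z0: "\<zeta> \<noteq> 0" using cz r by auto
    have "of_real (r\<^sup>2) = \<zeta> * cnj \<zeta>" using cz complex_norm_square by metis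
    then have fac: "of_real (r\<^sup>2) - cnj z * \<zeta> = \<zeta> * cnj (\<zeta> - z)" by (simp add: algebra_simps)
    have "of_real (k \<theta>) = m / ((\<zeta> - z) * cnj (\<zeta> - z))"
      unfolding k_def m_def complex_norm_square[symmetric] \<zeta>_def by simp
    then have kk: "H \<zeta> * of_real (k \<theta>) = H \<zeta> * (m / ((\<zeta> - z) * cnj (\<zeta> - z)))" by (rule arg_cong)
    have "x * (y / (v * w)) = x * y / (\<zeta> * w) / v * \<zeta>" for x y v w using z0 by simp
    then have "H \<zeta> * of_real (k \<theta>) = g \<zeta> / (\<zeta> - z) * \<zeta>"
      unfolding g_def fac kk .
    then show ?thesis by (simp add: \<zeta>_def mult_ac)
  qed
  have "((\<lambda>\<theta>. Im (\<i> * (H (of_real r * cis \<theta>) * of_real (k \<theta>)))) has_integral Im (2 * of_real pi * \<i> * H z)) {0..2 * pi}"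
    using has_integral_Im[OF int] unfolding ker .
  then have int2: "((\<lambda>\<theta>. k \<theta> * Re (H (of_real r * cis \<theta>))) has_integral (2 * pi * Re (H z))) {0..2 * pi}"
    by (simp add: mult.commute)
  have onc: "of_real r * cis \<theta> \<in> cball 0 r" for \<theta> using r by (simp add: norm_mult)
  have k: "0 \<le> k \<theta>" "k \<theta> \<le> 3" for \<theta>
  proof -
    have "(cmod z)\<^sup>2 \<le> r\<^sup>2" using z r by (intro power_mono) auto
    then show "0 \<le> k \<theta>" by (simp add: k_def)
    have le: "r - cmod z \<le> cmod (of_real r * cis \<theta> - z)"
      using norm_triangle_ineq2[of "of_real r * cis \<theta>" z] r by (simp add: norm_mult)
    have "k \<theta> \<le> (r\<^sup>2 - (cmod z)\<^sup>2) / (r - cmod z)\<^sup>2"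
      unfolding k_def using le z r \<open>(cmod z)\<^sup>2 \<le> r\<^sup>2\<close>
        by (intro divide_left_mono power_mono mult_pos_pos) auto
    also have "\<dots> = (r + cmod z) / (r - cmod z)"
      using z r by (simp add: power2_eq_square square_diff_square_factored)
    also have "\<dots> \<le> 3" using z r by (simp add: divide_le_eq)
    finally show "k \<theta> \<le> 3" .
  qed
  have cont: "continuous_on {0..2 * pi} (\<lambda>\<theta>. ln_plus (cmod (h (of_real r * cis \<theta>))))"
  proof (rule continuous_on_ln_plus)
    show "continuous_on {0..2 * pi} (\<lambda>\<theta>. h (of_real r * cis \<theta>))"
      using onc by (intro continuous_on_compose2[OF holomorphic_on_imp_continuous_on[OF h(1)]]
        continuous_intros) auto
  qed
  have "((\<lambda>\<theta>. 3 * ln_plus (cmod (h (of_real r * cis \<theta>)))) has_integral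
      3 * integral {0..2 * pi} (\<lambda>\<theta>. ln_plus (cmod (h (of_real r * cis \<theta>))))) {0..2 * pi}"
    by (intro has_integral_mult_right integrable_integral integrable_continuous_real cont)
  with int2 have "2 * pi * Re (H z) \<le>
    3 * integral {0..2 * pi} (\<lambda>\<theta>. ln_plus (cmod (h (of_real r * cis \<theta>))))"
  proof (rule has_integral_le)
    fix \<theta>
    let ?x = "cmod (h (of_real r * cis \<theta>))"
    have "k \<theta> * ln ?x \<le> k \<theta> * ln_plus ?x" by (intro mult_left_mono ln_le_ln_plus k)
    also have "\<dots> \<le> 3 * ln_plus ?x" by (intro mult_right_mono k ln_plus_nonneg)
    finally show "k \<theta> * Re (H (of_real r * cis \<theta>)) \<le> 3 * ln_plus ?x" using ReH[OF onc] by simp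
  qed
  then show ?thesis
    using ReH[of z] z r by (simp add: proximity_def field_simps)
qed

text \<open>Each factor \<open>z - w\<close> is replaced by its reflection \<open>p w z\<close>,
  which is zero-free in the closed disc. By the identity \<open>pid\<close> the moduli agree on the
  circle, and the reflection dominates inside.\<close>

lemma blaschke_quotient:
  assumes F: "F holomorphic_on UNIV" "\<exists>z. F z \<noteq> 0" and t: "t > 0" and nz: "\<And>z. cmod z = t \<Longrightarrow> F z \<noteq> 0"
    and W: "W = {w \<in> cball 0 t. F w = 0}"
  obtains G where "G holomorphic_on UNIV" "\<And>z. z \<in> cball 0 t \<Longrightarrow> G z \<noteq> 0"
    "\<And>z. cmod z = t \<Longrightarrow> cmod (G z) = cmod (F z)" "\<And>z. cmod z \<le> t \<Longrightarrow> cmod (F z) \<le> cmod (G z)"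
    "\<And>z. cmod z \<le> t \<Longrightarrow> cmod (F z) = cmod (G z) *
        (\<Prod>w\<in>W. (t * cmod (z - w) / cmod (of_real (t\<^sup>2) - cnj w * z)) ^ zmult F w)"
proof -
  have fin: "finite W" using finite_zeros_cball[OF F] unfolding W by blast
  obtain h where h: "h holomorphic_on UNIV" "\<And>z. z \<in> cball 0 t \<Longrightarrow> h z \<noteq> 0"
    "\<And>z. F z = (\<Prod>w\<in>W. (z - w) ^ zmult F w) * h z"
    using factor_zeros_cball[OF F W] by metis
  define p where "p = (\<lambda>w z. (of_real (t\<^sup>2) - cnj w * z) / of_real t)"
  define G where "G = (\<lambda>z. (\<Prod>w\<in>W. p w z ^ zmult F w) * h z)"
  have wt: "cmod w < t" if "w \<in> W" for w
    using that nz[of w] W by (cases "cmod w = t") auto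
  have pnz: "p w z \<noteq> 0" if "w \<in> W" "cmod z \<le> t" for w z
  proof
    assume "p w z = 0"
    then have "of_real (t\<^sup>2) = cnj w * z" using t by (simp add: p_def)
    then have "cmod (of_real (t\<^sup>2)) = cmod w * cmod z" by (simp only: norm_mult complex_mod_cnj)
    then have "t\<^sup>2 = cmod w * cmod z" by (simp add: norm_power)
    also have "\<dots> \<le> cmod w * t" using that by (intro mult_left_mono) auto
    also have "\<dots> < t * t" using wt[OF that(1)] t by simp
    finally show False by (simp add: power2_eq_square)
  qed
  have pid: "(cmod (p w z))\<^sup>2 - (cmod (z - w))\<^sup>2 = (t\<^sup>2 - (cmod z)\<^sup>2) * (t\<^sup>2 - (cmod w)\<^sup>2) / t\<^sup>2"
    for w z
  proof -
    have "(cmod (of_real (t\<^sup>2) - cnj w * z))\<^sup>2 =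
      t\<^sup>2 * t\<^sup>2 - 2 * t\<^sup>2 * Re (cnj w * z) + (cmod w)\<^sup>2 * (cmod z)\<^sup>2"
      unfolding cmod_power2 by (simp add: power2_eq_square algebra_simps)
    moreover have "(cmod (z - w))\<^sup>2 = (cmod z)\<^sup>2 + (cmod w)\<^sup>2 - 2 * Re (cnj w * z)"
      unfolding cmod_power2 by (simp add: power2_eq_square algebra_simps)
    moreover have "(cmod (p w z))\<^sup>2 = (cmod (of_real (t\<^sup>2) - cnj w * z))\<^sup>2 / t\<^sup>2"
      by (simp add: p_def norm_divide power_divide)
    moreover have "(t\<^sup>2 * t\<^sup>2 - 2 * t\<^sup>2 * x + W * Z) / t\<^sup>2 - (Z + W - 2 * x) =
      (t\<^sup>2 - Z) * (t\<^sup>2 - W) / t\<^sup>2"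
      for x W Z :: real using t by (simp add: field_simps)
    ultimately show ?thesis by (simp only:)
  qed
  have le: "cmod (z - w) \<le> cmod (p w z)" if "w \<in> W" "cmod z \<le> t" for w z
  proof (rule power2_le_imp_le)
    have "(cmod z)\<^sup>2 \<le> t\<^sup>2" "(cmod w)\<^sup>2 \<le> t\<^sup>2" using that wt[OF that(1)]
      by (auto intro!: power_mono)
    then have "0 \<le> (t\<^sup>2 - (cmod z)\<^sup>2) * (t\<^sup>2 - (cmod w)\<^sup>2) / t\<^sup>2"
      by (intro divide_nonneg_nonneg mult_nonneg_nonneg) auto
    then show "(cmod (z - w))\<^sup>2 \<le> (cmod (p w z))\<^sup>2" unfolding pid[symmetric] by simp
  qed auto
  have eq: "cmod (p w z) = cmod (z - w)" if "cmod z = t" for w z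
    using pid[of w z] that by (simp add: power2_eq_iff_nonneg)
  have cF: "cmod (F z) = (\<Prod>w\<in>W. cmod (z - w) ^ zmult F w) * cmod (h z)" for z
    by (simp add: h(3)[of z] norm_mult prod_norm[symmetric] norm_power)
  have cG: "cmod (G z) = (\<Prod>w\<in>W. cmod (p w z) ^ zmult F w) * cmod (h z)" for z
    by (simp add: G_def norm_mult prod_norm[symmetric] norm_power)
  show ?thesis
  proof (rule that)
    show "G holomorphic_on UNIV" unfolding G_def p_def
      by (intro holomorphic_intros h(1)) (use t in auto)
    show "G z \<noteq> 0" if "z \<in> cball 0 t" for z using pnz h(2) that fin by (simp add: G_def)
    show "cmod (G z) = cmod (F z)" if "cmod z = t" for z unfolding cF cG eq[OF that] ..
    show "cmod (F z) \<le> cmod (G z)" if "cmod z \<le> t" for z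
      unfolding cF cG by (intro mult_right_mono prod_mono conjI power_mono le that) auto
    show "cmod (F z) = cmod (G z) *
        (\<Prod>w\<in>W. (t * cmod (z - w) / cmod (of_real (t\<^sup>2) - cnj w * z)) ^ zmult F w)" if "cmod z \<le> t"
          for z
    proof -
      have "t * cmod (z - w) / cmod (of_real (t\<^sup>2) - cnj w * z) = cmod (z - w) / cmod (p w z)" for w
        using t by (simp add: p_def norm_divide)
      then show ?thesis unfolding cF cG using pnz that fin
        by (simp add: power_divide prod_dividef)
    qed
  qed
qed

lemma proximity_cong:
  assumes "\<And>z. cmod z = \<bar>r\<bar> \<Longrightarrow> cmod (f z) = cmod (g z)"
  shows "proximity f r = proximity g r"
  unfolding proximity_def using assms by (simp add: norm_mult)

lemma proximity_nonneg: "0 \<le> proximity f r"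
proof (cases "(\<lambda>\<theta>. ln_plus (cmod (f (of_real r * cis \<theta>)))) integrable_on {0..2 * pi}")
  case True
  then show ?thesis by (simp add: proximity_def integral_nonneg ln_plus_nonneg)
qed (simp add: proximity_def not_integrable_integral)

text \<open>The proximity function sees only the circle, where \<open>F\<close> may be replaced by
  its Blaschke quotient \<open>G\<close>. As \<open>G\<close> is zero-free,
  \<open>poisson_bound\<close> applies to it, and inside it dominates \<open>F\<close>.\<close>

lemma egrowth_of_proximity:
  assumes F: "F holomorphic_on UNIV" and prox: "\<And>r. r \<ge> r0 \<Longrightarrow> proximity F r \<le> r ^ N"
  shows "egrowth F (2 * N)"
proof (cases "\<exists>z. F z \<noteq> 0")
  case False
  then have "F = (\<lambda>z. 0)" by auto
  then show ?thesis by (simp add: egrowth_const)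
next
  case True
  show ?thesis
  \<comment> \<open>One \<open>3\<close> comes from \<open>poisson_bound\<close>, which needs
    \<open>t \<ge> 2 * r\<close>; the power \<open>3 ^ N\<close> comes from
    \<open>t \<le> 3 * r\<close>.\<close>
  proof (rule egrowthI_circle[OF F, of "max 1 r0" "3 * 3 ^ N"])
    fix r assume r: "r \<ge> max 1 r0"
    have "infinite ({2 * r..3 * r} - cmod ` {w \<in> cball 0 (3 * r). F w = 0})"
      using r by (intro Diff_infinite_finite finite_imageI finite_zeros_cball[OF F True] infinite_Icc) simp
    then obtain t where t: "t \<in> {2 * r..3 * r}" "t \<notin> cmod ` {w \<in> cball 0 (3 * r). F w = 0}"
      using infinite_imp_nonempty by blast
    have nz: "F z \<noteq> 0" if "cmod z = t" for z using t that by (auto simp: image_iff)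
    have t0: "t > 0" using t r by auto
    obtain G where G: "G holomorphic_on UNIV" "\<And>z. z \<in> cball 0 t \<Longrightarrow> G z \<noteq> 0"
      "\<And>z. cmod z = t \<Longrightarrow> cmod (G z) = cmod (F z)" "\<And>z. cmod z \<le> t \<Longrightarrow> cmod (F z) \<le> cmod (G z)"
      by (rule blaschke_quotient[OF F True t0 nz refl]) (assumption, rule that, assumption+)
    show "\<exists>s\<ge>r. \<forall>z. cmod z = s \<longrightarrow> cmod (F z) \<le> exp (3 * 3 ^ N * sqrt r ^ (2 * N))"
    proof (intro exI[of _ r] conjI allI impI)
      fix z assume z: "cmod z = r"
      have "ln (cmod (G z)) \<le> 3 * proximity G t"
        by (rule poisson_bound) (use G holomorphic_on_subset t0 t z in auto)
      also have "proximity G t = proximity F t" by (rule proximity_cong) (use G(3) t0 in auto)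
      also have "\<dots> \<le> t ^ N" by (rule prox) (use t r in auto)
      also have "\<dots> \<le> (3 * r) ^ N" using t t0 by (intro power_mono) auto
      finally have "ln (cmod (G z)) \<le> 3 * 3 ^ N * r ^ N" by (simp add: power_mult_distrib)
      moreover have "cmod (G z) > 0" using G(2)[of z] z t r by auto
      ultimately have "cmod (G z) \<le> exp (3 * 3 ^ N * r ^ N)"
        by (metis exp_le_cancel_iff exp_ln)
      moreover have "cmod (F z) \<le> cmod (G z)" using z t r by (intro G(4)) auto
      moreover have "sqrt r ^ (2 * N) = r ^ N" using r by (simp add: power_mult)
      ultimately show "cmod (F z) \<le> exp (3 * 3 ^ N * sqrt r ^ (2 * N))" by simp
    qed simp
  qed simp
qed


text \<open>The Blaschke quotients of \<open>u\<close> and \<open>E\<close> have a zero-free quotient with the same modulus as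
  \<open>u / E\<close> on the circle, so that the Poisson formula bounds it from above and the
  Borel-Caratheodory inequality then bounds it from below.\<close>

lemma quotient_lower_bound:
  assumes E: "E holomorphic_on UNIV" and u: "u holomorphic_on UNIV"
    and zs: "E zs \<noteq> 0" "u zs \<noteq> 0" and \<delta>: "0 < \<delta>" "\<And>w. E w = 0 \<Longrightarrow> \<delta> \<le> cmod (zs - w)"
    and t: "t \<ge> 1" "16 * cmod zs \<le> t" "2 * \<delta> \<le> t"
    and nz: "\<And>z. cmod z = t \<Longrightarrow> E z \<noteq> 0" "\<And>z. cmod z = t \<Longrightarrow> u z \<noteq> 0"
    and W: "W = {w \<in> cball 0 t. E w = 0}"
    and A: "proximity (\<lambda>z. u z / E z) t \<le> A" and n: "real (\<Sum>w\<in>W. zmult E w) \<le> M"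
    and L: "\<And>z. cmod z = t \<Longrightarrow> cmod (u z) \<le> exp L" and z: "cmod z \<le> t / 16"
  shows "cmod (E z) \<le> exp (L + 6 * A + 3 * ln (cmod (E zs)) - 3 * ln (cmod (u zs)) + 6 * M * t / \<delta>)"
proof -
  have t0: "t > 0" using t by simp
  have ntE: "\<exists>z. E z \<noteq> 0" and ntu: "\<exists>z. u z \<noteq> 0" using zs by auto
  have fin: "finite W" using finite_zeros_cball[OF E ntE] unfolding W by blast
  obtain Eb where Eb: "Eb holomorphic_on UNIV" "\<And>z. z \<in> cball 0 t \<Longrightarrow> Eb z \<noteq> 0"
    "\<And>z. cmod z = t \<Longrightarrow> cmod (Eb z) = cmod (E z)" "\<And>z. cmod z \<le> t \<Longrightarrow> cmod (E z) \<le> cmod (Eb z)"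
    "\<And>z. cmod z \<le> t \<Longrightarrow> cmod (E z) = cmod (Eb z) *
        (\<Prod>w\<in>W. (t * cmod (z - w) / cmod (of_real (t\<^sup>2) - cnj w * z)) ^ zmult E w)"
    by (rule blaschke_quotient[OF E ntE t0 nz(1) W]) (assumption, rule that, assumption+)
  obtain ub where ub: "ub holomorphic_on UNIV" "\<And>z. z \<in> cball 0 t \<Longrightarrow> ub z \<noteq> 0"
    "\<And>z. cmod z = t \<Longrightarrow> cmod (ub z) = cmod (u z)" "\<And>z. cmod z \<le> t \<Longrightarrow> cmod (u z) \<le> cmod (ub z)"
    by (rule blaschke_quotient[OF u ntu t0 nz(2) refl]) (assumption, rule that, assumption+)
  define Q where "Q = (\<lambda>z. ub z / Eb z)"
  have Q: "Q holomorphic_on cball 0 t" "\<And>z. z \<in> cball 0 t \<Longrightarrow> Q z \<noteq> 0"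
    unfolding Q_def using Eb(1,2) ub(1,2) holomorphic_on_subset
    by (auto intro!: holomorphic_intros intro: holomorphic_on_subset)
  have Qub: "ln (cmod (Q x)) \<le> 3 * A" if "cmod x \<le> t / 2" for x
  proof -
    have "ln (cmod (Q x)) \<le> 3 * proximity Q t" by (rule poisson_bound[OF Q t0 that])
    also have "proximity Q t = proximity (\<lambda>z. u z / E z) t"
      by (rule proximity_cong) (use Eb(3) ub(3) t0 in \<open>auto simp: Q_def norm_divide\<close>)
    finally show ?thesis using A by simp
  qed
  obtain G where G: "G holomorphic_on cball 0 t" "\<And>z. z \<in> cball 0 t \<Longrightarrow> Q z = exp (G z)"
    by (rule contractible_imp_holomorphic_log[OF Q(1) _ Q(2)]) (auto simp: convex_imp_contractible)
  have ReG: "Re (G x) = ln (cmod (Q x))" if "cmod x \<le> t" for x using G(2)[of x] that by simp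
  have sub: "cmod x \<le> t / 2" if "x \<in> ball zs (t / 4)" for x
    using that norm_triangle_ineq[of zs "x - zs"] t by (simp add: dist_norm norm_minus_commute)
  have "cmod (G z - G zs) \<le> 2 * (3 * A - Re (G zs))"
  \<comment> \<open>Both \<open>z\<close> and \<open>zs\<close> have modulus at most
    \<open>t / 16\<close>, so \<open>z\<close> is within half of \<open>t / 4\<close> from
    \<open>zs\<close>, and the disc stays within \<open>t / 2\<close>, where \<open>Qub\<close>
    holds.\<close>
  proof (rule Borel_Caratheodory[of G zs "t / 4"])
    show "G holomorphic_on ball zs (t / 4)"
      using G(1) by (rule holomorphic_on_subset) (use sub t0 in force)
    show "Re (G x) \<le> 3 * A" if "x \<in> ball zs (t / 4)" for x
      using ReG[of x] Qub[OF sub[OF that]] sub[OF that] t0 by simp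
    show "z \<in> cball zs (t / 4 / 2)"
      using z t norm_triangle_ineq4[of zs z] by (simp add: dist_norm)
  qed (use t0 in simp)
  then have low: "Re (G z) \<ge> 3 * Re (G zs) - 6 * A"
    using abs_Re_le_cmod[of "G z - G zs"] by simp
  have zst: "cmod zs \<le> t" using t by simp
  \<comment> \<open>At \<open>zs\<close> the function \<open>Eb\<close> may exceed \<open>E\<close>,
    but each Blaschke factor is at least \<open>\<delta> / (2 * t)\<close>. The loss is at most the
    number of zeros times \<open>ln (2 * t / \<delta>)\<close>.\<close>
  have Ebz: "ln (cmod (Eb zs)) \<le> ln (cmod (E zs)) + 2 * M * t / \<delta>"
  proof -
    have "(\<Prod>w\<in>W. (\<delta> / (2 * t)) ^ zmult E w) \<le>
        (\<Prod>w\<in>W. (t * cmod (zs - w) / cmod (of_real (t\<^sup>2) - cnj w * zs)) ^ zmult E w)"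
    proof (intro prod_mono conjI power_mono)
      fix w assume w: "w \<in> W"
      have d: "\<delta> \<le> cmod (zs - w)" using \<delta>(2)[of w] w W by simp
      have "cmod (of_real (t\<^sup>2) - cnj w * zs) \<le> t\<^sup>2 + cmod w * cmod zs"
        by (rule order_trans[OF norm_triangle_ineq4]) (simp add: norm_mult norm_power)
      also have "\<dots> \<le> t\<^sup>2 + t * t" using w W zst t0 by (intro add_left_mono mult_mono) auto
      finally have up: "cmod (of_real (t\<^sup>2) - cnj w * zs) \<le> 2 * t * t"
        by (simp add: power2_eq_square)
      have pos: "cmod (of_real (t\<^sup>2) - cnj w * zs) > 0"
      proof -
        have "cmod (cnj w * zs) < t\<^sup>2"
        proof -
          have "cmod (cnj w * zs) \<le> t * (t / 16)"
            unfolding norm_mult complex_mod_cnj using w W t by (intro mult_mono) auto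
          also have "\<dots> < t\<^sup>2" using t0 by (simp add: power2_eq_square)
          finally show ?thesis .
        qed
        then have "cnj w * zs \<noteq> of_real (t\<^sup>2)" by (auto simp: norm_power)
        then show ?thesis by simp
      qed
      have "\<delta> / (2 * t) = t * \<delta> / (2 * t * t)" using t0 by simp
      also have "\<dots> \<le> t * cmod (zs - w) / cmod (of_real (t\<^sup>2) - cnj w * zs)"
        using d up pos t0 \<delta>(1) by (intro frac_le mult_left_mono) auto
      finally show "\<delta> / (2 * t) \<le> t * cmod (zs - w) / cmod (of_real (t\<^sup>2) - cnj w * zs)" .
    qed (use \<delta> t0 in auto)
    then have "cmod (Eb zs) * (\<delta> / (2 * t)) ^ (\<Sum>w\<in>W. zmult E w) \<le> cmod (E zs)"
      unfolding Eb(5)[OF zst] by (intro mult_left_mono) (auto simp: power_sum)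
    then have "ln (cmod (Eb zs) * (\<delta> / (2 * t)) ^ (\<Sum>w\<in>W. zmult E w)) \<le> ln (cmod (E zs))"
      using zs Eb(2)[of zs] zst t0 \<delta> by (subst ln_le_cancel_iff) auto
    then have "ln (cmod (Eb zs)) + real (\<Sum>w\<in>W. zmult E w) * ln (\<delta> / (2 * t)) \<le> ln (cmod (E zs))"
      using Eb(2)[of zs] zst t0 \<delta> by (simp add: ln_mult_pos ln_realpow)
    moreover have "real (\<Sum>w\<in>W. zmult E w) * ln (\<delta> / (2 * t)) =
        - (real (\<Sum>w\<in>W. zmult E w) * ln (2 * t / \<delta>))" using t0 \<delta>
          by (simp add: ln_div right_diff_distrib)
    moreover have "real (\<Sum>w\<in>W. zmult E w) * ln (2 * t / \<delta>) \<le> M * (2 * t / \<delta>)"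
    proof (intro mult_mono n)
      show "0 \<le> M" using n by (meson of_nat_0_le_iff order_trans)
      show "ln (2 * t / \<delta>) \<le> 2 * t / \<delta>" using ln_le_minus_one[of "2 * t / \<delta>"] t0 \<delta> by simp
      show "0 \<le> ln (2 * t / \<delta>)" using t \<delta> by (intro ln_ge_zero) (simp add: field_simps)
    qed
    moreover have "M * (2 * t / \<delta>) = 2 * M * t / \<delta>" by simp
    ultimately show ?thesis by linarith
  qed
  have "Re (G zs) = ln (cmod (ub zs)) - ln (cmod (Eb zs))"
    using ReG[OF zst] Eb(2)[of zs] ub(2)[of zs] zst by (simp add: Q_def norm_divide ln_div)
  moreover have "ln (cmod (u zs)) \<le> ln (cmod (ub zs))"
    using ub(4)[OF zst] ub(2)[of zs] zst zs by (subst ln_le_cancel_iff) auto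
  ultimately have "Re (G zs) \<ge> ln (cmod (u zs)) - ln (cmod (E zs)) - 2 * M * t / \<delta>"
    using Ebz by linarith
  then have low': "- Re (G z) \<le> 6 * A + 3 * ln (cmod (E zs)) - 3 * ln (cmod (u zs)) + 6 * M * t / \<delta>"
    using low by simp
  have zt: "cmod z \<le> t" using z t0 by simp
  have "cmod (E z) \<le> cmod (Eb z)" using zt by (rule Eb(4))
  also have "\<dots> = cmod (ub z) * exp (- Re (G z))"
  proof -
    have "cmod (Q z) = exp (Re (G z))" using G(2)[of z] zt by simp
    then show ?thesis using Eb(2)[of z] ub(2)[of z] zt
      by (simp add: Q_def norm_divide exp_minus field_simps)
  qed
  also have "\<dots> \<le> exp L * exp (- Re (G z))"
    using maximum_modulus_sphere[OF ub(1), of t "exp L" z] ub(3) L zt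
      by (intro mult_right_mono) auto
  also have "\<dots> \<le> exp (L + 6 * A + 3 * ln (cmod (E zs)) - 3 * ln (cmod (u zs)) + 6 * M * t / \<delta>)"
    using low' by (simp flip: exp_add)
  finally show ?thesis .
qed

section \<open>Finite order of quotients of entire functions\<close>

lemma egrowth_of_quotient:
  assumes E: "E holomorphic_on UNIV" "\<exists>z. E z \<noteq> 0" and u: "egrowth u N" "\<exists>z. u z \<noteq> 0"
    and q: "q \<ge> 1" and C: "C \<ge> 0"
    and bd: "\<And>r. r \<ge> r0 \<Longrightarrow> \<exists>t\<in>{r..q * r}. (\<forall>z. cmod z = t \<longrightarrow> E z \<noteq> 0 \<and> u z \<noteq> 0) \<and>
      proximity (\<lambda>z. u z / E z) t \<le> C * r ^ M \<and> real (\<Sum>w\<in>{w \<in> cball 0 t. E w = 0}. zmult E w) \<le>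
        C * r ^ M"
  shows "\<exists>N. egrowth E N"
proof -
  have "\<forall>\<^sub>F x in at (0::complex). E x \<noteq> 0 \<and> u x \<noteq> 0"
    using entire_eventually_nonzero[OF E, of 0] entire_eventually_nonzero[OF egrowth_hol[OF u(1)] u(2), of 0]
    by eventually_elim auto
  then obtain zs where zs: "E zs \<noteq> 0" "u zs \<noteq> 0"
    using eventually_happens'[OF at_neq_bot] by blast
  have "continuous_on UNIV E" using E(1) by (rule holomorphic_on_imp_continuous_on)
  then obtain \<delta> where \<delta>: "\<delta> > 0" "\<And>w. cmod (zs - w) < \<delta> \<Longrightarrow> E w \<noteq> 0"
    using continuous_on_avoid[of UNIV E zs 0] zs(1) by (auto simp: dist_norm)
  obtain K where K: "K \<ge> 0" "\<And>z. cmod (u z) \<le> exp (K * sqrt (1 + cmod z) ^ N)"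
    using egrowthE[OF u(1)] by metis
  define l where "l = \<bar>3 * ln (cmod (E zs)) - 3 * ln (cmod (u zs))\<bar>"
  define R where "R = \<bar>r0\<bar> + 1 + 16 * cmod zs + 2 * \<delta>"
  define B where "B = K * 2 ^ N * q ^ N + 6 * C + l + 6 * C * q / \<delta>"
  \<comment> \<open>\<open>M\<close> serves the proximity and the number of zeros, \<open>N\<close>
    the growth of \<open>u\<close>, and one more power the factor \<open>t\<close> that accompanies
    the number of zeros.\<close>
  define M' where "M' = M + N + 1"
  have "egrowth E (2 * M')"
  proof (rule egrowthI_circle[OF E(1), of R "B * 16 ^ M'"])
    show "R \<ge> 1" using \<delta> by (simp add: R_def)
    fix r assume r: "r \<ge> R"
    have rr: "16 * r \<ge> r0" "r \<ge> 1" "16 * cmod zs \<le> r" "2 * \<delta> \<le> r"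
      using r \<delta>(1) norm_ge_zero[of zs] unfolding R_def by linarith+
    obtain t where t: "t \<in> {16 * r..q * (16 * r)}" "\<And>z. cmod z = t \<Longrightarrow> E z \<noteq> 0" "\<And>z. cmod z = t \<Longrightarrow>
      u z \<noteq> 0"
      "proximity (\<lambda>z. u z / E z) t \<le> C * (16 * r) ^ M"
      "real (\<Sum>w\<in>{w \<in> cball 0 t. E w = 0}. zmult E w) \<le> C * (16 * r) ^ M"
      using bd[OF rr(1)] by blast
    show "\<exists>t\<ge>r. \<forall>z. cmod z = t \<longrightarrow> cmod (E z) \<le> exp (B * 16 ^ M' * sqrt r ^ (2 * M'))"
    proof (intro exI[of _ "t / 16"] conjI allI impI)
      show "t / 16 \<ge> r" using t(1) by simp
      fix z assume z: "cmod z = t / 16"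
      let ?x = "16 * r"
      have x1: "?x \<ge> 1" using rr by simp
      define L where "L = K * sqrt (1 + t) ^ N"
      have Lt: "cmod (u y) \<le> exp L" if "cmod y = t" for y using K(2)[of y] that by (simp add: L_def)
      have d: "\<delta> \<le> cmod (zs - w)" if "E w = 0" for w using \<delta>(2)[of w] that by (meson not_le)
      have tt: "t \<ge> 1" "16 * cmod zs \<le> t" "2 * \<delta> \<le> t" using t(1) rr by auto
      have "cmod (E z) \<le>
        exp (L + 6 * (C * ?x ^ M) + 3 * ln (cmod (E zs)) - 3 * ln (cmod (u zs)) + 6 * (C * ?x ^ M) * t / \<delta>)"
        by (rule quotient_lower_bound[OF E(1) egrowth_hol[OF u(1)] zs \<delta>(1) d tt t(2,3) refl t(4,5) Lt])
          (use z in auto)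
      also have "\<dots> \<le> exp (B * ?x ^ M')"
      proof -
        have xp: "?x ^ j \<le> ?x ^ M'" if "j \<le> M'" for j using x1 that
          by (rule power_increasing[rotated])
        have "L \<le> K * 2 ^ N * q ^ N * ?x ^ M'"
        proof -
          have "1 + t \<le> (2 * (q * ?x)) ^ 2"
          proof -
            have "1 \<le> q * ?x" using q x1 mult_mono[of 1 q 1 ?x] by simp
            then have "1 + t \<le> 2 * (q * ?x)" using t(1) by simp
            also have "\<dots> \<le> (2 * (q * ?x)) * (2 * (q * ?x))"
              using \<open>1 \<le> q * ?x\<close> mult_left_mono[of 1 "2 * (q * ?x)" "2 * (q * ?x)"] by linarith
            finally show ?thesis by (simp add: power2_eq_square)
          qed
          then have "sqrt (1 + t) \<le> 2 * (q * ?x)" using q x1 by (intro real_le_lsqrt) auto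
          then have "sqrt (1 + t) ^ N \<le> (2 * (q * ?x)) ^ N" using tt by (intro power_mono) auto
          also have "\<dots> = 2 ^ N * q ^ N * ?x ^ N" by (simp only: power_mult_distrib mult.assoc)
          also have "\<dots> \<le> 2 ^ N * q ^ N * ?x ^ M'" using q
            by (intro mult_left_mono xp) (auto simp: M'_def)
          finally show ?thesis unfolding L_def using K(1) by (simp add: mult_left_mono mult.assoc)
        qed
        moreover have "6 * (C * ?x ^ M) \<le> 6 * C * ?x ^ M'"
          unfolding mult.assoc using C by (intro mult_left_mono xp) (auto simp: M'_def)
        moreover have "3 * ln (cmod (E zs)) - 3 * ln (cmod (u zs)) \<le> l * ?x ^ M'"
        proof -
          have "l * 1 \<le> l * ?x ^ M'" using one_le_power[OF x1]
            by (intro mult_left_mono) (auto simp: l_def)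
          moreover have "3 * ln (cmod (E zs)) - 3 * ln (cmod (u zs)) \<le> l" by (simp add: l_def)
          ultimately show ?thesis by simp
        qed
        moreover have "6 * (C * ?x ^ M) * t / \<delta> \<le> 6 * C * q / \<delta> * ?x ^ M'"
        proof -
          have "?x ^ M * t \<le> ?x ^ M * (q * ?x)" using t(1) x1 by (intro mult_left_mono) auto
          also have "\<dots> = q * ?x ^ (M + 1)" by simp
          also have "\<dots> \<le> q * ?x ^ M'" using q by (intro mult_left_mono xp) (auto simp: M'_def)
          finally have "6 * C / \<delta> * (?x ^ M * t) \<le> 6 * C / \<delta> * (q * ?x ^ M')"
            using C \<delta>(1) by (intro mult_left_mono) auto
          then show ?thesis by (simp add: mult_ac)
        qed
        ultimately show ?thesis by (simp add: B_def distrib_right)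
      qed
      also have "B * ?x ^ M' = B * 16 ^ M' * sqrt r ^ (2 * M')"
        using rr by (simp add: power_mult power_mult_distrib)
      finally show "cmod (E z) \<le> exp (B * 16 ^ M' * sqrt r ^ (2 * M'))" .
    qed
  qed
  then show ?thesis by blast
qed

text \<open>Hadamard's theorem for a zero-free quotient. The minimum modulus of \<open>u\<close> on
  good circles bounds \<open>g\<close> there, so a logarithm of \<open>g\<close> has real part of at
  most polynomial growth. Borel-Caratheodory extends this to the modulus, and Liouville's theorem
  makes the logarithm a polynomial.\<close>

lemma entire_nonvanishing_exp_poly:
  assumes u: "egrowth u N" "\<exists>z. u z \<noteq> 0" and v: "egrowth v N"
    and g: "g holomorphic_on UNIV" "\<And>z. g z \<noteq> 0" and eq: "\<And>z. v z = g z * u z"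
  shows "\<exists>P. \<forall>z. g z = exp (poly P z)"
proof -
  obtain a where a: "u a \<noteq> 0" using u(2) by blast
  have gs: "(\<lambda>z. g (z + a)) holomorphic_on UNIV" by (rule holomorphic_shift[OF g(1)])
  have us: "egrowth (\<lambda>z. u (z + a)) N" "egrowth (\<lambda>z. v (z + a)) N" by (intro egrowth_shift u v)+
  obtain K where K: "K \<ge> 0" "\<And>r. r \<ge> 1 \<Longrightarrow> \<exists>t\<in>{r..2 * r}. \<forall>z. cmod z = t \<longrightarrow>
    u (z + a) \<noteq> 0 \<and> exp (- (K * sqrt r ^ N)) \<le> cmod (u (z + a))"
    using minimum_modulus[OF us(1)] a by auto
  obtain L where L: "L \<ge> 0" "\<And>r z. r \<ge> 1 \<Longrightarrow> cmod z \<le> 2 * r \<Longrightarrow> cmod (v (z + a)) \<le> exp (L * sqrt r ^ N)"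
    by (rule egrowth_on_disc[OF us(2)]) (rule that, assumption+)
  have "egrowth (\<lambda>z. g (z + a)) N"
  proof (rule egrowthI_circle[OF gs order_refl, of "L + K"])
    fix r :: real assume r: "r \<ge> 1"
    obtain t where t: "t \<in> {r..2 * r}" "\<And>z. cmod z = t \<Longrightarrow> u (z + a) \<noteq> 0"
      "\<And>z. cmod z = t \<Longrightarrow> exp (- (K * sqrt r ^ N)) \<le> cmod (u (z + a))"
      using K(2)[OF r] by blast
    show "\<exists>t\<ge>r. \<forall>z. cmod z = t \<longrightarrow> cmod (g (z + a)) \<le> exp ((L + K) * sqrt r ^ N)"
    proof (intro exI[of _ t] conjI allI impI)
      fix z assume z: "cmod z = t"
      have v: "cmod (v (z + a)) \<le> exp (L * sqrt r ^ N)" using L(2)[OF r, of z] z t(1) by simp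
      have "cmod (g (z + a)) * exp (- (K * sqrt r ^ N)) \<le> cmod (g (z + a)) * cmod (u (z + a))"
        using t(3)[OF z] by (intro mult_left_mono) auto
      also have "\<dots> = cmod (v (z + a))" by (simp add: eq norm_mult)
      also note v
      finally have "cmod (g (z + a)) \<le> exp (L * sqrt r ^ N) * exp (K * sqrt r ^ N)"
        by (simp add: exp_minus field_simps)
      then show "cmod (g (z + a)) \<le> exp ((L + K) * sqrt r ^ N)"
        by (simp add: power_mult_distrib distrib_right mult.assoc flip: exp_add)
    qed (use t in auto)
  qed
  from egrowth_shift[OF this, of "- a"] have "egrowth g N" by simp
  then obtain C where C: "C \<ge> 0" "\<And>z. cmod (g z) \<le> exp (C * sqrt (1 + cmod z) ^ N)"
    using egrowthE by blast
  obtain H where H: "H holomorphic_on UNIV" "\<And>z. g z = exp (H z)"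
    using contractible_imp_holomorphic_log[OF g(1)] g(2) by (metis UNIV_I contractible_UNIV)
  define A where "A = \<bar>Re (H 0)\<bar>"
  define c0 where "c0 = C * 2 ^ N + A"
  have "cmod (H z) \<le> (2 * c0 + cmod (H 0)) * cmod z ^ N" if z: "1 \<le> cmod z" for z
  proof -
    let ?R = "2 * cmod z"
    have "cmod (H z - H 0) \<le> 2 * (C * 2 ^ N * cmod z ^ N - Re (H 0))"
    proof (rule Borel_Caratheodory[of H 0 ?R])
      show "H holomorphic_on ball 0 ?R" using H(1) by (rule holomorphic_on_subset) simp
      fix x :: complex assume x: "x \<in> ball 0 ?R"
      have "exp (Re (H x)) \<le> exp (C * sqrt (1 + cmod x) ^ N)" using C(2)[of x] by (simp add: H(2))
      then have "Re (H x) \<le> C * sqrt (1 + cmod x) ^ N" by simp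
      also have "\<dots> \<le> C * (2 * cmod z) ^ N"
      proof (intro mult_left_mono power_mono C)
        have "1 + cmod x \<le> 4 * cmod z * 1" using x z by simp
        also have "\<dots> \<le> 4 * cmod z * cmod z" using z by (intro mult_left_mono) auto
        finally show "sqrt (1 + cmod x) \<le> 2 * cmod z"
          by (intro real_le_lsqrt) (auto simp: power2_eq_square)
      qed auto
      finally show "Re (H x) \<le> C * 2 ^ N * cmod z ^ N" by (simp add: power_mult_distrib)
    qed (use z in auto)
    moreover have "1 \<le> cmod z ^ N" using z by (rule one_le_power)
    then have "A * 1 \<le> A * cmod z ^ N" "cmod (H 0) * 1 \<le> cmod (H 0) * cmod z ^ N"
      by (intro mult_left_mono; simp add: A_def)+
    moreover have "- Re (H 0) \<le> A" by (simp add: A_def)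
    moreover have "cmod (H z) \<le> cmod (H z - H 0) + cmod (H 0)"
      using norm_triangle_ineq[of "H z - H 0" "H 0"] by simp
    ultimately show ?thesis unfolding c0_def distrib_right distrib_left by simp
  qed
  then have "H z = (\<Sum>k\<le>N. (deriv ^^ k) H 0 / fact k * z ^ k)" for z
    by (intro Liouville_polynomial[OF H(1), of 1]) auto
  then have "H z = poly (\<Sum>k\<le>N. monom ((deriv ^^ k) H 0 / fact k) k) z" for z
    by (simp add: poly_sum poly_monom)
  then show ?thesis using H(2) by (intro exI[of _ "\<Sum>k\<le>N. monom ((deriv ^^ k) H 0 / fact k) k"]) simp
qed


section \<open>Exceptional radii, pole counting and finite order\<close>

text \<open>The logarithmic measure of \<open>{r..q * r}\<close> is \<open>ln q\<close>, chosen as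
  that of \<open>S\<close> plus one, and a countable set is null. The ratio \<open>q\<close> is the
  same for all \<open>r\<close>.\<close>

lemma radius_outside:
  assumes "finite_log_measure S"
  obtains q where "q \<ge> 1" "\<And>r D. r \<ge> 1 \<Longrightarrow> countable D \<Longrightarrow> \<exists>t\<in>{r..q * r}. t \<notin> S \<and> t \<notin> D"
proof -
  have S: "S \<in> sets lebesgue" "(\<integral>\<^sup>+ r \<in> S. ennreal (1 / r) \<partial>lebesgue) < \<infinity>"
    using assms by (auto simp: finite_log_measure_def)
  define V where "V = enn2real (\<integral>\<^sup>+ r \<in> S. ennreal (1 / r) \<partial>lebesgue)"
  have V: "V \<ge> 0" "(\<integral>\<^sup>+ r \<in> S. ennreal (1 / r) \<partial>lebesgue) = ennreal V"
    using S(2) by (auto simp: V_def less_top)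
  define q where "q = exp (V + 1)"
  show ?thesis
  proof (rule that)
    show "q \<ge> 1" using V by (simp add: q_def)
    fix r :: real and D :: "real set"
    assume r: "r \<ge> 1" and D: "countable D"
    show "\<exists>t\<in>{r..q * r}. t \<notin> S \<and> t \<notin> D"
    proof (rule ccontr)
      assume "\<not> ?thesis"
      then have sub: "t \<in> S \<or> t \<in> D" if "t \<in> {r..q * r}" for t using that by blast
      have rq: "r \<le> q * r" using \<open>q \<ge> 1\<close> r by simp
      have "(\<integral>\<^sup>+ x. ennreal (1 / x) * indicator {r..q * r} x \<partial>lborel) = ln (q * r) - ln r"
        using r rq by (intro nn_integral_FTC_Icc) (auto intro!: derivative_eq_intros)
      also have "ln (q * r) - ln r = V + 1" using r by (simp add: q_def ln_mult_pos)
      finally have "ennreal (V + 1) = (\<integral>\<^sup>+ x. ennreal (1 / x) * indicator {r..q * r} x \<partial>lebesgue)"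
        by (simp add: nn_integral_completion)
      also have "\<dots> \<le> (\<integral>\<^sup>+ r \<in> S. ennreal (1 / r) \<partial>lebesgue)"
      proof (rule nn_integral_mono_AE)
        have "D \<in> null_sets lebesgue"
          using D by (simp add: countable_imp_null_set_lborel null_sets_completionI)
        then have "AE x in lebesgue. x \<notin> D" by (rule AE_not_in)
        then show "AE x in lebesgue. ennreal (1 / x) * indicator {r..q * r} x \<le>
          ennreal (1 / x) * indicator S x"
          by eventually_elim (use sub in \<open>auto simp: indicator_def\<close>)
      qed
      also have "\<dots> = ennreal V" by (rule V(2))
      finally show False using V(1) by simp
    qed
  qed
qed

text \<open>At a pole \<open>w\<close> of multiplicity \<open>\<nu> w\<close>, the counting function picks up \<open>\<nu> w * ln (r / cmod w)\<close>.\<close>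

lemma pole_counting_bounds:
  fixes a :: "complex \<Rightarrow> complex" and \<nu> :: "complex \<Rightarrow> nat"
  assumes fin: "\<And>R. finite {w \<in> cball 0 R. is_pole a w}"
    and ord: "\<And>w. is_pole a w \<Longrightarrow> zorder a w = - int (\<nu> w)" and r: "r \<ge> 1"
  shows "0 \<le> pole_counting a r"
    "r \<ge> exp 1 \<Longrightarrow> real (\<Sum>w\<in>{w \<in> cball 0 (r / exp 1). is_pole a w}. \<nu> w) \<le> pole_counting a r"
proof -
  define Z where "Z = {w. is_pole a w}"
  have Zr: "{w \<in> cball 0 t. is_pole a w} = Z \<inter> cball 0 t" for t by (auto simp: Z_def)
  have finZ: "finite (Z \<inter> cball 0 t)" for t using fin[of t] unfolding Zr .
  have pc: "pole_count a t = (\<Sum>w\<in>Z \<inter> cball 0 t. real (\<nu> w))" for t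
    unfolding pole_count_def by (intro sum.cong) (auto simp: Z_def ord)
  \<comment> \<open>Poles at \<open>0\<close> are split off because \<open>pole_counting\<close>
    weights them by \<open>ln r\<close>.\<close>
  define n0 where "n0 = pole_count a 0"
  have n0: "n0 = (\<Sum>w\<in>Z \<inter> {0}. real (\<nu> w))" using pc[of 0] by (simp add: n0_def)
  define Y where "Y = Z \<inter> cball 0 r - {0}"
  have fY: "finite Y" unfolding Y_def using finZ by simp
  have wY: "0 < cmod w" "cmod w \<le> r" if "w \<in> Y" for w using that by (auto simp: Y_def)
  have trm: "((\<lambda>t.
    if cmod w \<le> t then real (\<nu> w) / t else 0) has_integral (real (\<nu> w) * ln (r / cmod w))) {0..r}"
    if "w \<in> Y" for w
  proof -
    have "((\<lambda>t. 1 / t) has_integral (ln r - ln (cmod w))) {cmod w..r}"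
    proof (rule fundamental_theorem_of_calculus)
      show "(ln has_vector_derivative 1 / x) (at x within {cmod w..r})" if "x \<in> {cmod w..r}" for x
      proof -
        have "x > 0" using that wY(1)[OF \<open>w \<in> Y\<close>] by (meson atLeastAtMost_iff less_le_trans)
        then show ?thesis unfolding has_real_derivative_iff_has_vector_derivative[symmetric]
          by (auto intro!: derivative_eq_intros)
      qed
    qed (use wY[OF that] in simp)
    from has_integral_mult_right[OF this, of "real (\<nu> w)"]
    have "((\<lambda>t. real (\<nu> w) / t) has_integral (real (\<nu> w) * ln (r / cmod w))) {cmod w..r}"
      using wY[OF that] r by (simp add: ln_div)
    then have "((\<lambda>t. if t \<in> {cmod w..r} then real (\<nu> w) / t else 0) has_integral
        (real (\<nu> w) * ln (r / cmod w))) {0..r}"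
      using wY[OF that] by (subst has_integral_restrict) auto
    then show ?thesis by (rule has_integral_eq[rotated]) auto
  qed
  have "((\<lambda>t. \<Sum>w\<in>Y. if cmod w \<le> t then real (\<nu> w) / t else 0) has_integral
      (\<Sum>w\<in>Y. real (\<nu> w) * ln (r / cmod w))) {0..r}"
    by (intro has_integral_sum fY trm)
  then have "((\<lambda>t. (pole_count a t - n0) / t) has_integral (\<Sum>w\<in>Y. real (\<nu> w) * ln (r / cmod w))) {0..r}"
  proof (rule has_integral_eq[rotated])
    fix t assume t: "t \<in> {0..r}"
    have "pole_count a t = n0 + (\<Sum>w\<in>Z \<inter> cball 0 t - {0}. real (\<nu> w))"
    proof -
      have "(\<Sum>w\<in>Z \<inter> cball 0 t. real (\<nu> w)) =
          (\<Sum>w\<in>Z \<inter> cball 0 t \<inter> {0}. real (\<nu> w)) + (\<Sum>w\<in>Z \<inter> cball 0 t - {0}. real (\<nu> w))"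
        using sum.Int_Diff[OF finZ, of "\<lambda>w. real (\<nu> w)" t "{0}"] .
      moreover have "Z \<inter> cball 0 t \<inter> {0} = Z \<inter> {0}" using t by auto
      ultimately show ?thesis using pc n0 by simp
    qed
    moreover have "Z \<inter> cball 0 t - {0} = {w \<in> Y. cmod w \<le> t}" using t by (auto simp: Y_def)
    ultimately have "(pole_count a t - n0) / t = (\<Sum>w\<in>{w \<in> Y. cmod w \<le> t}. real (\<nu> w) / t)"
      by (simp add: sum_divide_distrib)
    also have "\<dots> = (\<Sum>w\<in>Y. if cmod w \<le> t then real (\<nu> w) / t else 0)"
      by (rule sum.inter_filter[OF fY])
    finally show "(\<Sum>w\<in>Y. if cmod w \<le> t then real (\<nu> w) / t else 0) = (pole_count a t - n0) / t" ..
  qed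
  then have N: "pole_counting a r = (\<Sum>w\<in>Y. real (\<nu> w) * ln (r / cmod w)) + n0 * ln r"
    by (simp add: pole_counting_def n0_def[symmetric] integral_unique)
  have n00: "n0 \<ge> 0" unfolding n0 by (intro sum_nonneg) auto
  have nn: "0 \<le> real (\<nu> w) * ln (r / cmod w)" if "w \<in> Y" for w
    using wY[OF that] by (intro mult_nonneg_nonneg ln_ge_zero) (auto simp: field_simps)
  show "0 \<le> pole_counting a r"
    unfolding N using n00 r sum_nonneg[of Y, OF nn] by simp
  assume re: "r \<ge> exp 1"
  then have re1: "r / exp 1 \<ge> 1" "r / exp 1 \<le> r" using r by (auto simp: field_simps)
  define Y' where "Y' = Z \<inter> cball 0 (r / exp 1) - {0}"
  have sub: "Y' \<subseteq> Y" using re1 by (auto simp: Y_def Y'_def)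
  have "real (\<Sum>w\<in>Z \<inter> cball 0 (r / exp 1). \<nu> w) = n0 + (\<Sum>w\<in>Y'. real (\<nu> w))"
  proof -
    have "0 \<le> r / exp 1" using r by simp
    then have "Z \<inter> cball 0 (r / exp 1) \<inter> {0} = Z \<inter> {0}" by auto
    then show ?thesis
      using sum.Int_Diff[OF finZ, of "\<lambda>w. real (\<nu> w)" "r / exp 1" "{0}"] n0 by (simp add: Y'_def)
  qed
  also have "\<dots> \<le> n0 * ln r + (\<Sum>w\<in>Y'. real (\<nu> w) * ln (r / cmod w))"
  proof (intro add_mono sum_mono)
    \<comment> \<open>A pole with \<open>0 < cmod w \<le> r / exp 1\<close> has weight
      \<open>ln (r / cmod w) \<ge> 1\<close>, and \<open>r \<ge> exp 1\<close> gives the same for a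
      pole at \<open>0\<close>.\<close>
    have l1: "1 \<le> ln x" if "exp 1 \<le> x" for x :: real
      using that by (subst ln_ge_iff) (auto intro: less_le_trans[OF exp_gt_zero])
    show "n0 \<le> n0 * ln r" using mult_left_mono[OF l1[OF re] n00] by simp
    fix w assume w: "w \<in> Y'"
    then have "0 < cmod w" "cmod w \<le> r / exp 1" by (auto simp: Y'_def)
    then have "exp 1 \<le> r / cmod w" by (simp add: field_simps)
    then show "real (\<nu> w) \<le> real (\<nu> w) * ln (r / cmod w)"
      using mult_left_mono[OF l1, of "r / cmod w" "real (\<nu> w)"] by simp
  qed
  also have "(\<Sum>w\<in>Y'. real (\<nu> w) * ln (r / cmod w)) \<le> (\<Sum>w\<in>Y. real (\<nu> w) * ln (r / cmod w))"
    by (intro sum_mono2 fY sub) (use nn in auto)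
  finally show "real (\<Sum>w\<in>{w \<in> cball 0 (r / exp 1). is_pole a w}. \<nu> w) \<le> pole_counting a r"
    unfolding N Zr by simp
qed

lemma egrowth_of_finite_order:
  assumes f: "f holomorphic_on UNIV" and ord: "growth_order f < \<infinity>"
  obtains N r0 where "r0 \<ge> 1" "\<And>r. r \<ge> r0 \<Longrightarrow> nevanlinna_char f r = proximity f r \<and> proximity f r \<le>
    r ^ N"
    "egrowth f (2 * N)"
proof -
  have np: "\<not> is_pole f z" for z
    using f analytic_at_imp_no_pole holomorphic_on_imp_analytic_at open_UNIV by blast
  have T: "nevanlinna_char f r = proximity f r" for r
    by (simp add: nevanlinna_char_def pole_counting_def pole_count_def np)
  obtain b :: real where b: "growth_order f < ereal b"
    using ord less_PInf_Ex_of_nat by auto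
  then have "\<forall>\<^sub>F r in at_top. ereal (ln_plus (nevanlinna_char f r) / ln r) < ereal b"
    unfolding growth_order_def by (rule Limsup_lessD)
  then obtain R where R: "\<And>r. r \<ge> R \<Longrightarrow> ln_plus (nevanlinna_char f r) / ln r < b"
    by (auto simp: eventually_at_top_linorder)
  define N where "N = nat \<lceil>b\<rceil>"
  have pr: "proximity f r \<le> r ^ N" if r: "r \<ge> max R 2" for r
  proof (cases "proximity f r \<le> 0")
    case True
    then show ?thesis using r by (meson max.boundedE order_trans zero_le_numeral zero_le_power)
  next
    case False
    have l: "ln r > 0" using r by simp
    have "ln (proximity f r) \<le> ln_plus (proximity f r)" by (rule ln_le_ln_plus)
    also have "\<dots> \<le> b * ln r" using R[of r] r l by (simp add: T field_simps)
    also have "\<dots> \<le> real N * ln r" using l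
      by (intro mult_right_mono) (auto simp: N_def real_nat_ceiling_ge)
    also have "\<dots> = ln (r ^ N)" using r by (simp add: ln_realpow)
    finally show ?thesis using False r by simp
  qed
  show ?thesis
  proof (rule that)
    show "max R 2 \<ge> 1" by simp
    show "egrowth f (2 * N)" by (rule egrowth_of_proximity[OF f pr])
  qed (use pr T in auto)
qed


section \<open>Poles along a chain\<close>

text \<open>The analogue of \<open>fwd_diff\<close> along a chain. It also applies to leading
  Laurent coefficients, which are not values of one function.\<close>

definition dseq :: "(nat \<Rightarrow> complex) \<Rightarrow> nat \<Rightarrow> complex" where
  "dseq x = (\<lambda>j. x (Suc j) - x j)"

lemma dseq_pow_Suc: "(dseq ^^ Suc k) x j = (dseq ^^ k) x (Suc j) - (dseq ^^ k) x j"
  by (simp add: dseq_def)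

lemma dseq_explicit: "(dseq ^^ m) x j = (\<Sum>k\<le>m. (-1) ^ (m - k) * of_nat (m choose k) * x (j + k))"
proof (induction m arbitrary: j)
  case (Suc m)
  let ?t = "\<lambda>m k. (-1) ^ (m - k) * of_nat (m choose k) :: complex"
  have "(\<Sum>k\<le>Suc m. ?t (Suc m) k * x (j + k)) =
      ?t (Suc m) 0 * x j + (\<Sum>k\<le>m. ?t (Suc m) (Suc k) * x (j + Suc k))"
    by (subst sum.atMost_Suc_shift) simp
  also have "(\<Sum>k\<le>m. ?t (Suc m) (Suc k) * x (j + Suc k)) =
      (\<Sum>k\<le>m. ?t m k * x (Suc j + k)) + (\<Sum>k\<le>m. (-1) ^ (m - k) * of_nat (m choose Suc k) * x (j + Suc k))"
    by (simp add: algebra_simps sum.distrib)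
  also have "(\<Sum>k\<le>m. (-1) ^ (m - k) * of_nat (m choose Suc k) * x (j + Suc k)) =
      (\<Sum>k<m. - ?t m (Suc k) * x (j + Suc k))"
  proof -
    have "(\<Sum>k\<le>m. (-1) ^ (m - k) * of_nat (m choose Suc k) * x (j + Suc k)) =
        (\<Sum>k<m. (-1) ^ (m - k) * of_nat (m choose Suc k) * x (j + Suc k))"
      by (simp add: lessThan_Suc_atMost[symmetric])
    also have "\<dots> = (\<Sum>k<m. - ?t m (Suc k) * x (j + Suc k))"
    proof (rule sum.cong)
      fix k assume "k \<in> {..<m}"
      then have "m - k = Suc (m - Suc k)" by auto
      then show "(-1) ^ (m - k) * of_nat (m choose Suc k) * x (j + Suc k) =
        - ?t m (Suc k) * x (j + Suc k)"
        by simp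
    qed simp
    finally show ?thesis .
  qed
  also have "?t (Suc m) 0 * x j + ((\<Sum>k\<le>m. ?t m k * x (Suc j + k)) + (\<Sum>k<m. - ?t m (Suc k) * x (j + Suc k))) =
      (\<Sum>k\<le>m. ?t m k * x (Suc j + k)) - (\<Sum>k\<le>m. ?t m k * x (j + k))"
  proof -
    have "(\<Sum>k\<le>m. ?t m k * x (j + k)) = ?t m 0 * x j + (\<Sum>k<m. ?t m (Suc k) * x (j + Suc k))"
      by (subst sum.atMost_shift) simp
    then show ?thesis by (simp add: sum_negf)
  qed
  finally show ?case unfolding dseq_pow_Suc Suc ..
qed simp

lemma fwd_diff_pow_Suc: "(fwd_diff c ^^ Suc k) F z =
  (fwd_diff c ^^ k) F (z + c) - (fwd_diff c ^^ k) F z"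
  by (simp add: fwd_diff_def)

lemma dseq_fwd_diff: "(dseq ^^ m) (\<lambda>j. F (z + of_nat j * c)) j =
  (fwd_diff c ^^ m) F (z + of_nat j * c)"
proof (induction m arbitrary: j)
  case (Suc m)
  have eq: "z + of_nat (Suc j) * c = z + of_nat j * c + c" by (simp add: algebra_simps)
  show ?case unfolding dseq_pow_Suc Suc fwd_diff_pow_Suc eq ..
qed simp

lemma fwd_diff_explicit:
  "(fwd_diff c ^^ m) F z = (\<Sum>k\<le>m. (-1) ^ (m - k) * of_nat (m choose k) * F (z + of_nat k * c))"
  using dseq_fwd_diff[of m F z c 0] dseq_explicit[of m "\<lambda>j. F (z + of_nat j * c)" 0] by simp

lemma newton_forward: "x (i + j) = (\<Sum>k\<le>j. of_nat (j choose k) * (dseq ^^ k) x i)"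
proof (induction j arbitrary: i)
  case (Suc j)
  let ?d = "\<lambda>k. (dseq ^^ k) x i"
  have "x (i + Suc j) = (\<Sum>k\<le>j. of_nat (j choose k) * (dseq ^^ k) x (Suc i))"
    using Suc[of "Suc i"] by simp
  also have "\<dots> = (\<Sum>k\<le>j. of_nat (j choose k) * (?d (Suc k) + ?d k))"
    unfolding dseq_pow_Suc by simp
  also have "\<dots> = (\<Sum>k\<le>j. of_nat (j choose k) * ?d (Suc k)) + (\<Sum>k\<le>j. of_nat (j choose k) * ?d k)"
    by (simp add: distrib_left sum.distrib)
  also have "(\<Sum>k\<le>j. of_nat (j choose k) * ?d k) =
    ?d 0 + (\<Sum>k\<le>j. of_nat (j choose Suc k) * ?d (Suc k))"
  proof -
    have "(\<Sum>k\<le>j. of_nat (j choose k) * ?d k) = (\<Sum>k\<le>Suc j. of_nat (j choose k) * ?d k)" by simp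
    also have "\<dots> = ?d 0 + (\<Sum>k\<le>j. of_nat (j choose Suc k) * ?d (Suc k))"
      by (subst sum.atMost_Suc_shift) simp
    finally show ?thesis .
  qed
  also have "(\<Sum>k\<le>j. of_nat (j choose k) * ?d (Suc k)) +
      (?d 0 + (\<Sum>k\<le>j. of_nat (j choose Suc k) * ?d (Suc k))) =
        (\<Sum>k\<le>Suc j. of_nat (Suc j choose k) * ?d k)"
    unfolding sum.atMost_Suc_shift[of _ j] by (simp add: algebra_simps sum.distrib)
  finally show ?case .
qed simp

text \<open>By Newton's forward formula the sequence agrees on the window \<open>{..I}\<close> with
  a polynomial of degree below \<open>m\<close>, nonzero because of \<open>x i\<close>, so the
  indices in \<open>K\<close> are among fewer than \<open>m\<close> roots.\<close>

lemma sequence_zeros: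
  assumes rec: "\<And>j. j + m \<le> I \<Longrightarrow> (dseq ^^ m) x j = 0"
    and nz: "i \<le> I" "x i \<noteq> 0" and K: "K \<subseteq> {..I}" "\<And>j. j \<in> K \<Longrightarrow> x j = 0" and m: "m \<ge> 1"
  shows "card K < m"
proof -
  have higher: "(dseq ^^ (m + l)) x j = 0" if "j + m + l \<le> I" for j l
    using that
  proof (induction l arbitrary: j)
    case (Suc l)
    then show ?case using dseq_pow_Suc[of "m + l" x j] by simp
  qed (use rec in simp)
  \<comment> \<open>The falling factorial divided by \<open>fact k\<close>, that is,
    \<open>of_nat (j choose k)\<close> as a polynomial in \<open>j\<close>.\<close>
  define b where "b = (\<lambda>k. smult (1 / fact k) (\<Prod>i = 0..<k. [:- of_nat i, 1:]) :: complex poly)"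
  have b: "poly (b k) (of_nat j) = of_nat (j choose k)" for k j
    by (simp add: b_def poly_prod binomial_gbinomial gbinomial_prod_rev add.commute)
  have degb: "degree (b k) \<le> k" for k
  proof -
    have "degree (\<Prod>i = 0..<k. [:- of_nat i, 1:] :: complex poly) \<le> k"
      by (rule order_trans[OF degree_prod_sum_le]) auto
    then show ?thesis unfolding b_def by (meson degree_smult_le order_trans)
  qed
  define p where "p = (\<Sum>k<m. smult ((dseq ^^ k) x 0) (b k))"
  have degp: "degree p < m"
  proof -
    have "degree p \<le> m - 1" unfolding p_def
    proof (intro degree_sum_le)
      fix k assume "k \<in> {..<m}"
      then have "k \<le> m - 1" by auto
      then show "degree (smult ((dseq ^^ k) x 0) (b k)) \<le> m - 1"
        using degb[of k] degree_smult_le[of "(dseq ^^ k) x 0" "b k"] by linarith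
    qed simp
    then show ?thesis using m by simp
  qed
  have xp: "x j = poly p (of_nat j)" if j: "j \<le> I" for j
  proof -
    have "x j = (\<Sum>k\<le>j. of_nat (j choose k) * (dseq ^^ k) x 0)" using newton_forward[of x 0 j]
      by simp
    also have "\<dots> = (\<Sum>k\<in>{..<m} \<inter> {..j}. of_nat (j choose k) * (dseq ^^ k) x 0)"
    proof (rule sum.mono_neutral_right)
      show "\<forall>k\<in>{..j} - {..<m} \<inter> {..j}. of_nat (j choose k) * (dseq ^^ k) x 0 = 0"
      proof
        fix k assume "k \<in> {..j} - {..<m} \<inter> {..j}"
        then have "m \<le> k" "k \<le> I" using j by auto
        then show "of_nat (j choose k) * (dseq ^^ k) x 0 = 0" using higher[of 0 "k - m"] by simp
      qed
    qed auto
    also have "\<dots> = (\<Sum>k<m. of_nat (j choose k) * (dseq ^^ k) x 0)"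
      by (rule sum.mono_neutral_left) (auto simp: binomial_eq_0)
    also have "\<dots> = poly p (of_nat j)" by (simp add: p_def poly_sum b mult.commute)
    finally show ?thesis .
  qed
  have p0: "p \<noteq> 0" using xp[OF nz(1)] nz(2) by auto
  have "poly p (of_nat j) = 0" if "j \<in> K" for j using xp[of j] K that by auto
  then have "of_nat ` K \<subseteq> {z. poly p z = 0}" by auto
  then have "card (of_nat ` K :: complex set) \<le> card {z. poly p z = 0}"
    by (rule card_mono[OF poly_roots_finite[OF p0]])
  also have "\<dots> \<le> degree p" by (rule card_poly_roots_bound[OF p0])
  finally show ?thesis using degp by (simp add: card_image inj_on_def)
qed

lemma dseq_tendsto:
  assumes "\<And>j. j \<le> I \<Longrightarrow> ((\<lambda>t. y t j) \<longlongrightarrow> x j) L" "j + k \<le> I"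
  shows "((\<lambda>t. (dseq ^^ k) (y t) j) \<longlongrightarrow> (dseq ^^ k) x j) L"
  using assms(2)
proof (induction k arbitrary: j)
  case (Suc k)
  then show ?case unfolding dseq_pow_Suc by (intro tendsto_diff) auto
qed (use assms(1) in simp)

lemma dseq_scale: "(dseq ^^ k) (\<lambda>i. a * x i) j = a * (dseq ^^ k) x j"
proof (induction k arbitrary: j)
  case (Suc k)
  show ?case unfolding dseq_pow_Suc Suc by (simp add: algebra_simps)
qed simp

text \<open>Multiplied by \<open>\<zeta> ^ V\<close>, where \<open>V\<close> is the largest
  multiplicity in the window, \<open>f - u / E\<close> has a limit at every chain point: its leading
  Laurent coefficient where the multiplicity is \<open>V\<close>, and \<open>0\<close> elsewhere.
  The difference equation survives the limit, so \<open>sequence_zeros\<close> applies to these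
  limits.\<close>

lemma multiplicity_chain:
  assumes E: "E holomorphic_on UNIV" "\<exists>z. E z \<noteq> 0" and u: "u holomorphic_on UNIV"
    and f: "f holomorphic_on UNIV"
    and E_u: "\<And>z. E z = 0 \<Longrightarrow> u z \<noteq> 0" and m: "m \<ge> 1"
    and rec: "\<And>z. (\<And>k. k \<le> m \<Longrightarrow> E (z + of_nat k * c) \<noteq> 0) \<Longrightarrow>
        (fwd_diff c ^^ m) (\<lambda>z. f z - u z / E z) z = 0"
    and K: "finite K" "\<And>j. j \<in> K \<Longrightarrow> zmult E (w + of_nat j * c) \<le> q" "zmult E (w + of_nat i * c) > q"
  shows "card K < m"
proof -
  let ?p = "\<lambda>j. w + of_nat j * c"
  obtain I where I: "i \<le> I" "K \<subseteq> {..I}"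
  proof -
    obtain B where "\<forall>x\<in>insert i K. x \<le> B"
      using K(1) finite_nat_set_iff_bounded_le[of "insert i K"] by auto
    then show ?thesis using that[of B] by auto
  qed
  define V where "V = Max ((\<lambda>j. zmult E (?p j)) ` {..I})"
  have Vge: "zmult E (?p j) \<le> V" if "j \<le> I" for j unfolding V_def using that by (intro Max_ge) auto
  have "V \<in> (\<lambda>j. zmult E (?p j)) ` {..I}" unfolding V_def by (intro Max_in) auto
  then obtain j0 where j0: "j0 \<le> I" "zmult E (?p j0) = V" by auto
  have Vq: "V > q" using Vge[OF I(1)] K(3) by simp
  have "\<exists>g. g holomorphic_on UNIV \<and> g (?p j) \<noteq> 0 \<and> (\<forall>z. E z = (z - ?p j) ^ zmult E (?p j) * g z)"
    for j
    using zdvd_zmult[OF E, of "?p j"] by metis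
  then obtain g where g: "\<And>j. g j holomorphic_on UNIV" "\<And>j. g j (?p j) \<noteq> 0"
    "\<And>j z. E z = (z - ?p j) ^ zmult E (?p j) * g j z"
    by metis
  define x where "x = (\<lambda>j. if zmult E (?p j) = V then - u (?p j) / g j (?p j) else 0)"
  define y where "y = (\<lambda>\<zeta> j. \<zeta> ^ V * (f (?p j + \<zeta>) - u (?p j + \<zeta>) / E (?p j + \<zeta>)))"
  have cont: "isCont F z" if "F holomorphic_on UNIV" for F :: "complex \<Rightarrow> complex" and z
    using that by (meson UNIV_I continuous_on_eq_continuous_at holomorphic_on_imp_continuous_on open_UNIV)
  have sh: "((\<lambda>\<zeta>. F (z + \<zeta>)) \<longlongrightarrow> F z) (at 0)" if "F holomorphic_on UNIV"
    for F :: "complex \<Rightarrow> complex" and z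
    using cont[OF that, of z] by (simp add: isCont_def LIM_offset_zero_iff)
  have lim: "((\<lambda>\<zeta>. y \<zeta> j) \<longlongrightarrow> x j) (at 0)" if j: "j \<le> I" for j
  proof -
    let ?\<nu> = "zmult E (?p j)"
    have g0: "\<forall>\<^sub>F \<zeta> in at 0. g j (?p j + \<zeta>) \<noteq> 0"
      using sh[OF g(1)] g(2) by (rule tendsto_imp_eventually_ne)
    have ne: "\<forall>\<^sub>F \<zeta> in at (0::complex). \<zeta> \<noteq> 0" by (simp add: eventually_at_filter)
    have "V > 0" using Vq by simp
    have "((\<lambda>\<zeta>. \<zeta> ^ V * f (?p j + \<zeta>) - \<zeta> ^ (V - ?\<nu>) * (u (?p j + \<zeta>) / g j (?p j + \<zeta>)))
        \<longlongrightarrow> 0 ^ V * f (?p j) - 0 ^ (V - ?\<nu>) * (u (?p j) / g j (?p j))) (at 0)"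
      by (intro tendsto_intros sh f u g)
    also have "0 ^ V * f (?p j) - 0 ^ (V - ?\<nu>) * (u (?p j) / g j (?p j)) = x j"
      using \<open>V > 0\<close> Vge[OF j] by (cases "?\<nu> = V") (simp_all add: x_def power_0_left)
    finally show ?thesis
    proof (rule Lim_transform_eventually)
      show "\<forall>\<^sub>F \<zeta> in at 0. \<zeta> ^ V * f (?p j + \<zeta>) - \<zeta> ^ (V - ?\<nu>) * (u (?p j + \<zeta>) / g j (?p j + \<zeta>)) =
        y \<zeta> j"
        using g0 ne
      proof eventually_elim
        case (elim \<zeta>)
        have "\<zeta> ^ V = \<zeta> ^ (V - ?\<nu>) * \<zeta> ^ ?\<nu>" using Vge[OF j] by (simp flip: power_add)
        moreover have "E (?p j + \<zeta>) = \<zeta> ^ ?\<nu> * g j (?p j + \<zeta>)" using g(3)[of "?p j + \<zeta>" j] by simp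
        ultimately show ?case using elim unfolding y_def by (simp add: right_diff_distrib)
      qed
    qed
  qed
  have recx: "(dseq ^^ m) x j = 0" if j: "j + m \<le> I" for j
  proof -
    have "((\<lambda>\<zeta>. (dseq ^^ m) (y \<zeta>) j) \<longlongrightarrow> (dseq ^^ m) x j) (at 0)"
      by (rule dseq_tendsto[OF lim j])
    moreover have "\<forall>\<^sub>F \<zeta> in at 0. (dseq ^^ m) (y \<zeta>) j = 0"
    proof -
      have "\<forall>\<^sub>F \<zeta> in at 0. E (?p k + \<zeta>) \<noteq> 0" for k
        using entire_eventually_nonzero[OF E, of "?p k"]
        by (simp add: at_to_0'[of "?p k"] eventually_filtermap add.commute) 
      then have "\<forall>\<^sub>F \<zeta> in at 0. \<forall>k\<in>{..I}. E (?p k + \<zeta>) \<noteq> 0" by (intro eventually_ball_finite) auto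
      then show ?thesis
      proof eventually_elim
        case (elim \<zeta>)
        have "(dseq ^^ m) (y \<zeta>) j =
          \<zeta> ^ V * (dseq ^^ m) (\<lambda>j. (\<lambda>z. f z - u z / E z) (w + \<zeta> + of_nat j * c)) j"
          unfolding y_def dseq_scale by (simp add: add_ac)
        also have "\<dots> = \<zeta> ^ V * (fwd_diff c ^^ m) (\<lambda>z. f z - u z / E z) (w + \<zeta> + of_nat j * c)"
          using dseq_fwd_diff[of m "\<lambda>z. f z - u z / E z" "w + \<zeta>" c j] by simp
        also have "(fwd_diff c ^^ m) (\<lambda>z. f z - u z / E z) (w + \<zeta> + of_nat j * c) = 0"
        proof (rule rec)
          fix k assume "k \<le> m"
          then have "j + k \<in> {..I}" using j by simp
          from bspec[OF elim this] show "E (w + \<zeta> + of_nat j * c + of_nat k * c) \<noteq> 0"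
            by (simp add: algebra_simps)
        qed
        finally show ?case by simp
      qed
    qed
    ultimately have "((\<lambda>\<zeta>. 0 :: complex) \<longlongrightarrow> (dseq ^^ m) x j) (at (0::complex))"
      by (rule Lim_transform_eventually)
    then show ?thesis using tendsto_unique[OF at_neq_bot _ tendsto_const] by metis
  qed
  show ?thesis
  proof (rule sequence_zeros[OF recx j0(1) _ I(2) _ m])
    have "E (?p j0) = 0" using zmult_pos_iff(1)[OF E, of "?p j0"] j0(2) Vq by simp
    then show "x j0 \<noteq> 0" using j0 E_u g(2) by (simp add: x_def)
    show "x j = 0" if "j \<in> K" for j using K(2)[OF that] Vq by (simp add: x_def)
  qed
qed

text \<open>All orders of the quotient are nonnegative, so nothing but removable singularities
  remains.\<close>

lemma entire_quotient:
  assumes u: "u meromorphic_on UNIV" "\<And>z. \<forall>\<^sub>F w in at z. u w \<noteq> 0"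
    and g: "g meromorphic_on UNIV" "\<And>z. \<forall>\<^sub>F w in at z. g w \<noteq> 0"
    and le: "\<And>z. zorder g z \<le> zorder u z"
  obtains E where "E holomorphic_on UNIV" "\<And>z. \<forall>\<^sub>F w in at z. E w = u w / g w \<and> E w \<noteq> 0"
    "\<And>z. zorder E z = zorder u z - zorder g z"
proof -
  define E where "E = remove_sings (\<lambda>z. u z / g z)"
  have mero: "(\<lambda>z. u z / g z) meromorphic_on UNIV" using u g by (intro meromorphic_intros)
  have mero': "u meromorphic_on {z}" "g meromorphic_on {z}" "(\<lambda>z. u z / g z) meromorphic_on {z}"
    for z
    using u g mero meromorphic_on_subset by blast+
  have ev: "\<forall>\<^sub>F w in at z. E w = u w / g w" for z
    using eventually_remove_sings_eq[OF mero] unfolding E_def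
    by (simp add: eventually_cosparse_open_eq)
  have ord0: "zorder (\<lambda>z. u z / g z) z = zorder u z - zorder g z" for z
    by (rule zorder_divide[OF mero'(1) _ mero'(2)]) (use u g in \<open>auto intro: eventually_frequently\<close>)
  have ord: "zorder E z = zorder u z - zorder g z" for z
    using zorder_cong[OF ev refl, of z] ord0 by simp
  have ne: "\<forall>\<^sub>F w in at z. E w \<noteq> 0" for z
    using ev[of z] u(2)[of z] g(2)[of z] by eventually_elim auto
  have nice: "E nicely_meromorphic_on UNIV" unfolding E_def
    by (rule remove_sings_nicely_meromorphic[OF mero])
  have "E meromorphic_on {z}" for z
    using nice meromorphic_on_subset unfolding nicely_meromorphic_on_def by blast
  then have "isolated_singularity_at E z" for z by (simp add: meromorphic_at_iff)
  then have "\<not> is_pole E z" for z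
    using isolated_pole_imp_neg_zorder[of E z] ord[of z] le[of z] by auto
  then have "E analytic_on {z}" for z using nicely_meromorphic_on_imp_analytic_at[OF nice] by blast
  then have "E holomorphic_on UNIV" using analytic_imp_holomorphic analytic_on_analytic_at by blast
  then show ?thesis using that[of E] ev ne ord eventually_conj by blast
qed


section \<open>Identities up to sparse sets\<close>

lemma cosparse_shift:
  fixes h :: complex
  assumes "\<forall>\<^sub>\<approx>z. P z" shows "\<forall>\<^sub>\<approx>z. P (z + h)"
proof -
  have "eventually P (at (x + h))" for x
    using assms by (simp add: eventually_cosparse_open_eq)
  moreover have "eventually (\<lambda>z. P (z + h)) (at x) \<longleftrightarrow> eventually P (at (x + h))" for x
  proof -
    have eq: "filtermap (\<lambda>x. x - h) (at (x + h)) = at x" using filtermap_at_shift[of h "x + h"]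
      by simp
    show ?thesis unfolding eq[symmetric] eventually_filtermap by simp
  qed
  ultimately show ?thesis by (simp add: eventually_cosparse_open_eq)
qed

lemma fwd_diff_zero_mono:
  assumes "\<forall>\<^sub>\<approx>z. (fwd_diff c ^^ m) a z = 0" shows "\<forall>\<^sub>\<approx>z. (fwd_diff c ^^ (m + j)) a z = 0"
proof (induction j)
  case (Suc j)
  from Suc cosparse_shift[OF Suc, of c] show ?case
    unfolding add_Suc_right fwd_diff_pow_Suc by eventually_elim simp
qed (use assms in simp)

lemma egrowth_fwd_diff: "egrowth f N \<Longrightarrow> egrowth ((fwd_diff c ^^ k) f) N"
  by (induction k) (auto simp: fwd_diff_def intro!: egrowth_diff egrowth_shift)

lemma entire_isCont: "F holomorphic_on UNIV \<Longrightarrow> isCont F z"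
  by (meson UNIV_I continuous_on_eq_continuous_at holomorphic_on_imp_continuous_on open_UNIV)

lemma isCont_shift: "isCont F (z + h) \<Longrightarrow> isCont (\<lambda>z. F (z + h)) (z :: complex)"
  by (intro isCont_o2[of z "\<lambda>z. z + h" F] continuous_intros) auto

lemma isCont_eventually_const:
  fixes A :: "complex \<Rightarrow> complex"
  assumes "isCont A z" "\<forall>\<^sub>F y in at z. A y = b" shows "A z = b"
proof -
  have "(A \<longlongrightarrow> A z) (at z)" using assms(1) by (simp add: isCont_def)
  then have "((\<lambda>_. b) \<longlongrightarrow> A z) (at z)" using assms(2) by (rule Lim_transform_eventually)
  then show ?thesis by (simp add: tendsto_const_iff)
qed

text \<open>The values of \<open>a\<close> on a sparse set are arbitrary, but
  \<open>f - u / E\<close> is continuous off the zeros of \<open>E\<close>. The generic identity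
  therefore holds for it at every admissible point.\<close>

lemma fwd_diff_zero_everywhere:
  assumes E: "E holomorphic_on UNIV" and u: "u holomorphic_on UNIV" and f: "f holomorphic_on UNIV"
    and a: "\<forall>\<^sub>\<approx>z. a z = f z - u z / E z" and zero: "\<forall>\<^sub>\<approx>z. (fwd_diff c ^^ N) a z = 0"
    and nz: "\<And>k. k \<le> N \<Longrightarrow> E (z + of_nat k * c) \<noteq> 0"
  shows "(fwd_diff c ^^ N) (\<lambda>z. f z - u z / E z) z = 0"
proof -
  define h where "h = (\<lambda>z. f z - u z / E z)"
  have ex: "(fwd_diff c ^^ N) h =
    (\<lambda>z. \<Sum>k\<le>N. (-1) ^ (N - k) * of_nat (N choose k) * h (z + of_nat k * c))"
    by (rule ext) (rule fwd_diff_explicit)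
  have hc: "isCont h y" if "E y \<noteq> 0" for y
    unfolding h_def using that by (intro continuous_intros entire_isCont f u E)
  have A: "isCont ((fwd_diff c ^^ N) h) z"
    unfolding ex
  proof (intro continuous_intros)
    fix k assume "k \<in> {..N}"
    then show "isCont (\<lambda>z. h (z + of_nat k * c)) z" using nz by (intro isCont_shift hc) simp
  qed
  have "\<forall>\<^sub>\<approx>z. \<forall>k\<in>{..N}. a (z + of_nat k * c) = h (z + of_nat k * c)"
    unfolding h_def using cosparse_shift[OF a] by (intro eventually_ball_finite) auto
  then have "\<forall>\<^sub>\<approx>z. (fwd_diff c ^^ N) h z = 0"
    using zero
  proof eventually_elim
    case (elim y)
    then show ?case unfolding fwd_diff_explicit by simp
  qed
  then have "\<forall>\<^sub>F y in at z. (fwd_diff c ^^ N) h y = 0" by (simp add: eventually_cosparse_open_eq)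
  from isCont_eventually_const[OF A this] show ?thesis unfolding h_def .
qed

lemma ln_plus_diff: "ln_plus (cmod (x - y)) \<le> ln_plus (cmod x) + ln_plus (cmod y) + ln 2"
proof -
  let ?X = "max 1 (cmod x)" and ?Y = "max 1 (cmod y)"
  have "cmod (x - y) \<le> ?X + ?Y" using norm_triangle_ineq4[of x y] by linarith
  moreover have "?X \<le> ?X * ?Y" "?Y \<le> ?X * ?Y" "1 \<le> ?X * ?Y"
    using mult_left_mono[of 1 ?Y ?X] mult_right_mono[of 1 ?X ?Y] by auto
  ultimately have "max 1 (cmod (x - y)) \<le> ?X * ?Y * 2" by linarith
  then have "ln (max 1 (cmod (x - y))) \<le> ln (?X * ?Y * 2)" by (subst ln_le_cancel_iff) auto
  also have "\<dots> = ln ?X + ln ?Y + ln 2" by (simp add: ln_mult_pos)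
  finally show ?thesis by (simp add: ln_plus_eq)
qed

lemma proximity_diff:
  assumes "continuous_on {0..2 * pi} (\<lambda>\<theta>. f (of_real t * cis \<theta>))"
    "continuous_on {0..2 * pi} (\<lambda>\<theta>. a (of_real t * cis \<theta>))"
  shows "proximity (\<lambda>z. f z - a z) t \<le> proximity f t + proximity a t + ln 2"
proof -
  let ?i = "\<lambda>F. \<lambda>\<theta>. ln_plus (cmod (F (of_real t * cis \<theta>)))"
  have int: "?i f integrable_on {0..2 * pi}" "?i a integrable_on {0..2 * pi}"
    "?i (\<lambda>z. f z - a z) integrable_on {0..2 * pi}"
    by (intro integrable_continuous_real continuous_on_ln_plus continuous_intros assms)+
  have "((\<lambda>\<theta>. ln 2 :: real) has_integral (2 * pi * ln 2)) {0..2 * pi}"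
    using has_integral_const_real[of "ln 2 :: real" 0 "2 * pi"] by simp
  then have "((\<lambda>\<theta>. ?i f \<theta> + ?i a \<theta> + ln 2) has_integral
      (integral {0..2 * pi} (?i f) + integral {0..2 * pi} (?i a) + 2 * pi * ln 2)) {0..2 * pi}"
    by (intro has_integral_add integrable_integral int)
  then have "integral {0..2 * pi} (?i (\<lambda>z. f z - a z)) \<le>
      integral {0..2 * pi} (?i f) + integral {0..2 * pi} (?i a) + 2 * pi * ln 2"
    by (rule has_integral_le[OF integrable_integral[OF int(3)]]) (rule ln_plus_diff)
  then show ?thesis by (simp add: proximity_def field_simps)
qed

lemma zero_mult_entire:
  assumes F: "F holomorphic_on UNIV" "\<exists>z. F z \<noteq> 0"
  shows "zero_mult F z = enat (zmult F z)"
proof -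
  have ne: "\<forall>\<^sub>F w in at z. F w \<noteq> 0" by (rule entire_eventually_nonzero[OF F])
  then have "\<not> (\<forall>\<^sub>F w in at z. F w = 0)" using eventually_frequently[OF at_neq_bot ne]
    by (simp add: frequently_def)
  moreover have "F analytic_on {z}" using F(1) holomorphic_on_imp_analytic_at by blast
  then have "isolated_zero F z \<longleftrightarrow> F z = 0" using ne by (simp add: isolated_zero_analytic_iff)
  moreover have "zmult F z = 0" if "F z \<noteq> 0" using zmult_pos_iff(1)[OF F, of z] that by simp
  ultimately show ?thesis by (simp add: zero_mult_def zero_enat_def)
qed


section \<open>The quotient of \<open>u\<close> and \<open>f - a\<close>\<close>

text \<open>Smallness bounds the proximity and the poles of \<open>a\<close> only off an exceptional
  set. Two radii are chosen outside it: \<open>t\<close> for the circle, and a larger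
  \<open>s\<close> because \<open>pole_counting_bounds\<close> at \<open>s\<close> counts the poles
  up to \<open>s / exp 1\<close>.\<close>

lemma quotient_growth:
  assumes f: "f holomorphic_on UNIV" "growth_order f < \<infinity>"
    and E: "E holomorphic_on UNIV" "\<exists>z. E z \<noteq> 0" and u: "egrowth u N" "\<exists>z. u z \<noteq> 0"
    and small: "a \<in> small_functions f" and a: "\<forall>\<^sub>\<approx>z. a z = f z - u z / E z"
    and pole: "\<And>z. is_pole a z \<longleftrightarrow> E z = 0" "\<And>z. is_pole a z \<Longrightarrow> zorder a z = - int (zmult E z)"
  shows "\<exists>N. egrowth E N"
proof -
  have u': "u holomorphic_on UNIV" using egrowth_hol[OF u(1)] .
  obtain M r0 where M: "r0 \<ge> 1" "\<And>r. r \<ge> r0 \<Longrightarrow> nevanlinna_char f r = proximity f r \<and>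
    proximity f r \<le> r ^ M"
    by (rule egrowth_of_finite_order[OF f]) (rule that, assumption+)
  obtain S where S: "finite_log_measure S"
    "nevanlinna_char a \<in> o[inf at_top (principal (- S))](nevanlinna_char f)"
    using small by (auto simp: small_functions_def)
  have "\<forall>\<^sub>F r in inf at_top (principal (- S)). norm (nevanlinna_char a r) \<le>
    1 * norm (nevanlinna_char f r)"
    using landau_o.smallD[OF S(2) zero_less_one] .
  then obtain R1 where R1: "\<And>r. r \<ge> R1 \<Longrightarrow> r \<notin> S \<Longrightarrow> \<bar>nevanlinna_char a r\<bar> \<le> \<bar>nevanlinna_char f r\<bar>"
    by (auto simp: eventually_inf_principal eventually_at_top_linorder)
  obtain q where q: "q \<ge> 1" "\<And>r D. r \<ge> 1 \<Longrightarrow> countable D \<Longrightarrow> \<exists>t\<in>{r..q * r}. t \<notin> S \<and> t \<notin> D"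
    using radius_outside[OF S(1)] by metis
  have finp: "finite {w \<in> cball 0 R. is_pole a w}" for R
    unfolding pole(1) by (rule finite_zeros_cball[OF E])
  have Ta: "proximity a r \<le> r ^ M" "pole_counting a r \<le> r ^ M"
    if r: "r \<ge> max r0 R1" "r \<notin> S" for r
  proof -
    have r1: "r \<ge> 1" using r M by simp
    have nn: "0 \<le> pole_counting a r" by (rule pole_counting_bounds(1)[OF finp pole(2) r1])
    have "\<bar>nevanlinna_char a r\<bar> \<le> \<bar>nevanlinna_char f r\<bar>" using R1 r by simp
    also have "\<dots> \<le> r ^ M" using M(2)[of r] r proximity_nonneg[of f r] by simp
    finally have "proximity a r + pole_counting a r \<le> r ^ M" by (simp add: nevanlinna_char_def)
    then show "proximity a r \<le> r ^ M" "pole_counting a r \<le> r ^ M"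
      using nn proximity_nonneg[of a r] by linarith+
  qed
  \<comment> \<open>Avoiding the moduli of these countably many points makes \<open>a\<close>
    continuous on the circle and keeps \<open>E\<close> and \<open>u\<close> from vanishing
    there.\<close>
  define bad where "bad = {z. \<not> (a z = f z - u z / E z)} \<union> {z. E z = 0} \<union> {z. u z = 0}"
  have "{z. \<not> (a z = f z - u z / E z)} sparse_in UNIV" using a by (simp add: eventually_cosparse)
  moreover have "{z. F z = 0} sparse_in UNIV" if "F holomorphic_on UNIV" "\<exists>z. F z \<noteq> 0" for F
  proof -
    have "\<forall>\<^sub>\<approx>z. F z \<noteq> 0" using entire_eventually_nonzero[OF that]
      by (simp add: eventually_cosparse_open_eq)
    then show ?thesis by (simp add: eventually_cosparse)
  qed
  note this[OF E] this[OF u' u(2)]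
  ultimately have "countable bad"
    unfolding bad_def using sparse_imp_countable[OF open_UNIV] by (metis countable_Un Int_UNIV_left)
  then have cbad: "countable (cmod ` bad)" by simp
  show ?thesis
  \<comment> \<open>The radii satisfy \<open>t \<le> q * r\<close> and
    \<open>s \<le> exp 1 * q\<^sup>2 * r\<close>. The factor \<open>3\<close> collects the
    proximities of \<open>f\<close> and \<open>a\<close> and \<open>ln 2\<close>.\<close>
  proof (rule egrowth_of_quotient[OF E u, of "q" "3 * (exp 1 * q\<^sup>2) ^ M" "max (max r0 R1) 1" M])
    show "1 \<le> q" by (rule q(1))
    show "0 \<le> 3 * (exp 1 * q\<^sup>2) ^ M" by simp
    fix r assume r: "r \<ge> max (max r0 R1) 1"
    then have r1: "r \<ge> 1" by simp
    obtain t where t: "t \<in> {r..q * r}" "t \<notin> S" "t \<notin> cmod ` bad" using q(2)[OF r1 cbad] by blast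
    have e1: "exp (1::real) \<ge> 1" by simp
    have qr: "r \<le> q * r" using mult_right_mono[OF q(1), of r] r1 by simp
    have eqr: "q * r \<le> exp 1 * q * r" "exp 1 \<le> exp 1 * q * r"
    proof -
      have "1 * (q * r) \<le> exp 1 * (q * r)" using e1 q(1) r1 by (intro mult_right_mono) auto
      then show "q * r \<le> exp 1 * q * r" by (simp add: mult.assoc)
      have "exp 1 * 1 \<le> exp 1 * (q * r)" by (intro mult_left_mono order_trans[OF r1 qr]) simp
      then show "exp 1 \<le> exp 1 * q * r" by (simp add: mult.assoc)
    qed
    have eqr1: "exp 1 * q * r \<ge> 1" using eqr(2) e1 by linarith
    obtain s where s: "s \<in> {exp 1 * q * r..q * (exp 1 * q * r)}" "s \<notin> S"
      using q(2)[OF eqr1 countable_empty] by blast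
    have es: "1 \<le> s" "exp 1 \<le> s" using s(1) eqr1 eqr(2) by (meson atLeastAtMost_iff order_trans)+
    have rs: "r \<le> s" by (rule order_trans[OF qr order_trans[OF eqr(1)]]) (use s(1) in simp)
    have qq: "q * r \<le> exp 1 * q\<^sup>2 * r"
    proof -
      have "q * r * 1 \<le> q * r * (exp 1 * q)"
        using mult_mono[OF e1 q(1)] q(1) r1 by (intro mult_left_mono) auto
      then show ?thesis by (simp add: power2_eq_square mult_ac)
    qed
    have good: "a z = f z - u z / E z" "E z \<noteq> 0" "u z \<noteq> 0" if "cmod z = t" for z
      using t(3) that by (auto simp: bad_def image_iff)
    have t1: "t \<ge> 1" using t r1 by auto
    show "\<exists>t\<in>{r..q * r}. (\<forall>z. cmod z = t \<longrightarrow> E z \<noteq> 0 \<and> u z \<noteq> 0) \<and>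
      proximity (\<lambda>z. u z / E z) t \<le> 3 * (exp 1 * q\<^sup>2) ^ M * r ^ M \<and>
      real (\<Sum>w\<in>{w \<in> cball 0 t. E w = 0}. zmult E w) \<le> 3 * (exp 1 * q\<^sup>2) ^ M * r ^ M"
    proof (intro bexI[OF _ t(1)] conjI allI impI)
      show "E z \<noteq> 0" "u z \<noteq> 0" if "cmod z = t" for z using good[OF that] by auto
      have onc: "cmod (of_real t * cis \<theta>) = t" for \<theta> using t1 by (simp add: norm_mult)
      have cont: "continuous_on {0..2 * pi} (\<lambda>\<theta>. F (of_real t * cis \<theta>))"
        if "F holomorphic_on UNIV" for F
        by (rule continuous_on_compose2[OF holomorphic_on_imp_continuous_on[OF that]])
          (auto intro!: continuous_intros)
      have "continuous_on {0..2 * pi} (\<lambda>\<theta>. f (of_real t * cis \<theta>) - u (of_real t * cis \<theta>) / E (of_real t * cis \<theta>))"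
        using good(2)[OF onc] by (intro continuous_intros cont f u' E) auto
      then have conta: "continuous_on {0..2 * pi} (\<lambda>\<theta>. a (of_real t * cis \<theta>))"
        using good(1)[OF onc] by simp
      have "proximity (\<lambda>z. u z / E z) t = proximity (\<lambda>z. f z - a z) t"
        by (rule proximity_cong) (use good(1) t1 in auto)
      also have "\<dots> \<le> proximity f t + proximity a t + ln 2"
        by (rule proximity_diff[OF cont[OF f(1)] conta])
      also have "\<dots> \<le> t ^ M + t ^ M + t ^ M"
      proof (intro add_mono)
        show "proximity f t \<le> t ^ M" using M(2)[of t] t(1) r by simp
        show "proximity a t \<le> t ^ M" using Ta(1)[of t] t r by simp
        have "ln (2::real) \<le> 1" using ln_le_minus_one[of 2] by simp
        then show "ln 2 \<le> t ^ M" using one_le_power[OF t1, of M] by linarith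
      qed
      also have "\<dots> = 3 * t ^ M" by simp
      also have "\<dots> \<le> 3 * (exp 1 * q\<^sup>2 * r) ^ M"
        using t t1 qq by (intro mult_left_mono power_mono) auto
      finally show "proximity (\<lambda>z. u z / E z) t \<le> 3 * (exp 1 * q\<^sup>2) ^ M * r ^ M"
        by (simp only: power_mult_distrib mult.assoc)
      have "(\<Sum>w\<in>{w \<in> cball 0 t. E w = 0}. zmult E w) \<le>
        (\<Sum>w\<in>{w \<in> cball 0 (s / exp 1). is_pole a w}. zmult E w)"
      proof (rule sum_mono2[OF finp])
        have "t * exp 1 \<le> q * r * exp 1" using t(1) by (intro mult_right_mono) auto
        also have "\<dots> = exp 1 * q * r" by simp
        also have "\<dots> \<le> s" using s(1) by simp
        finally have "t \<le> s / exp 1" by (simp only: pos_le_divide_eq exp_gt_zero)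
        then show "{w \<in> cball 0 t. E w = 0} \<subseteq> {w \<in> cball 0 (s / exp 1). is_pole a w}"
          by (auto simp: pole(1))
      qed auto
      then have "real (\<Sum>w\<in>{w \<in> cball 0 t. E w = 0}. zmult E w) \<le>
          real (\<Sum>w\<in>{w \<in> cball 0 (s / exp 1). is_pole a w}. zmult E w)" by (simp only: of_nat_le_iff)
      also have "\<dots> \<le> pole_counting a s"
        by (rule pole_counting_bounds(2)[OF finp pole(2)]) (assumption, rule es, rule es)
      also have "\<dots> \<le> s ^ M" using s(2) rs r by (intro Ta(2)) auto
      also have "\<dots> \<le> (exp 1 * q\<^sup>2 * r) ^ M"
      proof (rule power_mono)
        show "s \<le> exp 1 * q\<^sup>2 * r" using s by (simp add: power2_eq_square mult_ac)
      qed (use s eqr1 in auto)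
      also have "\<dots> \<le> 3 * (exp 1 * q\<^sup>2 * r) ^ M"
      proof -
        have "0 \<le> (exp 1 * q\<^sup>2 * r) ^ M" using r1 by simp
        then show ?thesis by linarith
      qed
      finally show "real (\<Sum>w\<in>{w \<in> cball 0 t. E w = 0}. zmult E w) \<le> 3 * (exp 1 * q\<^sup>2) ^ M * r ^ M"
        by (simp only: power_mult_distrib mult.assoc)
    qed
  qed
qed

text \<open>At a pole of \<open>f - a\<close> the shared multiplicity is \<open>0\<close>, so
  \<open>u\<close> does not vanish and \<open>u / (f - a)\<close> has a zero of the order of the
  pole. Elsewhere the orders of \<open>u\<close> and \<open>f - a\<close> agree and cancel.\<close>

lemma shared_zeros_quotient:
  assumes u: "u holomorphic_on UNIV" "\<exists>z. u z \<noteq> 0" and f: "f holomorphic_on UNIV" "\<exists>z. f z \<noteq> 0"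
    and a: "a meromorphic_on UNIV" and share: "\<And>z. zero_mult (\<lambda>z. f z - a z) z = zero_mult u z"
  obtains E where "E holomorphic_on UNIV" "\<exists>z. E z \<noteq> 0" "\<And>z. E z = 0 \<Longrightarrow> u z \<noteq> 0"
    "\<forall>\<^sub>\<approx>z. a z = f z - u z / E z"
    "\<And>z. is_pole a z \<longleftrightarrow> E z = 0" "\<And>z. is_pole a z \<Longrightarrow> zorder a z = - int (zmult E z)"
proof -
  define g where "g = (\<lambda>z. f z - a z)"
  have merf: "f meromorphic_on UNIV" "u meromorphic_on UNIV"
    using f(1) u(1) by (auto intro!: analytic_on_imp_meromorphic_on simp: analytic_on_open)
  have merg: "g meromorphic_on UNIV" unfolding g_def by (intro meromorphic_intros merf a)
  have loc: "F meromorphic_on {z}" if "F meromorphic_on UNIV" for F z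
    using that meromorphic_on_subset by blast
  have neu: "\<forall>\<^sub>F w in at z. u w \<noteq> 0" for z by (rule entire_eventually_nonzero[OF u])
  have nef: "\<forall>\<^sub>F w in at z. f w \<noteq> 0" for z by (rule entire_eventually_nonzero[OF f])
  have zu: "zero_mult g z = enat (zmult u z)" for z
    using share[of z] zero_mult_entire[OF u, of z] by (simp add: g_def)
  \<comment> \<open>If \<open>f - a\<close> vanished identically near a point, its
    \<open>zero_mult\<close> would be infinite there, while that of \<open>u\<close> is
    finite.\<close>
  have neg: "\<forall>\<^sub>F w in at z. g w \<noteq> 0" for z
  proof (rule non_zero_neighbour)
    show "isolated_singularity_at g z" "not_essential g z"
      using loc[OF merg, of z] by (auto simp: meromorphic_at_iff)
    have "\<not> (\<forall>\<^sub>F w in at z. g w = 0)"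
    proof
      assume "\<forall>\<^sub>F w in at z. g w = 0"
      then have "zero_mult g z = \<infinity>" by (simp add: zero_mult_def)
      with zu[of z] show False by simp
    qed
    then show "\<exists>\<^sub>F w in at z. g w \<noteq> 0" by (simp add: frequently_def)
  qed
  have nz: "\<not> (\<forall>\<^sub>F w in at z. g w = 0)" for z
    using eventually_frequently[OF at_neq_bot neg[of z]] by (simp add: frequently_def)
  have zg: "zmult u z = (if isolated_zero g z then zmult g z else 0)" for z
    using zu[of z] nz[of z] by (auto simp: zero_mult_def zero_enat_def split: if_splits)
  have ou: "zorder u z = int (zmult u z)" for z using zmult_pos_iff(2)[OF u, of z] by simp
  have iso: "isolated_singularity_at F z" if "F meromorphic_on UNIV" for F z
    using loc[OF that, of z] by (simp add: meromorphic_at_iff)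
  have ordg: "if is_pole g z then zorder g z < 0 \<and> zorder u z = 0 else zorder g z = zorder u z"
    for z
  proof (cases "is_pole g z")
    case True
    then have "\<not> isolated_zero g z" using pole_is_not_zero unfolding isolated_zero_def is_pole_def
      using not_tendsto_and_filterlim_at_infinity[OF at_neq_bot] by blast
    then show ?thesis using True isolated_pole_imp_neg_zorder[OF iso[OF merg] True] zg[of z] ou[of z] by simp
  next
    case F: False
    show ?thesis
    proof (cases "isolated_zero g z")
      case True
      then show ?thesis using F zorder_isolated_zero_pos'[OF True iso[OF merg]] zg[of z] ou[of z]
        by simp
    next
      case False
      have "zorder g z = 0"
        by (rule not_pole_not_isolated_zero_imp_zorder_eq_0[OF loc[OF merg] F False])
          (use neg in \<open>auto intro: eventually_frequently\<close>)
      then show ?thesis using F False zg[of z] ou[of z] by simp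
    qed
  qed
  have le: "zorder g z \<le> zorder u z" for z using ordg[of z] by (auto split: if_splits)
  obtain E where E: "E holomorphic_on UNIV" "\<And>z. \<forall>\<^sub>F w in at z. E w = u w / g w \<and> E w \<noteq> 0"
    "\<And>z. zorder E z = zorder u z - zorder g z"
    by (rule entire_quotient[OF merf(2) neu merg neg le]) (rule that, assumption+)
  have ntE: "\<exists>z. E z \<noteq> 0" using eventually_happens'[OF at_neq_bot E(2)[of 0]] by auto
  have E0: "E z = 0 \<longleftrightarrow> is_pole g z" for z
    using zmult_pos_iff[OF E(1) ntE, of z] ordg[of z] E(3)[of z] by (auto split: if_splits)
  have anf: "(f \<longlongrightarrow> f z) (at z)" for z using entire_isCont[OF f(1), of z] by (simp add: isCont_def)
  have poleg: "is_pole g z \<longleftrightarrow> is_pole a z" for z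
  proof
    assume "is_pole a z"
    then have "is_pole (\<lambda>w. - a w) z" by simp
    then have "is_pole (\<lambda>w. f w + - a w) z"
      unfolding is_pole_def by (rule tendsto_add_filterlim_at_infinity[OF anf])
    then show "is_pole g z" by (simp add: g_def)
  next
    assume "is_pole g z"
    then have "is_pole (\<lambda>w. - g w) z" by simp
    then have "is_pole (\<lambda>w. f w + - g w) z"
      unfolding is_pole_def by (rule tendsto_add_filterlim_at_infinity[OF anf])
    then show "is_pole a z" by (simp add: g_def)
  qed
  show ?thesis
  proof (rule that[OF E(1) ntE])
    show "u z \<noteq> 0" if "E z = 0" for z
      using ordg[of z] that E0 zmult_pos_iff(1)[OF u, of z] by auto
    have "\<forall>\<^sub>F w in at z. a w = f w - u w / E w" for z
      using E(2)[of z] by eventually_elim (auto simp: g_def field_simps)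
    then show "\<forall>\<^sub>\<approx>z. a z = f z - u z / E z" by (simp add: eventually_cosparse_open_eq)
    show "is_pole a z \<longleftrightarrow> E z = 0" for z using E0 poleg by simp
    fix z assume pa: "is_pole a z"
    then have pg: "is_pole g z" using poleg by simp
    have a0: "zorder a z < 0" by (rule isolated_pole_imp_neg_zorder[OF iso[OF a] pa])
    have "\<exists>\<^sub>F w in at z. a w \<noteq> 0"
      using non_zero_neighbour_pole[OF pa] by (rule eventually_frequently[OF at_neq_bot])
    then have "zorder g z = zorder a z"
      unfolding g_def using zmult_pos_iff(2)[OF f, of z] a0
      by (intro zorder_diff2 loc merf a eventually_frequently[OF at_neq_bot nef]) auto
    then show "zorder a z = - int (zmult E z)" using E(3)[of z] ordg[of z] pg a0 by simp
  qed
qed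

theorem theorem1p4:
  fixes c :: complex and n m :: nat and f a :: "complex \<Rightarrow> complex"
  assumes "1 \<le> m" and "m \<le> n"
    and "f holomorphic_on UNIV" and "\<not> f constant_on UNIV" and "growth_order f < \<infinity>"
    and "(fwd_diff c ^^ n) f \<noteq> (\<lambda>z. 0)"
    and "a \<in> small_functions f"
    and "\<forall>\<^sub>\<approx>z. (fwd_diff c ^^ m) a z = 0"
    and "share_zero_CM {\<lambda>z. f z - a z, (fwd_diff c ^^ n) f, (fwd_diff c ^^ (n + 1)) f}"
  shows "\<exists>C. C \<noteq> 0 \<and>
    (\<forall>\<^sub>\<approx>z. fwd_diff c f z = C * f z + fwd_diff c a z - C * a z)"
proof -
  note f = assms(3)
  define u where "u = (fwd_diff c ^^ n) f"
  define v where "v = (fwd_diff c ^^ (n + 1)) f"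
  obtain M where grf: "egrowth f M" by (rule egrowth_of_finite_order[OF f assms(5)]) (rule that)
  have gru: "egrowth u M" "egrowth v M" unfolding u_def v_def by (intro egrowth_fwd_diff grf)+
  note holu = egrowth_hol[OF gru(1)] and holv = egrowth_hol[OF gru(2)]
  have ntu: "\<exists>z. u z \<noteq> 0" using assms(6) unfolding u_def by auto
  have ntf: "\<exists>z. f z \<noteq> 0" using assms(4) unfolding constant_on_def by auto
  have vu: "v z = u (z + c) - u z" for z by (simp add: v_def u_def fwd_diff_def)
  have share: "zero_mult (\<lambda>z. f z - a z) z = zero_mult u z" "zero_mult v z = zero_mult u z" for z
    using assms(9) unfolding share_zero_CM_def u_def v_def by blast+
  have c0: "c \<noteq> 0"
  proof
    assume "c = 0"
    obtain k where k: "n = Suc k" using assms(1,2) by (cases n) auto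
    have "u z = 0" for z unfolding u_def k fwd_diff_pow_Suc by (simp add: \<open>c = 0\<close>)
    then show False using ntu by simp
  qed
  \<comment> \<open>This is not among the hypotheses; it follows because the zero function has
    infinite multiplicity everywhere and \<open>u\<close> does not.\<close>
  have ntv: "\<exists>z. v z \<noteq> 0"
  proof (rule ccontr)
    assume "\<nexists>z. v z \<noteq> 0"
    then have "zero_mult v 0 = \<infinity>" by (simp add: zero_mult_def)
    then show False using share(2)[of 0] zero_mult_entire[OF holu ntu, of 0] by simp
  qed
  have ordv: "zorder v z = zorder u z" for z
    using share(2)[of z] zmult_pos_iff(2)[OF holu ntu, of z] zmult_pos_iff(2)[OF holv ntv, of z]
    unfolding zero_mult_entire[OF holu ntu] zero_mult_entire[OF holv ntv] by simp
  have mer: "u meromorphic_on UNIV" "v meromorphic_on UNIV"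
    using holu holv by (auto intro!: analytic_on_imp_meromorphic_on simp: analytic_on_open)
  obtain \<beta> where \<beta>: "\<beta> holomorphic_on UNIV" "\<And>z. \<forall>\<^sub>F w in at z. \<beta> w = v w / u w \<and> \<beta> w \<noteq> 0"
    "\<And>z. zorder \<beta> z = zorder v z - zorder u z"
    by (rule entire_quotient[OF mer(2) entire_eventually_nonzero[OF holv ntv] mer(1) entire_eventually_nonzero[OF holu ntu]
      eq_refl[OF ordv[symmetric]]]) (rule that, assumption+)
  have nt\<beta>: "\<exists>z. \<beta> z \<noteq> 0" using eventually_happens'[OF at_neq_bot \<beta>(2)[of 0]] by auto
  have \<beta>0: "\<beta> z \<noteq> 0" for z using zmult_pos_iff(1)[OF \<beta>(1) nt\<beta>, of z] \<beta>(3)[of z] ordv[of z] by auto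
  have v\<beta>: "v z = \<beta> z * u z" for z
  proof -
    have "\<forall>\<^sub>F w in at z. v w - \<beta> w * u w = 0"
      using \<beta>(2)[of z] by eventually_elim (auto simp: field_simps)
    then have "v z - \<beta> z * u z = 0"
      by (rule isCont_eventually_const[rotated]) (intro continuous_intros entire_isCont holv \<beta>(1) holu)
    then show ?thesis by simp
  qed
  obtain P where P: "\<And>z. \<beta> z = exp (poly P z)"
    using entire_nonvanishing_exp_poly[OF gru(1) ntu gru(2) \<beta>(1) \<beta>0 v\<beta>] by blast
  have ush: "u (z + c) = (1 + exp (poly P z)) * u z" for z
    using vu[of z] v\<beta>[of z] P[of z] by (simp add: algebra_simps)
  have mera: "a meromorphic_on UNIV" using assms(7) by (simp add: small_functions_def)
  obtain E where E: "E holomorphic_on UNIV" "\<exists>z. E z \<noteq> 0" "\<And>z. E z = 0 \<Longrightarrow> u z \<noteq> 0"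
    "\<forall>\<^sub>\<approx>z. a z = f z - u z / E z"
    "\<And>z. is_pole a z \<longleftrightarrow> E z = 0" "\<And>z. is_pole a z \<Longrightarrow> zorder a z = - int (zmult E z)"
    by (rule shared_zeros_quotient[OF holu ntu f ntf mera share(1)]) (rule that, assumption+)
  have grE: "\<exists>N. egrowth E N"
    by (rule quotient_growth[OF f assms(5) E(1,2) gru(1) ntu assms(7) E(4,5,6)])
  have zm: "(fwd_diff c ^^ m) (\<lambda>z. f z - u z / E z) z = 0"
    if "\<And>k. k \<le> m \<Longrightarrow> E (z + of_nat k * c) \<noteq> 0" for z
    by (rule fwd_diff_zero_everywhere[OF E(1) holu f E(4) assms(8) that])
  have zn0: "\<forall>\<^sub>\<approx>z. (fwd_diff c ^^ n) a z = 0"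
    using fwd_diff_zero_mono[OF assms(8), of "n - m"] assms(2) by simp
  have uk: "u (z + of_nat k * c) = (\<Prod>j<k. 1 + exp (poly P (z + of_nat j * c))) * u z" for z k
  proof (induction k)
    case (Suc k)
    have eq: "z + of_nat (Suc k) * c = z + of_nat k * c + c" by (simp add: algebra_simps)
    show ?case unfolding eq ush Suc by (simp add: mult_ac)
  qed simp
  define T where "T = (\<lambda>z. \<Sum>k\<le>n. (-1) ^ (n - k) * of_nat (n choose k) *
      (\<Prod>j<k. 1 + exp (poly P (z + of_nat j * c))) / E (z + of_nat k * c))"
  have star0: "T z = 1" if nzE: "\<And>k. k \<le> n \<Longrightarrow> E (z + of_nat k * c) \<noteq> 0" and uz: "u z \<noteq> 0" for z
  proof -
    have "0 = (fwd_diff c ^^ n) (\<lambda>z. f z - u z / E z) z"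
      by (rule fwd_diff_zero_everywhere[OF E(1) holu f E(4) zn0 nzE, symmetric])
    also have "\<dots> = (fwd_diff c ^^ n) f z -
        (\<Sum>k\<le>n. (-1) ^ (n - k) * of_nat (n choose k) * (u (z + of_nat k * c) / E (z + of_nat k * c)))"
      unfolding fwd_diff_explicit by (simp add: right_diff_distrib sum_subtractf)
    also have "(fwd_diff c ^^ n) f z = u z" by (simp add: u_def)
    also have "(\<Sum>k\<le>n. (-1) ^ (n - k) * of_nat (n choose k) * (u (z + of_nat k * c) / E (z + of_nat k * c))) = u z * T z"
      unfolding T_def sum_distrib_left uk by (intro sum.cong) (auto simp: mult_ac)
    finally show ?thesis using uz by (simp add: algebra_simps)
  qed
  \<comment> \<open>The division by \<open>u z\<close> is undone by continuity. The identity is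
    applied at zeros of \<open>b\<close> and their translates, where \<open>u\<close> may
    vanish.\<close>
  have star: "T z = 1" if nzE: "\<And>k. k \<le> n \<Longrightarrow> E (z + of_nat k * c) \<noteq> 0" for z
  proof (rule isCont_eventually_const[where A = T])
    have Esh: "isCont (\<lambda>z. E (z + h)) z" for h by (intro isCont_shift entire_isCont E)
    show "isCont T z"
      unfolding T_def by (intro continuous_intros Esh) (use nzE in auto)
    have "\<forall>\<^sub>F y in at z. \<forall>k\<in>{..n}. E (y + of_nat k * c) \<noteq> 0"
    proof (intro eventually_ball_finite ballI)
      fix k assume "k \<in> {..n}"
      then show "\<forall>\<^sub>F y in at z. E (y + of_nat k * c) \<noteq> 0"
        using Esh[of "of_nat k * c"] nzE
          by (intro tendsto_imp_eventually_ne) (auto simp: isCont_def)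
    qed simp
    then show "\<forall>\<^sub>F y in at z. T y = 1"
      using entire_eventually_nonzero[OF holu ntu, of z] by eventually_elim (use star0 in auto)
  qed
  interpret difference_system c u E P n m
  proof
    show "card K < m" if "finite K" "\<And>j. j \<in> K \<Longrightarrow> zmult E (w + of_nat j * c) \<le> q"
      "zmult E (w + of_nat i * c) > q" for w q i K
      by (rule multiplicity_chain[OF E(1,2) holu f E(3) assms(1) zm that])
    show "(\<Sum>k\<le>n. (-1) ^ (n - k) * of_nat (n choose k) *
      (\<Prod>j<k. 1 + exp (poly P (z + of_nat j * c))) / E (z + of_nat k * c)) = 1"
      if "\<And>k. k \<le> n \<Longrightarrow> E (z + of_nat k * c) \<noteq> 0" for z
      using star[OF that] by (simp add: T_def)
  qed (use c0 assms(1,2) E grE holu ntu ush in auto)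
  obtain e where e: "\<And>z. E z = e" using E_constant by blast
  have e0: "e \<noteq> 0" using E(2) e by simp
  obtain p where p: "P = [:p:]" using degree_P degree_eq_zeroE by blast
  \<comment> \<open>Now \<open>f - a = u / e\<close> off a sparse set, so the claim is the equation
    \<open>u (z + c) - u z = exp p * u z\<close> divided by \<open>e\<close>.\<close>
  have "\<forall>\<^sub>\<approx>z. fwd_diff c f z = exp p * f z + fwd_diff c a z - exp p * a z"
    using E(4) cosparse_shift[OF E(4), of c]
  proof eventually_elim
    case (elim z)
    have up: "u (z + c) = (1 + exp p) * u z" using ush[of z] p by simp
    show ?case unfolding fwd_diff_def elim e up by (simp add: algebra_simps add_divide_distrib)
  qed
  then show ?thesis by (intro exI[of _ "exp p"]) simp
qed

end
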